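(* Consider the LCQ queueing system of size $n$ described in the context, and let $(\mathbf{v}(\cdot),\chi)$ be the limit in distribution of $(\mathbf{u}(\cdot),\xi)$ along a convergent subsequence of $\{n\}$. Then: (a) the limit measure $\chi$ satisfies $\chi([0,t)\times A)=\int_0^t\pi_{\mathbf{v}(s)}(A)\,ds$ for all $t>0$ and Borel $A\subseteq\Omega$, where for each $s>0$, $\pi_{\mathbf{v}(s)}$ is an equilibrium (stationary) distribution of the process $\omega^{\mathbf{v}(s)}(\cdot)$ such that $\pi_{\mathbf{v}(s)}(\omega_k=\infty)=1$ whenever $v_k(s)>0$; (b) the limit trajectory $\mathbf{v}(\cdot)$ satisfies, for $k=1,2,\dots$, \[\frac{d}{dt}v_k(t)=\lambda(v_{k-1}(t)-v_k(t))-E_{\pi_{\mathbf{v}(t)}}\big[(1-q)^{\omega_{k+1}}-(1-q)^{\omega_k}\big],\] where $E_{\pi_{\mathbf{v}(t)}}$ denotes expectation with respect to $\pi_{\mathbf{v}(t)}$.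
   Context: System model: $n$ queues; packets arrive to each queue by independent Poisson processes of rate $\lambda<1$; transmission times are i.i.d. exponential with mean $n^{-1}$; at most one queue transmits at a time; at each scheduling instant each queue is independently connected with probability $q\in(0,1]$, independently of queue lengths and the past. The LCQ policy transmits from a longest connected queue (idling an exponential time of mean $n^{-1}$ if none is nonempty and connected). Let $m_k(t)$ be the number of queues with at least $k$ packets, $u_k(t)=m_k(t)/n$, $\mathbf{m}(t)=\{m_k(t)\}$, $\mathbf{u}(t)=\{u_k(t)\}$. Then $\mathbf{u}(\cdot)$ is a Markov process on $U=\{\mathbf{u}:1=u_0\ge u_1\ge\cdots\ge0\}$ (metric $\rho(\mathbf{u},\mathbf{u}')=\sup_{k>0}|u_k-u'_k|/k$) with jumps $\mathbf{u}\to\mathbf{u}+n^{-1}\mathbf{e}_k$ at rate $n\lambda(u_{k-1}-u_k)$ and $\mathbf{u}\to\mathbf{u}-n^{-1}\mathbf{e}_k$ at rate $n((1-q)^{nu_{k+1}}-(1-q)^{nu_k})$, $k\ge1$, where $\mathbf{e}_k$ has $1$ in coordinate $k$ and $0$ elsewhere. Let $\Omega$ be the set of sequences $\omega=\{\omega_k\}_{k\ge0}$ with $\omega_k\in\mathbb{Z}_+\cup\{\infty\}$, $\omega_0=\infty$, $\omega_k\ge\omega_{k+1}$, with metric $\rho_o(\omega,\omega')=\rho(h(\omega),h(\omega'))$ where $h(\omega)=\{(1+\omega_k)^{-1}\}_{k\ge0}$ (conventions $1+\infty=\infty$, $1/\infty=0$); $\Omega$ is compact. Let $\mathcal{L}$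 be the set of measures $\mu$ on $[0,\infty)\times\Omega$ with $\mu([0,t)\times\Omega)=t$ for all $t>0$, topologized by weak convergence of restrictions to $[0,t)\times\Omega$ for each $t$. The random element $\xi\in\mathcal{L}$ is $\xi([0,t)\times A)=\int_0^t1\{\mathbf{m}(s)\in A\}ds$ ($\mathbf{m}(s)$ regarded as an element of $\Omega$). For fixed $\mathbf{u}\in U$, $\omega^{\mathbf{u}}(\cdot)$ is the Markov process on $\Omega$ with transitions $\omega\to\omega+\mathbf{e}_k$ at rate $\lambda(u_{k-1}-u_k)$ and $\omega\to\omega-\mathbf{e}_k$ at rate $(1-q)^{\omega_{k+1}}-(1-q)^{\omega_k}$, $k\ge1$ (with $\infty\pm1=\infty$, $(1-q)^\infty=0$).
   Formalization: In (b) the differential equation is proved in integral form for all t ≥ 0 and as a derivative for almost every t > 0, since v_k can have kinks (e.g. when v_1 hits 0) where it is not differentiable; conclusions hold almost surely and λ > 0 is assumed. *)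

theory Defs
  imports "HOL-Probability.Probability"
begin

definition Uset :: "(nat \<Rightarrow> real) set" where
  "Uset = {u. u 0 = 1 \<and> (\<forall>k. u (Suc k) \<le> u k) \<and> (\<forall>k. 0 \<le> u k)}"

definition rhoU :: "(nat \<Rightarrow> real) \<Rightarrow> (nat \<Rightarrow> real) \<Rightarrow> real" where
  "rhoU u u' = (SUP k\<in>{1..}. \<bar>u k - u' k\<bar> / real k)"

definition OmegaS :: "(nat \<Rightarrow> enat) set" where
  "OmegaS = {w. w 0 = \<infinity> \<and> (\<forall>k. w (Suc k) \<le> w k)}"

definition hO :: "enat \<Rightarrow> real" where
  "hO e = (case e of enat j \<Rightarrow> 1 / (1 + real j) | \<infinity> \<Rightarrow> 0)"

definition rhoO :: "(nat \<Rightarrow> enat) \<Rightarrow> (nat \<Rightarrow> enat) \<Rightarrow> real" where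
  "rhoO w w' = (SUP k\<in>{1..}. \<bar>hO (w k) - hO (w' k)\<bar> / real k)"

definition pw :: "real \<Rightarrow> enat \<Rightarrow> real" where
  "pw q e = (case e of enat j \<Rightarrow> (1 - q) ^ j | \<infinity> \<Rightarrow> 0)"

text \<open>Generator of omega^u: omega -> omega + e_k at rate lam (u_{k-1} - u_k), omega -> omega - e_k
  at rate (1-q)^{omega_{k+1}} - (1-q)^{omega_k}, k >= 1 (infinity +- 1 = infinity).\<close>
definition genO :: "real \<Rightarrow> real \<Rightarrow> (nat \<Rightarrow> real) \<Rightarrow> ((nat \<Rightarrow> enat) \<Rightarrow> real) \<Rightarrow> (nat \<Rightarrow> enat) \<Rightarrow> real" where
  "genO lam q u f w =
     (\<Sum>j. lam * (u j - u (Suc j)) * (f (w(Suc j := w (Suc j) + 1)) - f w)) +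
     (\<Sum>j. (pw q (w (Suc (Suc j))) - pw q (w (Suc j))) * (f (w(Suc j := w (Suc j) - 1)) - f w))"

text \<open>pi is an equilibrium (stationary) distribution of the bounded-rate chain omega^u:
  the integral of the generator applied to any bounded function vanishes.\<close>
definition stationaryO :: "real \<Rightarrow> real \<Rightarrow> (nat \<Rightarrow> real) \<Rightarrow> (nat \<Rightarrow> enat) pmf \<Rightarrow> bool" where
  "stationaryO lam q u \<pi> \<longleftrightarrow>
     (\<forall>f. bounded (range f) \<longrightarrow> measure_pmf.expectation \<pi> (genO lam q u f) = 0)"

section \<open>The LCQ system of size n (via the counts m_k = n u_k)\<close>

definition Sn :: "nat \<Rightarrow> (nat \<Rightarrow> nat) set" where
  "Sn n = {m. m 0 = n \<and> (\<forall>k. m (Suc k) \<le> m k)}"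

text \<open>Generator: m -> m + e_k at rate n lam (u_{k-1}-u_k) = lam (m_{k-1}-m_k),
  m -> m - e_k at rate n ((1-q)^{m_{k+1}} - (1-q)^{m_k}), k >= 1.\<close>
definition genN :: "real \<Rightarrow> real \<Rightarrow> nat \<Rightarrow> ((nat \<Rightarrow> nat) \<Rightarrow> real) \<Rightarrow> (nat \<Rightarrow> nat) \<Rightarrow> real" where
  "genN lam q n f m =
     (\<Sum>j. lam * (real (m j) - real (m (Suc j))) * (f (m(Suc j := Suc (m (Suc j)))) - f m)) +
     (\<Sum>j. real n * ((1 - q) ^ (m (Suc (Suc j))) - (1 - q) ^ (m (Suc j)))
            * (f (m(Suc j := m (Suc j) - 1)) - f m))"

definition uOf :: "nat \<Rightarrow> (nat \<Rightarrow> nat) \<Rightarrow> (nat \<Rightarrow> real)" where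
  "uOf n m = (\<lambda>k. real (m k) / real n)"

definition toO :: "(nat \<Rightarrow> nat) \<Rightarrow> (nat \<Rightarrow> enat)" where
  "toO m = (\<lambda>k. if k = 0 then \<infinity> else enat (m k))"

text \<open>X is (a cadlag version of) the Markov process with generator genN on Sn n, with arbitrary
  initial law, characterised by the martingale problem w.r.t. its natural filtration.\<close>
definition lcq_chain :: "real \<Rightarrow> real \<Rightarrow> nat \<Rightarrow> 'a measure \<Rightarrow> ('a \<Rightarrow> real \<Rightarrow> nat \<Rightarrow> nat) \<Rightarrow> bool" where
  "lcq_chain lam q n M X \<longleftrightarrow>
     prob_space M \<and>
     (\<forall>x t. 0 \<le> t \<longrightarrow> X x t \<in> Sn n) \<and>
     (\<forall>t. 0 \<le> t \<longrightarrow> (\<lambda>x. X x t) \<in> measurable M (count_space UNIV)) \<and>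
     (\<forall>x. (\<forall>t. 0 \<le> t \<longrightarrow> (\<exists>\<delta>>0. \<forall>s. t \<le> s \<and> s < t + \<delta> \<longrightarrow> X x s = X x t)) \<and>
          (\<forall>t. 0 < t \<longrightarrow> (\<exists>\<delta>>0. \<forall>s s'. t - \<delta> < s \<and> s < t \<and> t - \<delta> < s' \<and> s' < t
                                     \<longrightarrow> X x s = X x s'))) \<and>
     (\<forall>f. bounded (range f) \<longrightarrow>
        (\<forall>s t rs gs. 0 \<le> s \<longrightarrow> s \<le> t \<longrightarrow>
           (\<forall>i<length rs. 0 \<le> rs ! i \<and> rs ! i \<le> s) \<longrightarrow>
           (\<forall>i<length rs. bounded (range (gs i :: (nat \<Rightarrow> nat) \<Rightarrow> real))) \<longrightarrow>
           (\<integral>x. (f (X x t) - f (X x s) - (LINT r:{s..t}|lborel. genN lam q n f (X x r)))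
                  * (\<Prod>i<length rs. gs i (X x (rs ! i))) \<partial>M) = 0))"

definition SpaceL :: "(real \<times> (nat \<Rightarrow> enat)) measure" where
  "SpaceL = borel \<Otimes>\<^sub>M count_space UNIV"

text \<open>xi([0,t) x A) = int_0^t 1{m(s) in A} ds.\<close>
definition occ :: "(real \<Rightarrow> nat \<Rightarrow> nat) \<Rightarrow> (real \<times> (nat \<Rightarrow> enat)) measure" where
  "occ x = distr (restrict_space lborel {0..}) SpaceL (\<lambda>s. (s, toO (x s)))"

definition Lset :: "(real \<times> (nat \<Rightarrow> enat)) measure set" where
  "Lset = {\<mu>. sets \<mu> = sets SpaceL \<and> emeasure \<mu> (UNIV - {0..} \<times> OmegaS) = 0 \<and>
               (\<forall>t>0. emeasure \<mu> ({0..<t} \<times> OmegaS) = ennreal t)}"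

definition cont_on_strip :: "real \<Rightarrow> (real \<times> (nat \<Rightarrow> enat) \<Rightarrow> real) \<Rightarrow> bool" where
  "cont_on_strip t f \<longleftrightarrow>
     (\<forall>ss ws s w. (\<forall>j. ss j \<in> {0..<t} \<and> ws j \<in> OmegaS) \<longrightarrow> s \<in> {0..<t} \<longrightarrow> w \<in> OmegaS \<longrightarrow>
        ss \<longlonglongrightarrow> s \<longrightarrow> (\<lambda>j. rhoO (ws j) w) \<longlonglongrightarrow> 0 \<longrightarrow>
        (\<lambda>j. f (ss j, ws j)) \<longlonglongrightarrow> f (s, w))"

definition Lconv :: "(nat \<Rightarrow> (real \<times> (nat \<Rightarrow> enat)) measure) \<Rightarrow> (real \<times> (nat \<Rightarrow> enat)) measure \<Rightarrow> bool" where
  "Lconv \<mu>s \<mu> \<longleftrightarrow>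
     (\<forall>t>0. \<forall>f. f \<in> borel_measurable SpaceL \<longrightarrow> bounded (f ` ({0..<t} \<times> OmegaS)) \<longrightarrow>
        cont_on_strip t f \<longrightarrow>
        (\<lambda>j. LINT z:({0..<t} \<times> OmegaS)|\<mu>s j. f z) \<longlonglongrightarrow> (LINT z:({0..<t} \<times> OmegaS)|\<mu>. f z))"

definition Dsp :: "(real \<Rightarrow> nat \<Rightarrow> real) set" where
  "Dsp = {x. (\<forall>t. 0 \<le> t \<longrightarrow> x t \<in> Uset) \<and>
             (\<forall>t. 0 \<le> t \<longrightarrow> ((\<lambda>s. rhoU (x s) (x t)) \<longlongrightarrow> 0) (at_right t)) \<and>
             (\<forall>t. 0 < t \<longrightarrow> (\<exists>y\<in>Uset. ((\<lambda>s. rhoU (x s) y) \<longlongrightarrow> 0) (at_left t)))}"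

definition gammaJ :: "(real \<Rightarrow> real) \<Rightarrow> real" where
  "gammaJ l = Sup {\<bar>ln ((l s - l t) / (s - t))\<bar> | s t. 0 \<le> t \<and> t < s}"

text \<open>Time changes (Ethier-Kurtz): strictly increasing maps of [0,infinity) onto itself with gamma finite.\<close>
definition LambdaJ :: "(real \<Rightarrow> real) set" where
  "LambdaJ = {l. strict_mono_on {0..} l \<and> l ` {0..} = {0..} \<and>
                 bdd_above {\<bar>ln ((l s - l t) / (s - t))\<bar> | s t. 0 \<le> t \<and> t < s}}"

text \<open>J1 convergence, as characterised in Ethier-Kurtz, Prop. 3.5.3.\<close>
definition J1conv :: "(nat \<Rightarrow> real \<Rightarrow> nat \<Rightarrow> real) \<Rightarrow> (real \<Rightarrow> nat \<Rightarrow> real) \<Rightarrow> bool" where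
  "J1conv xs x \<longleftrightarrow>
     (\<exists>ls. (\<forall>m. ls m \<in> LambdaJ) \<and> (\<lambda>m. gammaJ (ls m)) \<longlonglongrightarrow> 0 \<and>
           (\<forall>T>0. (\<lambda>m. SUP t\<in>{0..T}. rhoU (xs m t) (x (ls m t))) \<longlonglongrightarrow> 0))"

type_synonym DL = "(real \<Rightarrow> nat \<Rightarrow> real) \<times> (real \<times> (nat \<Rightarrow> enat)) measure"

text \<open>Bounded continuous functionals on D x L (functionals only see paths on [0,infinity)).\<close>
definition Ftest :: "(DL \<Rightarrow> real) \<Rightarrow> bool" where
  "Ftest F \<longleftrightarrow>
     bounded (F ` (Dsp \<times> Lset)) \<and>
     (\<forall>x \<mu>. F (x, \<mu>) = F (\<lambda>t. x (max 0 t), \<mu>)) \<and>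
     (\<forall>xs x \<mu>s \<mu>. (\<forall>m. xs m \<in> Dsp \<and> \<mu>s m \<in> Lset) \<longrightarrow> x \<in> Dsp \<longrightarrow> \<mu> \<in> Lset \<longrightarrow>
        J1conv xs x \<longrightarrow> Lconv \<mu>s \<mu> \<longrightarrow> (\<lambda>m. F (xs m, \<mu>s m)) \<longlonglongrightarrow> F (x, \<mu>))"

definition conv_dist :: "(nat \<Rightarrow> 'a measure) \<Rightarrow> (nat \<Rightarrow> 'a \<Rightarrow> DL) \<Rightarrow> 'b measure \<Rightarrow> ('b \<Rightarrow> DL) \<Rightarrow> bool" where
  "conv_dist M Y P Z \<longleftrightarrow>
     (\<forall>F. Ftest F \<longrightarrow>
        (\<forall>j. (\<lambda>x. F (Y j x)) \<in> borel_measurable (M j)) \<and>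
        (\<lambda>x. F (Z x)) \<in> borel_measurable P \<and>
        (\<lambda>j. \<integral>x. F (Y j x) \<partial>M j) \<longlonglongrightarrow> (\<integral>x. F (Z x) \<partial>P))"

end

theory Submission
  imports Defs
begin

text \<open>
  In the system of size n the total jump rate is at most n(lam + 1), so the martingale of a function of
  the counts with bounded jumps has second moment of order n; divided by n it vanishes in the limit. For
  a coordinate this gives the integral equation of the fluid limit, smoothed in time because evaluation
  at a fixed time is not continuous for the J1 topology. For a cylinder function of the counts, which
  move n times faster than their proportions, it says that the limiting occupation measure annihilates
  the generator with frozen rates. Finally, where a proportion stays positive the corresponding count
  tends to infinity.

  All three statements are zero sets of continuous functionals on D x L, so they pass to the limit.
  A nonincreasing sequence of extended naturals is eventually constant, hence the space of fast
  variables is countable, and the limiting occupation measure disintegrates through Radon-Nikodym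
  densities into a family of probability mass functions, which are stationary for almost every time. On
  the exceptional null set the point mass at the constant infinite sequence is chosen: it is absorbing,
  so it is stationary for every choice of frozen rates. Lebesgue's differentiation theorem turns the
  integral equation into the differential one.
\<close>

section \<open>Integration over intervals\<close>

lemma set_integrable_bounded:
  fixes f :: "'a \<Rightarrow> 'b::{banach, second_countable_topology}"
  assumes "A \<in> sets M" "emeasure M A < \<infinity>" "f \<in> borel_measurable M"
    and "\<And>x. x \<in> A \<Longrightarrow> norm (f x) \<le> B"
  shows "set_integrable M A f"
  unfolding set_integrable_def
  by (rule integrableI_bounded_set_indicator[where B=B]) (use assms in auto)

lemma set_integrable_bounded_Icc:
  fixes f :: "real \<Rightarrow> 'b::{banach, second_countable_topology}"
  assumes "f \<in> borel_measurable borel" and "\<And>s. s \<in> {a..b} \<Longrightarrow> norm (f s) \<le> B"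
  shows "set_integrable lborel {a..b} f"
  by (rule set_integrable_bounded) (use assms in \<open>auto simp: emeasure_lborel_Icc_eq\<close>)

lemma abs_set_integral_le_Icc:
  fixes f :: "real \<Rightarrow> real"
  assumes f: "set_integrable lborel {a..b} f" and B: "\<And>s. s \<in> {a..b} \<Longrightarrow> \<bar>f s\<bar> \<le> B" and "a \<le> b"
  shows "\<bar>LINT s:{a..b}|lborel. f s\<bar> \<le> B * (b - a)"
proof -
  have "\<bar>LINT s:{a..b}|lborel. f s\<bar> \<le> (LINT s:{a..b}|lborel. \<bar>f s\<bar>)"
    using set_integral_norm_bound[OF f] by simp
  also have "\<dots> \<le> (LINT s:{a..b}|lborel. B)"
    by (intro set_integral_mono set_integrable_abs f set_integrable_bounded_Icc[where B="\<bar>B\<bar>"])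
       (use B in auto)
  also have "\<dots> = B * (b - a)"
    using \<open>a \<le> b\<close> by (subst set_integral_const) auto
  finally show ?thesis .
qed

lemma set_integral_Icc_split:
  fixes f :: "real \<Rightarrow> 'b::{banach, second_countable_topology}"
  assumes f: "set_integrable lborel {a..c} f" and "a \<le> b" "b \<le> c"
  shows "(LINT s:{a..c}|lborel. f s) = (LINT s:{a..b}|lborel. f s) + (LINT s:{b..c}|lborel. f s)"
proof -
  have "(LINT s:{a..b} \<union> {b..c}|lborel. f s) = (LINT s:{a..b}|lborel. f s) + (LINT s:{b..c}|lborel. f s)"
  proof (rule set_integral_Un_AE)
    show "AE x in lborel. \<not> (x \<in> {a..b} \<and> x \<in> {b..c})"
      using AE_lborel_singleton[of b] by eventually_elim auto
  qed (use f assms in \<open>auto intro: set_integrable_subset\<close>)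
  then show ?thesis
    using assms by (simp add: ivl_disj_un_two_touch)
qed

lemma borel_measurable_interval_integral:
  fixes f :: "'a \<Rightarrow> real \<Rightarrow> real"
  assumes [measurable]: "case_prod f \<in> borel_measurable (M \<Otimes>\<^sub>M lborel)"
    "a \<in> borel_measurable M" "b \<in> borel_measurable M"
  shows "(\<lambda>x. LINT s:{a x..b x}|lborel. f x s) \<in> borel_measurable M"
  unfolding set_lebesgue_integral_def
proof (rule lborel.borel_measurable_lebesgue_integral)
  have "(\<lambda>z. if a (fst z) \<le> snd z \<and> snd z \<le> b (fst z) then f (fst z) (snd z) else 0)
      \<in> borel_measurable (M \<Otimes>\<^sub>M lborel)"
    by measurable
  then show "(\<lambda>(x, s). indicator {a x..b x} s *\<^sub>R f x s) \<in> borel_measurable (M \<Otimes>\<^sub>M lborel)"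
    by (rule measurable_cong[THEN iffD1, rotated]) (auto simp: indicator_def)
qed

lemma continuous_on_integral_upto:
  fixes f :: "real \<Rightarrow> real"
  assumes f: "set_integrable lborel {a..b} f"
  shows "continuous_on {a..b} (\<lambda>t. LINT s:{a..t}|lborel. f s)"
proof -
  have "(LINT s:{a..t}|lborel. f s) = integral {a..t} f" if "t \<in> {a..b}" for t
    using set_integrable_subset[OF f, of "{a..t}"] that by (intro set_borel_integral_eq_integral) auto
  then show ?thesis
    using indefinite_integral_continuous_1[OF set_borel_integral_eq_integral(1)[OF f]]
    by (rule continuous_on_cong[THEN iffD2, OF refl])
qed

lemma integrable_product_lborel:
  fixes f g :: "real \<Rightarrow> real"
  assumes f: "integrable lborel f" and g: "integrable lborel g"
  shows "integrable (lborel \<Otimes>\<^sub>M lborel) (\<lambda>(x, y). f x * g y)"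
proof (rule lborel_pair.Fubini_integrable)
  have [measurable]: "f \<in> borel_measurable borel" "g \<in> borel_measurable borel"
    using borel_measurable_integrable[OF f] borel_measurable_integrable[OF g] by simp_all
  show "(\<lambda>(x, y). f x * g y) \<in> borel_measurable (lborel \<Otimes>\<^sub>M lborel)"
    by measurable
  show "integrable lborel (\<lambda>x. LINT y|lborel. norm (case (x, y) of (x, y) \<Rightarrow> f x * g y))"
    using f by (simp add: abs_mult integrable_abs)
  show "AE x in lborel. integrable lborel (\<lambda>y. case (x, y) of (x, y) \<Rightarrow> f x * g y)"
    using g by simp
qed

lemma integral_triangle_Fubini:
  fixes f g :: "real \<Rightarrow> real"
  assumes f: "set_integrable lborel {a..b} f" and g: "set_integrable lborel {a..b} g"
  shows "(LINT r:{a..b}|lborel. f r * (LINT s:{r..b}|lborel. g s)) =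
         (LINT s:{a..b}|lborel. g s * (LINT r:{a..s}|lborel. f r))"
proof -
  define f' where "f' r = indicator {a..b} r * f r" for r
  define g' where "g' s = indicator {a..b} s * g s" for s
  have int: "integrable lborel f'" "integrable lborel g'"
    using f g by (simp_all add: f'_def[abs_def] g'_def[abs_def] set_integrable_def)
  have "integrable (lborel \<Otimes>\<^sub>M lborel) (\<lambda>(r, s). indicator {(r, s). r \<le> s} (r, s) *\<^sub>R (f' r * g' s))"
  proof -
    have "{z \<in> space (lborel \<Otimes>\<^sub>M lborel). fst z \<le> (snd z :: real)} \<in> sets (lborel \<Otimes>\<^sub>M lborel)"
      by measurable
    from integrable_mult_indicator[OF this integrable_product_lborel[OF int]] show ?thesis
      by (simp add: split_beta' space_pair_measure)
  qed
  from lborel_pair.Fubini_integral[OF this]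
  have swap: "(LINT r|lborel. LINT s|lborel. indicator {(r, s). r \<le> s} (r, s) *\<^sub>R (f' r * g' s)) =
      (LINT s|lborel. LINT r|lborel. indicator {(r, s). r \<le> s} (r, s) *\<^sub>R (f' r * g' s))"
    by simp
  have inner_s: "(LINT s|lborel. indicator {(r, s). r \<le> s} (r, s) *\<^sub>R (f' r * g' s)) =
      indicator {a..b} r *\<^sub>R (f r * (LINT s:{r..b}|lborel. g s))" for r
  proof -
    have "(LINT s|lborel. indicator {(r, s). r \<le> s} (r, s) *\<^sub>R (f' r * g' s)) =
        (LINT s|lborel. f' r * (indicator {r..b} s *\<^sub>R g s))"
      by (rule Bochner_Integration.integral_cong) (auto simp: f'_def g'_def indicator_def)
    then show ?thesis
      by (simp add: set_lebesgue_integral_def f'_def)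
  qed
  have inner_r: "(LINT r|lborel. indicator {(r, s). r \<le> s} (r, s) *\<^sub>R (f' r * g' s)) =
      indicator {a..b} s *\<^sub>R (g s * (LINT r:{a..s}|lborel. f r))" for s
  proof -
    have "(LINT r|lborel. indicator {(r, s). r \<le> s} (r, s) *\<^sub>R (f' r * g' s)) =
        (LINT r|lborel. g' s * (indicator {a..s} r *\<^sub>R f r))"
      by (rule Bochner_Integration.integral_cong) (auto simp: f'_def g'_def indicator_def)
    then show ?thesis
      by (simp add: set_lebesgue_integral_def g'_def)
  qed
  show ?thesis
    using swap unfolding inner_s inner_r by (simp add: set_lebesgue_integral_def)
qed

lemma integral_of_integral_upto:
  fixes f :: "real \<Rightarrow> real"
  assumes f: "set_integrable lborel {a..b} f"
  shows "(LINT s:{a..b}|lborel. LINT r:{a..s}|lborel. f r) = (LINT s:{a..b}|lborel. (b - s) * f s)"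
proof -
  have "(LINT s:{a..b}|lborel. (b - s) * f s) = (LINT r:{a..b}|lborel. f r * (LINT s:{r..b}|lborel. 1))"
    by (rule set_lebesgue_integral_cong) (auto simp: set_integral_const)
  also have "\<dots> = (LINT s:{a..b}|lborel. 1 * (LINT r:{a..s}|lborel. f r))"
    by (rule integral_triangle_Fubini[OF f]) (rule set_integrable_bounded_Icc[where B=1], auto)
  finally show ?thesis
    by simp
qed

lemma set_integrable_times_integral:
  fixes f g :: "real \<Rightarrow> real"
  assumes f: "set_integrable lborel {a..b} f" and g: "set_integrable lborel {a..b} g"
  shows "set_integrable lborel {a..b} (\<lambda>s. f s * (LINT r:{a..s}|lborel. g r))"
    and "set_integrable lborel {a..b} (\<lambda>s. f s * (LINT r:{s..b}|lborel. g r))"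
proof -
  let ?G = "\<lambda>s. LINT r:{a..s}|lborel. g r"
  have "bounded (?G ` {a..b})"
    by (intro compact_imp_bounded compact_continuous_image continuous_on_integral_upto g compact_Icc)
  then obtain B where B: "\<And>s. s \<in> {a..b} \<Longrightarrow> \<bar>?G s\<bar> \<le> B"
    unfolding bounded_iff by fastforce
  have [measurable]: "(\<lambda>s. indicator {a..b} s * ?G s) \<in> borel_measurable borel"
    using borel_measurable_continuous_on_indicator[OF _ continuous_on_integral_upto[OF g]] by simp
  have [measurable]: "(\<lambda>s. indicator {a..b} s * f s) \<in> borel_measurable borel"
    using borel_measurable_integrable[OF f[unfolded set_integrable_def]] by simp
  show *: "set_integrable lborel {a..b} (\<lambda>s. f s * ?G s)"
    unfolding set_integrable_def
  proof (rule Bochner_Integration.integrable_bound)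
    show "integrable lborel (\<lambda>s. B * (indicator {a..b} s * f s))"
      using f by (simp add: set_integrable_def)
    have "indicator {a..b} s *\<^sub>R (f s * ?G s) = (indicator {a..b} s * f s) * (indicator {a..b} s * ?G s)" for s
      by (simp add: indicator_def)
    then show "(\<lambda>s. indicator {a..b} s *\<^sub>R (f s * ?G s)) \<in> borel_measurable lborel"
      by (simp only: ) measurable
    show "AE s in lborel. norm (indicator {a..b} s *\<^sub>R (f s * ?G s)) \<le> norm (B * (indicator {a..b} s * f s))"
    proof (rule AE_I2)
      fix s
      have "\<bar>f s\<bar> * \<bar>?G s\<bar> \<le> \<bar>f s\<bar> * \<bar>B\<bar>" if "s \<in> {a..b}"
        using B[OF that] by (intro mult_left_mono) auto
      then show "norm (indicator {a..b} s *\<^sub>R (f s * ?G s)) \<le> norm (B * (indicator {a..b} s * f s))"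
        by (simp add: indicator_def abs_mult mult.commute)
    qed
  qed
  have split: "f s * (LINT r:{s..b}|lborel. g r) = f s * ?G b - f s * ?G s" if "s \<in> {a..b}" for s
    using set_integral_Icc_split[OF g, of s] that by (simp add: algebra_simps)
  have "set_integrable lborel {a..b} (\<lambda>s. f s * ?G b - f s * ?G s)"
    by (intro set_integral_diff(1) * set_integrable_mult_left f)
  moreover have "set_integrable lborel {a..b} (\<lambda>s. f s * (LINT r:{s..b}|lborel. g r)) \<longleftrightarrow>
      set_integrable lborel {a..b} (\<lambda>s. f s * ?G b - f s * ?G s)"
    by (rule set_integrable_cong[OF refl refl]) (rule split)
  ultimately show "set_integrable lborel {a..b} (\<lambda>s. f s * (LINT r:{s..b}|lborel. g r))"
    by (rule iffD2[rotated])
qed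

lemma integral_triangle_square:
  fixes f :: "real \<Rightarrow> real"
  assumes f: "set_integrable lborel {a..b} f"
  shows "2 * (LINT r:{a..b}|lborel. f r * (LINT s:{r..b}|lborel. f s)) = (LINT r:{a..b}|lborel. f r)\<^sup>2"
proof -
  let ?A = "LINT r:{a..b}|lborel. f r"
  note int = set_integrable_times_integral[OF f f]
  have "2 * (LINT r:{a..b}|lborel. f r * (LINT s:{r..b}|lborel. f s)) =
      (LINT r:{a..b}|lborel. f r * (LINT s:{r..b}|lborel. f s) + f r * (LINT s:{a..r}|lborel. f s))"
    using set_integral_add(2)[OF int(2,1)] integral_triangle_Fubini[OF f f] by simp
  also have "\<dots> = (LINT r:{a..b}|lborel. f r * ?A)"
    by (rule set_lebesgue_integral_cong)
       (use set_integral_Icc_split[OF f] in \<open>auto simp: distrib_left[symmetric] add.commute\<close>)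
  also have "\<dots> = ?A\<^sup>2"
    by (simp add: power2_eq_square)
  finally show ?thesis .
qed

section \<open>Lebesgue differentiation\<close>

lemma AE_lborel_uminus:
  assumes "AE x in lborel. P x"
  shows "AE x in lborel. P (- x :: real)"
proof -
  obtain N where N: "N \<in> null_sets lborel" "{x. \<not> P x} \<subseteq> N"
    using assms by (auto simp: eventually_ae_filter)
  have [measurable]: "N \<in> sets borel"
    using N(1) by auto
  have "AE x in lborel. 0 + (- 1) * x \<notin> N"
    by (rule AE_borel_affine[of "- 1" "\<lambda>x. x \<notin> N" 0]) (use AE_not_in[OF N(1)] in auto)
  then show ?thesis
    by eventually_elim (use N(2) in auto)
qed

lemma lebesgue_differentiation_at_right:
  fixes f :: "real \<Rightarrow> real"
  assumes "\<And>a b. f integrable_on {a..b}"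
  shows "AE x in lborel. ((\<lambda>h. integral {x..x + h} f / h) \<longlongrightarrow> f x) (at_right 0)"
proof -
  obtain N where N: "negligible N" and lim: "\<And>x e. x \<notin> N \<Longrightarrow> 0 < e \<Longrightarrow>
      \<exists>d>0. \<forall>h. 0 < h \<and> h < d \<longrightarrow> norm (integral (cbox x (x + h *\<^sub>R One)) f /\<^sub>R h ^ DIM(real) - f x) < e"
    using integrable_ccontinuous_explicit[of f] assms by (metis cbox_interval)
  have "AE x in lebesgue. x \<notin> N"
    using N by (intro AE_not_in) (simp add: negligible_iff_null_sets)
  then have "AE x in lborel. x \<notin> N"
    by (simp add: AE_completion_iff)
  then show ?thesis
  proof eventually_elim
    case (elim x)
    show ?case
      unfolding tendsto_iff eventually_at_right_field
    proof (intro allI impI)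
      fix e :: real
      assume "0 < e"
      with lim[OF elim this] show "\<exists>b>0. \<forall>h>0. h < b \<longrightarrow> dist (integral {x..x + h} f / h) (f x) < e"
        by (auto simp: dist_real_def divide_inverse mult.commute)
    qed
  qed
qed

lemma lebesgue_differentiation_at_left:
  fixes f :: "real \<Rightarrow> real"
  assumes f: "\<And>a b. f integrable_on {a..b}"
  shows "AE x in lborel. ((\<lambda>h. integral {x - h..x} f / h) \<longlongrightarrow> f x) (at_right 0)"
proof -
  have "(\<lambda>s. f (- s)) integrable_on {b..c}" for b c
    using f[of "- c" "- b"] Henstock_Kurzweil_Integration.integrable_reflect_real[of f "- b" "- c"] by simp
  from AE_lborel_uminus[OF lebesgue_differentiation_at_right[OF this]]
  show ?thesis
  proof eventually_elim
    case (elim x)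
    have "integral {- x .. - x + h} (\<lambda>s. f (- s)) = integral {x - h..x} f" for h
      using Henstock_Kurzweil_Integration.integral_reflect_real[of x "x - h" f] by simp
    then show ?case
      using elim by simp
  qed
qed

theorem lebesgue_differentiation:
  fixes f :: "real \<Rightarrow> real"
  assumes f: "\<And>b. set_integrable lborel {a..b} f"
  shows "AE t in lborel. a < t \<longrightarrow> ((\<lambda>\<tau>. LINT s:{a..\<tau>}|lborel. f s) has_real_derivative f t) (at t)"
proof -
  define g where "g s = (if a \<le> s then f s else 0)" for s
  have g_int: "set_integrable lborel {b..c} g" for b c
  proof -
    have "set_integrable lborel ({a..c} \<inter> {b..c}) f"
      by (rule set_integrable_subset[OF f[of c]]) auto
    then show ?thesis
      unfolding set_integrable_def
      by (rule Bochner_Integration.integrable_cong[THEN iffD1, rotated -1]) (auto simp: g_def indicator_def)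
  qed
  note g = set_borel_integral_eq_integral[OF g_int]
  have increment: "(LINT s:{a..c}|lborel. f s) - (LINT s:{a..b}|lborel. f s) = integral {b..c} g"
    if "a \<le> b" "b \<le> c" for b c
  proof -
    have "(LINT s:{b..c}|lborel. f s) = (LINT s:{b..c}|lborel. g s)"
      by (rule set_lebesgue_integral_cong) (use that in \<open>auto simp: g_def\<close>)
    then show ?thesis
      using set_integral_Icc_split[OF f[of c] that] g(2) by simp
  qed
  from lebesgue_differentiation_at_right[OF g(1)] lebesgue_differentiation_at_left[OF g(1)] show ?thesis
  proof (eventually_elim, intro impI)
    fix t
    assume right: "((\<lambda>h. integral {t..t + h} g / h) \<longlongrightarrow> g t) (at_right 0)"
      and left: "((\<lambda>h. integral {t - h..t} g / h) \<longlongrightarrow> g t) (at_right 0)" and t: "a < t"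
    let ?F = "\<lambda>\<tau>. LINT s:{a..\<tau>}|lborel. f s"
    have "((\<lambda>h. (?F (t + h) - ?F t) / h) \<longlongrightarrow> g t) (at_right 0)"
    proof (rule Lim_transform_eventually[OF right])
      show "\<forall>\<^sub>F h in at_right 0. integral {t..t + h} g / h = (?F (t + h) - ?F t) / h"
        unfolding eventually_at_right_field using t increment[of t] by (intro exI[of _ 1]) auto
    qed
    moreover have "((\<lambda>h. (?F (t + - h) - ?F t) / - h) \<longlongrightarrow> g t) (at_right 0)"
    proof (rule Lim_transform_eventually[OF left])
      have "integral {t - h..t} g / h = (?F (t + - h) - ?F t) / - h" if "0 < h" "h < t - a" for h
        using increment[of "t - h" t] that by (simp add: field_simps)
      then show "\<forall>\<^sub>F h in at_right 0. integral {t - h..t} g / h = (?F (t + - h) - ?F t) / - h"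
        unfolding eventually_at_right_field using t by (intro exI[of _ "t - a"]) auto
    qed
    ultimately show "(?F has_real_derivative f t) (at t)"
      using t unfolding DERIV_def filterlim_at_split filterlim_at_left_to_right by (simp add: g_def)
  qed
qed

lemma AE_zero_if_integrals_zero:
  fixes f :: "real \<Rightarrow> real"
  assumes f: "\<And>b. set_integrable lborel {a..b} f"
    and zero: "\<And>t. t \<in> \<rat> \<Longrightarrow> a < t \<Longrightarrow> (LINT s:{a..t}|lborel. f s) = 0"
  shows "AE t in lborel. a < t \<longrightarrow> f t = 0"
proof -
  let ?F = "\<lambda>t. LINT s:{a..t}|lborel. f s"
  have F_zero: "?F t = 0" if "a < t" for t
  proof (rule ccontr)
    assume "?F t \<noteq> 0"
    have "(?F \<longlongrightarrow> ?F t) (at_right t)"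
    proof -
      have "(?F \<longlongrightarrow> ?F t) (at t within {a..t + 1})"
        using continuous_on_integral_upto[OF f[of "t + 1"]] that by (simp add: continuous_on_def)
      then have "(?F \<longlongrightarrow> ?F t) (at t within {t..t + 1})"
        by (rule tendsto_within_subset) (use that in auto)
      then show ?thesis
        by (simp add: at_within_Icc_at_right)
    qed
    from tendsto_imp_eventually_ne[OF this \<open>?F t \<noteq> 0\<close>] obtain b where
      b: "t < b" "\<And>s. t < s \<Longrightarrow> s < b \<Longrightarrow> ?F s \<noteq> 0"
      unfolding eventually_at_right_field by blast
    obtain s where "s \<in> \<rat>" "t < s" "s < b"
      using Rats_dense_in_real[OF b(1)] by blast
    then show False
      using b(2)[of s] zero[of s] that by simp
  qed
  from lebesgue_differentiation[of a f, OF f] show ?thesis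
  proof (eventually_elim, intro impI)
    fix t
    assume deriv: "a < t \<longrightarrow> (?F has_real_derivative f t) (at t)" and t: "a < t"
    have "((\<lambda>_. 0) has_real_derivative f t) (at t)"
      by (rule has_field_derivative_transform_within_open[of ?F _ _ "{a<..}"]) (use deriv t F_zero in auto)
    then show "f t = 0"
      using DERIV_unique DERIV_const by blast
  qed
qed

section \<open>Right-continuous paths\<close>

lemma grid_points_tendsto_right:
  fixes s :: real
  shows "filterlim (\<lambda>i. real_of_int (\<lfloor>real (Suc i) * s\<rfloor> + 1) / real (Suc i)) (at_right s) sequentially"
proof -
  let ?\<tau> = "\<lambda>i. real_of_int (\<lfloor>real (Suc i) * s\<rfloor> + 1) / real (Suc i)"
  have lower: "s < ?\<tau> i" for i
  proof -
    have "real (Suc i) * s < real_of_int (\<lfloor>real (Suc i) * s\<rfloor> + 1)"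
      by linarith
    then show ?thesis
      by (simp add: field_simps del: of_nat_Suc)
  qed
  have upper: "?\<tau> i \<le> s + 1 / real (Suc i)" for i
  proof -
    have "real_of_int (\<lfloor>real (Suc i) * s\<rfloor> + 1) \<le> real (Suc i) * s + 1"
      by linarith
    then show ?thesis
      by (simp add: field_simps del: of_nat_Suc)
  qed
  have "?\<tau> \<longlonglongrightarrow> s"
  proof (rule real_tendsto_sandwich)
    show "\<forall>\<^sub>F i in sequentially. s \<le> ?\<tau> i"
      using lower by (simp add: less_imp_le)
    show "\<forall>\<^sub>F i in sequentially. ?\<tau> i \<le> s + 1 / real (Suc i)"
      using upper by simp
    show "(\<lambda>i. s + 1 / real (Suc i)) \<longlonglongrightarrow> s"
      using tendsto_add[OF tendsto_const[of s] LIMSEQ_Suc[OF lim_1_over_n]] by simp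
  qed simp
  then show ?thesis
    using lower by (auto simp: filterlim_at intro!: always_eventually less_imp_neq[THEN not_sym])
qed

lemma borel_measurable_right_continuous_process:
  fixes Y :: "'a \<Rightarrow> real \<Rightarrow> 'b::metric_space"
  assumes Y: "\<And>t. 0 \<le> t \<Longrightarrow> (\<lambda>x. Y x t) \<in> borel_measurable M"
    and right_cont: "\<And>x t. x \<in> space M \<Longrightarrow> 0 \<le> t \<Longrightarrow> (Y x \<longlongrightarrow> Y x t) (at_right t)"
  shows "(\<lambda>z. Y (fst z) (max 0 (snd z))) \<in> borel_measurable (M \<Otimes>\<^sub>M (lborel :: real measure))"
proof (rule borel_measurable_LIMSEQ_metric)
  fix i :: nat
  have "(\<lambda>z. Y (fst z) (max 0 (real_of_int (j + 1) / real (Suc i)))) \<in> borel_measurable (M \<Otimes>\<^sub>M (lborel :: real measure))"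
    for j :: int
    by (rule measurable_compose[OF measurable_fst Y]) simp
  then have "(\<lambda>z. (\<lambda>j z. Y (fst z) (max 0 (real_of_int (j + 1) / real (Suc i)))) \<lfloor>real (Suc i) * max 0 (snd z)\<rfloor> z)
      \<in> borel_measurable (M \<Otimes>\<^sub>M (lborel :: real measure))"
    by (rule measurable_compose_countable) measurable
  then show "(\<lambda>z. Y (fst z) (max 0 (real_of_int (\<lfloor>real (Suc i) * max 0 (snd z)\<rfloor> + 1) / real (Suc i))))
      \<in> borel_measurable (M \<Otimes>\<^sub>M (lborel :: real measure))"
    by simp
next
  fix z
  assume "z \<in> space (M \<Otimes>\<^sub>M (lborel :: real measure))"
  then have "fst z \<in> space M"
    by (auto simp: space_pair_measure)
  let ?s = "max 0 (snd z)"
  let ?\<tau> = "\<lambda>i. real_of_int (\<lfloor>real (Suc i) * ?s\<rfloor> + 1) / real (Suc i)"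
  have "(\<lambda>i. Y (fst z) (?\<tau> i)) \<longlonglongrightarrow> Y (fst z) ?s"
    by (rule filterlim_compose[OF right_cont[OF \<open>fst z \<in> space M\<close>] grid_points_tendsto_right]) simp
  moreover have "max 0 (?\<tau> i) = ?\<tau> i" for i
    by (simp add: max_def not_le)
  ultimately show "(\<lambda>i. Y (fst z) (max 0 (?\<tau> i))) \<longlonglongrightarrow> Y (fst z) ?s"
    by simp
qed

lemma borel_measurable_right_continuous:
  fixes y :: "real \<Rightarrow> 'b::metric_space"
  assumes "\<And>t. 0 \<le> t \<Longrightarrow> (y \<longlongrightarrow> y t) (at_right t)"
  shows "(\<lambda>s. y (max 0 s)) \<in> borel_measurable borel"
proof -
  have "(\<lambda>z. y (max 0 (snd z))) \<in> borel_measurable (count_space (UNIV :: unit set) \<Otimes>\<^sub>M lborel)"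
    by (rule borel_measurable_right_continuous_process[of "\<lambda>_. y"]) (use assms in auto)
  from measurable_compose[OF _ this, of "\<lambda>s. ((), s)" lborel] show ?thesis
    by simp
qed

lemma countable_if_left_gaps:
  fixes D :: "real set"
  assumes "\<And>t. t \<in> D \<Longrightarrow> \<exists>a<t. {a<..<t} \<inter> D = {}"
  shows "countable D"
proof -
  obtain a where a: "\<And>t. t \<in> D \<Longrightarrow> a t < t" "\<And>t. t \<in> D \<Longrightarrow> {a t<..<t} \<inter> D = {}"
    using assms by metis
  have disj: "{a s<..<s} \<inter> {a t<..<t} = {}" if "s \<in> D" "t \<in> D" "s < t" for s t
  proof -
    have "s \<le> a t"
      using a(2)[OF that(2)] that by (meson disjoint_iff greaterThanLessThan_iff not_less)
    then show ?thesis
      by auto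
  qed
  have "inj_on (\<lambda>t. {a t<..<t}) D"
  proof (rule inj_onI)
    fix s t
    assume st: "s \<in> D" "t \<in> D" and eq: "{a s<..<s} = {a t<..<t}"
    have "{a s<..<s} \<noteq> {}"
      using a(1)[OF st(1)] by simp
    then show "s = t"
      using disj[OF st] disj[OF st(2,1)] eq by (metis inf.idem linorder_neqE)
  qed
  moreover have "countable ((\<lambda>t. {a t<..<t}) ` D)"
  proof (rule countable_disjoint_open_subsets)
    show "pairwise disjnt ((\<lambda>t. {a t<..<t}) ` D)"
    proof (rule pairwise_imageI)
      show "disjnt {a s<..<s} {a t<..<t}" if "s \<in> D" "t \<in> D" "s \<noteq> t" for s t
        using disj[OF that(1,2)] disj[OF that(2,1)] that(3)
        by (cases "s < t") (auto simp: disjnt_def Int_commute)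
    qed
  qed auto
  ultimately show ?thesis
    by (rule countable_image_inj_on[rotated])
qed

lemma countable_large_left_jumps:
  fixes y :: "real \<Rightarrow> 'b::metric_space"
  assumes l: "\<And>t. 0 < t \<Longrightarrow> (y \<longlongrightarrow> l t) (at_left t)" and "0 < e"
  shows "countable {t. 0 < t \<and> e < dist (y t) (l t)}"
proof (rule countable_if_left_gaps)
  fix t
  assume "t \<in> {t. 0 < t \<and> e < dist (y t) (l t)}"
  then have t: "0 < t"
    by simp
  have "\<forall>\<^sub>F s in at_left t. dist (y s) (l t) < e / 2"
    using \<open>0 < e\<close> by (intro tendstoD[OF l[OF t]]) simp
  then obtain a where a: "a < t" "\<And>s. a < s \<Longrightarrow> s < t \<Longrightarrow> dist (y s) (l t) < e / 2"
    unfolding eventually_at_left_field by blast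
  have "dist (y s) (l s) \<le> e" if s: "max 0 a < s" "s < t" for s
  proof -
    have "((\<lambda>r. dist (y r) (l t)) \<longlongrightarrow> dist (l s) (l t)) (at_left s)"
      by (intro tendsto_intros l) (use s in simp)
    moreover have "\<forall>\<^sub>F r in at_left s. dist (y r) (l t) \<le> e / 2"
      unfolding eventually_at_left_field using a(2) s
      by (intro exI[of _ "max 0 a"]) (auto intro: less_imp_le)
    ultimately have "dist (l s) (l t) \<le> e / 2"
      by (rule tendsto_upperbound) simp
    then show ?thesis
      using a(2)[of s] s dist_triangle2[of "y s" "l s" "l t"] by simp
  qed
  then have "{max 0 a<..<t} \<inter> {t. 0 < t \<and> e < dist (y t) (l t)} = {}"
    by (fastforce simp: not_less[symmetric])
  then show "\<exists>a<t. {a<..<t} \<inter> {t. 0 < t \<and> e < dist (y t) (l t)} = {}"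
    using a(1) t by (intro exI[of _ "max 0 a"]) simp
qed

lemma countable_left_discontinuities:
  fixes y :: "real \<Rightarrow> 'b::metric_space"
  assumes left_limit: "\<And>t. 0 < t \<Longrightarrow> \<exists>l. (y \<longlongrightarrow> l) (at_left t)"
  shows "countable {t. 0 < t \<and> \<not> (y \<longlongrightarrow> y t) (at_left t)}"
proof -
  obtain l where l: "\<And>t. 0 < t \<Longrightarrow> (y \<longlongrightarrow> l t) (at_left t)"
    using left_limit by metis
  let ?J = "\<lambda>i. {t. 0 < t \<and> inverse (real (Suc i)) < dist (y t) (l t)}"
  have "{t. 0 < t \<and> \<not> (y \<longlongrightarrow> y t) (at_left t)} \<subseteq> (\<Union>i. ?J i)"
  proof
    fix t
    assume t: "t \<in> {t. 0 < t \<and> \<not> (y \<longlongrightarrow> y t) (at_left t)}"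
    then have "y t \<noteq> l t"
      using l[of t] by auto
    then obtain i where "inverse (Suc i) < dist (y t) (l t)"
      using reals_Archimedean[of "dist (y t) (l t)"] by auto
    then show "t \<in> (\<Union>i. ?J i)"
      using t by auto
  qed
  moreover have "countable (\<Union>i. ?J i)"
    using countable_large_left_jumps[OF l] by (intro countable_UN) auto
  ultimately show ?thesis
    by (rule countable_subset)
qed

section \<open>Continuous approximation\<close>

lemma borel_measurable_AE_limit_of_continuous:
  fixes f :: "real \<Rightarrow> real"
  assumes f: "f \<in> borel_measurable borel" and B: "\<And>s. \<bar>f s\<bar> \<le> B"
  obtains \<phi> :: "nat \<Rightarrow> real \<Rightarrow> real" where "\<And>n. continuous_on UNIV (\<phi> n)" "\<And>n s. \<bar>\<phi> n s\<bar> \<le> B"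
    "AE s in lborel. (\<lambda>n. \<phi> n s) \<longlonglongrightarrow> f s"
proof -
  have "f measurable_on UNIV"
    using f by (intro lebesgue_measurable_imp_measurable_on_real) (auto simp: measurable_completion)
  then obtain N g where N: "negligible N" and g: "\<And>n. continuous_on UNIV (g n)"
    and lim: "\<And>s. s \<notin> N \<Longrightarrow> (\<lambda>n. g n s) \<longlonglongrightarrow> f s"
    unfolding measurable_on_def by auto
  have "AE s in lebesgue. s \<notin> N"
    using N by (intro AE_not_in) (simp add: negligible_iff_null_sets)
  then have "AE s in lborel. s \<notin> N"
    by (simp add: AE_completion_iff)
  then have "AE s in lborel. (\<lambda>n. max (- B) (min B (g n s))) \<longlonglongrightarrow> f s"
  proof eventually_elim
    case (elim s)
    have "(\<lambda>n. max (- B) (min B (g n s))) \<longlonglongrightarrow> max (- B) (min B (f s))"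
      by (intro tendsto_intros lim elim)
    moreover have "max (- B) (min B (f s)) = f s"
      using B[of s] by auto
    ultimately show ?case
      by simp
  qed
  moreover have "\<bar>max (- B) (min B (g n s))\<bar> \<le> B" for n s
    using B[of 0] by auto
  moreover have "continuous_on UNIV (\<lambda>s. max (- B) (min B (g n s)))" for n
    by (intro continuous_intros g)
  ultimately show thesis
    by (intro that[of "\<lambda>n s. max (- B) (min B (g n s))"])
qed

lemma set_integral_abs_diff_tendsto_zero:
  fixes f :: "real \<Rightarrow> real"
  assumes [measurable]: "f \<in> borel_measurable borel" "\<And>n. g n \<in> borel_measurable borel"
    and B: "\<And>s. s \<in> {a..b} \<Longrightarrow> \<bar>f s\<bar> \<le> B" "\<And>n s. s \<in> {a..b} \<Longrightarrow> \<bar>g n s\<bar> \<le> B"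
    and lim: "AE s in lborel. s \<in> {a..b} \<longrightarrow> (\<lambda>n. g n s) \<longlonglongrightarrow> f s"
  shows "(\<lambda>n. LINT s:{a..b}|lborel. \<bar>g n s - f s\<bar>) \<longlonglongrightarrow> 0"
proof -
  have "(\<lambda>n. LINT s|lborel. indicator {a..b} s *\<^sub>R \<bar>g n s - f s\<bar>) \<longlonglongrightarrow> (LINT s|(lborel :: real measure). 0)"
  proof (rule integral_dominated_convergence[where w="\<lambda>s. indicator {a..b} s *\<^sub>R (2 * B)"])
    show "integrable lborel (\<lambda>s. indicator {a..b} s *\<^sub>R (2 * B))"
      using set_integrable_bounded_Icc[of "\<lambda>_. 2 * B" a b "\<bar>2 * B\<bar>"] by (simp add: set_integrable_def)
    show "AE s in lborel. norm (indicator {a..b} s *\<^sub>R \<bar>g n s - f s\<bar>) \<le> indicator {a..b} s *\<^sub>R (2 * B)" for n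
    proof (rule AE_I2)
      fix s
      show "norm (indicator {a..b} s *\<^sub>R \<bar>g n s - f s\<bar>) \<le> indicator {a..b} s *\<^sub>R (2 * B)"
        using B(1)[of s] B(2)[of s n] by (auto simp: indicator_def)
    qed
    show "AE s in lborel. (\<lambda>n. indicator {a..b} s *\<^sub>R \<bar>g n s - f s\<bar>) \<longlonglongrightarrow> 0"
      using lim
    proof eventually_elim
      case (elim s)
      show ?case
      proof (cases "s \<in> {a..b}")
        case True
        then have "(\<lambda>n. g n s) \<longlonglongrightarrow> f s"
          using elim by blast
        then have "(\<lambda>n. \<bar>g n s - f s\<bar>) \<longlonglongrightarrow> \<bar>f s - f s\<bar>"
          by (intro tendsto_intros)
        with True show ?thesis
          by simp
      qed simp
    qed
  qed measurable
  then show ?thesis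
    by (simp add: set_lebesgue_integral_def)
qed

section \<open>Jump generators\<close>

definition bounded_rates :: "(nat \<Rightarrow> real) \<Rightarrow> real \<Rightarrow> bool" where
  "bounded_rates a A \<longleftrightarrow> (\<forall>j. 0 \<le> a j) \<and> summable a \<and> suminf a \<le> A"

definition jump_generator :: "(nat \<Rightarrow> real) \<Rightarrow> (nat \<Rightarrow> 's) \<Rightarrow> ('s \<Rightarrow> real) \<Rightarrow> 's \<Rightarrow> real" where
  "jump_generator a v f w = (\<Sum>j. a j * (f (v j) - f w))"

lemma bounded_rates_telescoping:
  fixes c :: "nat \<Rightarrow> real"
  assumes "\<And>j. c (Suc j) \<le> c j" "\<And>j. 0 \<le> c j"
  shows "bounded_rates (\<lambda>j. c j - c (Suc j)) (c 0)"
proof -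
  have "decseq c"
    using assms(1) by (simp add: decseq_SucI)
  then obtain L where L: "c \<longlonglongrightarrow> L"
    using decseq_convergent[of c 0] assms(2) by blast
  have "(\<lambda>j. c j - c (Suc j)) sums (c 0 - L)"
    by (rule telescope_sums'[OF L])
  moreover have "0 \<le> L"
    by (rule LIMSEQ_le_const[OF L]) (use assms(2) in auto)
  ultimately show ?thesis
    using assms(1) by (auto simp: bounded_rates_def sums_iff)
qed

lemma bounded_rates_suminf:
  assumes a: "bounded_rates a A" and d: "\<And>j. \<bar>d j\<bar> \<le> C"
  shows "summable (\<lambda>j. a j * d j)" "\<bar>\<Sum>j. a j * d j\<bar> \<le> A * C"
proof -
  have "0 \<le> C"
    using d[of 0] by linarith
  have le: "norm (a j * d j) \<le> a j * C" for j
    using a d[of j] by (simp add: bounded_rates_def abs_mult mult_left_mono)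
  have sum_aC: "summable (\<lambda>j. a j * C)"
    using a by (auto simp: bounded_rates_def intro: summable_mult2)
  show "summable (\<lambda>j. a j * d j)"
    by (rule summable_comparison_test'[OF sum_aC le])
  have sum_norm: "summable (\<lambda>j. norm (a j * d j))"
    by (rule summable_comparison_test'[OF sum_aC]) (use le in simp)
  have "\<bar>\<Sum>j. a j * d j\<bar> \<le> (\<Sum>j. norm (a j * d j))"
    using summable_norm[OF sum_norm] by simp
  also have "\<dots> \<le> (\<Sum>j. a j * C)"
    by (rule suminf_le[OF le sum_norm sum_aC])
  also have "\<dots> = suminf a * C"
    using a by (auto simp: bounded_rates_def suminf_mult2)
  also have "\<dots> \<le> A * C"
    using a \<open>0 \<le> C\<close> by (auto simp: bounded_rates_def intro: mult_right_mono)
  finally show "\<bar>\<Sum>j. a j * d j\<bar> \<le> A * C" .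
qed

lemma jump_generator_bound:
  assumes "bounded_rates a A" and "\<And>j. \<bar>f (v j) - f w\<bar> \<le> C"
  shows "\<bar>jump_generator a v f w\<bar> \<le> A * C"
  unfolding jump_generator_def by (rule bounded_rates_suminf(2)[OF assms])

lemma jump_generator_linear:
  assumes a: "bounded_rates a A"
    and f: "\<And>j. \<bar>f (v j) - f w\<bar> \<le> B" and g: "\<And>j. \<bar>g (v j) - g w\<bar> \<le> C"
  shows "jump_generator a v (\<lambda>s. f s + c * g s) w = jump_generator a v f w + c * jump_generator a v g w"
proof -
  note sum_f = bounded_rates_suminf(1)[of a A "\<lambda>j. f (v j) - f w", OF a f]
  note sum_g = bounded_rates_suminf(1)[of a A "\<lambda>j. g (v j) - g w", OF a g]
  have "(\<Sum>j. a j * ((f (v j) + c * g (v j)) - (f w + c * g w))) =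
      (\<Sum>j. a j * (f (v j) - f w) + c * (a j * (g (v j) - g w)))"
    by (rule arg_cong[of _ _ suminf]) (simp add: fun_eq_iff algebra_simps)
  also have "\<dots> = (\<Sum>j. a j * (f (v j) - f w)) + c * (\<Sum>j. a j * (g (v j) - g w))"
    using suminf_add[OF sum_f summable_mult[OF sum_g, of c]] suminf_mult[OF sum_g, of c] by simp
  finally show ?thesis
    by (simp add: jump_generator_def)
qed

lemma jump_generator_tendsto:
  assumes a: "bounded_rates a A" and f: "\<And>n j. \<bar>f n (v j) - f n w\<bar> \<le> C"
    and lim: "\<And>s. (\<lambda>n. f n s) \<longlonglongrightarrow> g s"
  shows "(\<lambda>n. jump_generator a v (f n) w) \<longlonglongrightarrow> jump_generator a v g w"
proof -
  have "(\<lambda>n. \<Sum>j. a j * (f n (v j) - f n w)) \<longlonglongrightarrow> (\<Sum>j. a j * (g (v j) - g w))"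
  proof (rule tannerys_theorem[where M="\<lambda>j. a j * C", THEN conjunct2, THEN conjunct2])
    show "(\<lambda>n. a j * (f n (v j) - f n w)) \<longlonglongrightarrow> a j * (g (v j) - g w)" for j
      by (intro tendsto_intros lim)
    have "norm (a j * (f n (v j) - f n w)) \<le> a j * C" for j n
      using a f[of n j] by (simp add: bounded_rates_def abs_mult mult_left_mono)
    then show "\<forall>\<^sub>F (j, n) in at_top \<times>\<^sub>F sequentially. norm (a j * (f n (v j) - f n w)) \<le> a j * C"
      by (auto intro: always_eventually)
    show "summable (\<lambda>j. a j * C)"
      using a by (auto simp: bounded_rates_def intro: summable_mult2)
  qed simp
  then show ?thesis
    by (simp add: jump_generator_def)
qed

text \<open>The left-hand side is the carre du champ \<open>\<Sum>j. a j * (f (v j) - f w)\<^sup>2\<close>.\<close>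

lemma jump_generator_square_le:
  assumes a: "bounded_rates a A" and f: "\<And>s. \<bar>f s\<bar> \<le> B" and jump: "\<And>j. \<bar>f (v j) - f w\<bar> \<le> C"
  shows "jump_generator a v (\<lambda>s. (f s)\<^sup>2) w - 2 * f w * jump_generator a v f w \<le> A * C\<^sup>2"
proof -
  have square: "\<bar>(f s)\<^sup>2 - (f w)\<^sup>2\<bar> \<le> B\<^sup>2" for s
    using power_mono[OF f abs_ge_zero, of s 2] power_mono[OF f abs_ge_zero, of w 2]
      zero_le_power2[of "f s"] zero_le_power2[of "f w"] unfolding power2_abs abs_le_iff by linarith
  note sum_square = bounded_rates_suminf(1)[OF a square]
  note sum_jump = bounded_rates_suminf(1)[OF a jump]
  have "jump_generator a v (\<lambda>s. (f s)\<^sup>2) w - 2 * f w * jump_generator a v f w =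
      (\<Sum>j. a j * ((f (v j))\<^sup>2 - (f w)\<^sup>2) - 2 * f w * (a j * (f (v j) - f w)))"
    using suminf_diff[OF sum_square summable_mult[OF sum_jump, of "2 * f w"]]
      suminf_mult[OF sum_jump, of "2 * f w"] by (simp add: jump_generator_def)
  also have "\<dots> = (\<Sum>j. a j * (f (v j) - f w)\<^sup>2)"
    by (rule arg_cong[of _ _ suminf]) (simp add: fun_eq_iff power2_eq_square algebra_simps)
  also have "\<dots> \<le> A * C\<^sup>2"
    using bounded_rates_suminf(2)[OF a, of "\<lambda>j. (f (v j) - f w)\<^sup>2" "C\<^sup>2"] power_mono[OF jump abs_ge_zero, of _ 2]
    by simp
  finally show ?thesis .
qed

lemma jump_generator_finite:
  assumes "finite J" "\<And>j. j \<notin> J \<Longrightarrow> f (v j) = f w"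
  shows "jump_generator a v f w = (\<Sum>j\<in>J. a j * (f (v j) - f w))"
  unfolding jump_generator_def by (rule suminf_finite) (use assms in auto)

lemma jump_generator_cong:
  assumes "\<And>j. a j \<noteq> 0 \<Longrightarrow> f (v j) = g (v j)" "f w = g w"
  shows "jump_generator a v f w = jump_generator a v g w"
proof -
  have "a j * (f (v j) - f w) = a j * (g (v j) - g w)" for j
    using assms by (cases "a j = 0") auto
  then show ?thesis
    by (simp only: jump_generator_def)
qed

section \<open>Transitions of the queueing system\<close>

definition arrive :: "(nat \<Rightarrow> 'a::{plus, one}) \<Rightarrow> nat \<Rightarrow> nat \<Rightarrow> 'a" where
  "arrive w k = w(k := w k + 1)"

definition depart :: "(nat \<Rightarrow> 'a::{minus, one}) \<Rightarrow> nat \<Rightarrow> nat \<Rightarrow> 'a" where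
  "depart w k = w(k := w k - 1)"

definition arrival_rate :: "real \<Rightarrow> (nat \<Rightarrow> real) \<Rightarrow> nat \<Rightarrow> real" where
  "arrival_rate lam u k = lam * (u (k - 1) - u k)"

definition departure_rate :: "real \<Rightarrow> (nat \<Rightarrow> enat) \<Rightarrow> nat \<Rightarrow> real" where
  "departure_rate q w k = pw q (w (Suc k)) - pw q (w k)"

text \<open>Only levels \<open>k \<ge> 1\<close> jump, so the rates are indexed by the predecessor of the level.\<close>

definition level_generator ::
  "(nat \<Rightarrow> real) \<Rightarrow> (nat \<Rightarrow> real) \<Rightarrow> ((nat \<Rightarrow> 'a::{plus, minus, one}) \<Rightarrow> real) \<Rightarrow> (nat \<Rightarrow> 'a) \<Rightarrow> real" where
  "level_generator a b f w =
    jump_generator a (\<lambda>j. arrive w (Suc j)) f w + jump_generator b (\<lambda>j. depart w (Suc j)) f w"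

lemma genO_level_generator:
  "genO lam q u f w =
    level_generator (\<lambda>j. arrival_rate lam u (Suc j)) (\<lambda>j. departure_rate q w (Suc j)) f w"
  by (simp add: genO_def level_generator_def jump_generator_def arrival_rate_def departure_rate_def
      arrive_def depart_def)

lemma pw_toO: "pw q (toO m (Suc k)) = (1 - q) ^ m (Suc k)"
  by (simp add: toO_def pw_def)

lemma departure_rate_toO:
  "departure_rate q (toO m) (Suc k) = (1 - q) ^ m (Suc (Suc k)) - (1 - q) ^ m (Suc k)"
  by (simp add: departure_rate_def pw_toO)

lemma toO_arrive: "toO (arrive m (Suc k)) = arrive (toO m) (Suc k)"
  by (auto simp: toO_def arrive_def fun_eq_iff one_enat_def)

lemma toO_depart: "toO (depart m (Suc k)) = depart (toO m) (Suc k)"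
  by (auto simp: toO_def depart_def fun_eq_iff one_enat_def)

lemma level_generator_finite:
  assumes "finite J"
    and "\<And>j. j \<notin> J \<Longrightarrow> f (arrive w (Suc j)) = f w" "\<And>j. j \<notin> J \<Longrightarrow> f (depart w (Suc j)) = f w"
  shows "level_generator a b f w =
    (\<Sum>j\<in>J. a j * (f (arrive w (Suc j)) - f w) + b j * (f (depart w (Suc j)) - f w))"
  unfolding level_generator_def
  using jump_generator_finite[of J f "\<lambda>j. arrive w (Suc j)" w a]
    jump_generator_finite[of J f "\<lambda>j. depart w (Suc j)" w b] assms
  by (simp add: sum.distrib)

section \<open>State spaces\<close>

lemma Uset_range: "u \<in> Uset \<Longrightarrow> 0 \<le> u k \<and> u k \<le> 1"
  using lift_Suc_antimono_le[of u 0 k] by (auto simp: Uset_def)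

lemma Uset_zero: "u \<in> Uset \<Longrightarrow> u 0 = 1"
  by (simp add: Uset_def)

lemma OmegaS_zero: "w \<in> OmegaS \<Longrightarrow> w 0 = \<infinity>"
  by (simp add: OmegaS_def)

lemma OmegaS_antimono: "w \<in> OmegaS \<Longrightarrow> i \<le> j \<Longrightarrow> w j \<le> w i"
  by (rule lift_Suc_antimono_le[of w]) (auto simp: OmegaS_def)

lemma Sn_le: "m \<in> Sn n \<Longrightarrow> m k \<le> n"
  using lift_Suc_antimono_le[of m 0 k] by (auto simp: Sn_def)

lemma toO_OmegaS: "m \<in> Sn n \<Longrightarrow> toO m \<in> OmegaS"
  by (auto simp: Sn_def OmegaS_def toO_def)

lemma uOf_Uset: "m \<in> Sn n \<Longrightarrow> 0 < n \<Longrightarrow> uOf n m \<in> Uset"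
  by (auto simp: Sn_def Uset_def uOf_def divide_right_mono)

lemma arrive_OmegaS:
  assumes w: "w \<in> OmegaS" and top: "w k = \<infinity>"
  shows "arrive w (Suc k) \<in> OmegaS"
  unfolding OmegaS_def mem_Collect_eq
proof (intro conjI allI)
  show "arrive w (Suc k) 0 = \<infinity>"
    using w by (simp add: arrive_def OmegaS_zero)
  fix i
  have "w (Suc i) \<le> w i"
    by (rule OmegaS_antimono[OF w]) simp
  moreover have "w i \<le> w i + 1"
    by simp
  ultimately show "arrive w (Suc k) (Suc i) \<le> arrive w (Suc k) i"
    using top unfolding arrive_def by (auto intro: order_trans)
qed

lemma depart_OmegaS:
  assumes w: "w \<in> OmegaS" and less: "w (Suc (Suc k)) < w (Suc k)"
  shows "depart w (Suc k) \<in> OmegaS"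
  unfolding OmegaS_def mem_Collect_eq
proof (intro conjI allI)
  show "depart w (Suc k) 0 = \<infinity>"
    using w by (simp add: depart_def OmegaS_zero)
  fix i
  have "w (Suc i) \<le> w i"
    by (rule OmegaS_antimono[OF w]) simp
  moreover have "w (Suc k) - 1 \<le> w k"
    using OmegaS_antimono[OF w, of k "Suc k"] by (simp add: order_trans[OF ediff_le_self])
  moreover have "w (Suc (Suc k)) \<le> w (Suc k) - 1"
    using less by (cases "w (Suc k)"; cases "w (Suc (Suc k))") (auto simp: one_enat_def)
  ultimately show "depart w (Suc k) (Suc i) \<le> depart w (Suc k) i"
    unfolding depart_def by auto
qed

locale lcq_parameters =
  fixes lam q :: real
  assumes lam_pos: "0 < lam" and q_pos: "0 < q" and q_le_1: "q \<le> 1"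
begin

lemma pw_range: "0 \<le> pw q e" "pw q e \<le> 1"
  using q_pos q_le_1 by (cases e; simp add: pw_def power_le_one)+

lemma pw_antimono: "e \<le> e' \<Longrightarrow> pw q e' \<le> pw q e"
  using q_pos q_le_1 by (cases e; cases e') (auto simp: pw_def intro: power_decreasing)

lemma arrival_rate_bounds:
  assumes "u \<in> Uset"
  shows "0 \<le> arrival_rate lam u k" "arrival_rate lam u k \<le> lam"
proof -
  have "u k \<le> u (k - 1)"
    using assms by (cases k) (auto simp: Uset_def)
  then show "0 \<le> arrival_rate lam u k"
    using lam_pos by (simp add: arrival_rate_def)
  have "u (k - 1) - u k \<le> 1"
    using Uset_range[OF assms, of k] Uset_range[OF assms, of "k - 1"] by linarith
  then show "arrival_rate lam u k \<le> lam"
    using mult_left_mono[of "u (k - 1) - u k" 1 lam] lam_pos by (simp add: arrival_rate_def)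
qed

lemma departure_rate_abs_le: "\<bar>departure_rate q w k\<bar> \<le> 1"
  using pw_range[of "w k"] pw_range[of "w (Suc k)"] unfolding departure_rate_def by linarith

lemma bounded_rates_arrival:
  assumes u: "u \<in> Uset"
  shows "bounded_rates (\<lambda>j. arrival_rate lam u (Suc j)) lam"
  using bounded_rates_telescoping[of "\<lambda>j. lam * u j"] u lam_pos
  by (simp add: Uset_def arrival_rate_def right_diff_distrib)

lemma bounded_rates_departure:
  assumes w: "w \<in> OmegaS"
  shows "bounded_rates (\<lambda>j. departure_rate q w (Suc j)) 1"
proof -
  have "bounded_rates (\<lambda>j. (1 - pw q (w (Suc j))) - (1 - pw q (w (Suc (Suc j))))) (1 - pw q (w (Suc 0)))"
    using pw_range by (intro bounded_rates_telescoping) (simp_all add: pw_antimono OmegaS_antimono[OF w])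
  then show ?thesis
    using pw_range(1)[of "w (Suc 0)"] by (auto simp: bounded_rates_def departure_rate_def)
qed

lemma genO_bound:
  assumes u: "u \<in> Uset" and w: "w \<in> OmegaS" and f: "\<And>v. \<bar>f v - f w\<bar> \<le> C"
  shows "\<bar>genO lam q u f w\<bar> \<le> (lam + 1) * C"
proof -
  have "\<bar>genO lam q u f w\<bar> \<le> lam * C + 1 * C"
    unfolding genO_level_generator level_generator_def
    by (intro order_trans[OF abs_triangle_ineq add_mono] jump_generator_bound
        bounded_rates_arrival[OF u] bounded_rates_departure[OF w] f)
  then show ?thesis
    by (simp add: algebra_simps)
qed

lemma genO_linear:
  assumes u: "u \<in> Uset" and w: "w \<in> OmegaS" and f: "\<And>v. \<bar>f v - f w\<bar> \<le> B" and g: "\<And>v. \<bar>g v - g w\<bar> \<le> C"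
  shows "genO lam q u (\<lambda>v. f v + c * g v) w = genO lam q u f w + c * genO lam q u g w"
  unfolding genO_level_generator level_generator_def
    jump_generator_linear[of _ _ f _ w _ g, OF bounded_rates_arrival[OF u] f g]
    jump_generator_linear[of _ _ f _ w _ g, OF bounded_rates_departure[OF w] f g]
  by (simp add: algebra_simps)

lemma genO_tendsto:
  assumes u: "u \<in> Uset" and w: "w \<in> OmegaS" and f: "\<And>n v. \<bar>f n v - f n w\<bar> \<le> C"
    and lim: "\<And>v. (\<lambda>n. f n v) \<longlonglongrightarrow> g v"
  shows "(\<lambda>n. genO lam q u (f n) w) \<longlonglongrightarrow> genO lam q u g w"
  unfolding genO_level_generator level_generator_def
  by (intro tendsto_add jump_generator_tendsto[of _ _ f, OF bounded_rates_arrival[OF u] f lim]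
      jump_generator_tendsto[of _ _ f, OF bounded_rates_departure[OF w] f lim])

text \<open>A jump that leaves \<open>OmegaS\<close> has rate zero: an arrival at level \<open>k + 1\<close> needs
  \<open>u k > 0\<close>, which forces \<open>w k = \<infinity>\<close>.\<close>

lemma genO_cong_OmegaS:
  assumes u: "u \<in> Uset" and w: "w \<in> OmegaS" and top: "\<And>k. 0 < u k \<Longrightarrow> w k = \<infinity>"
    and eq: "\<And>v. v \<in> OmegaS \<Longrightarrow> f v = g v"
  shows "genO lam q u f w = genO lam q u g w"
  unfolding genO_level_generator level_generator_def
proof (intro arg_cong2[where f="(+)"] jump_generator_cong eq w)
  fix j
  assume "arrival_rate lam u (Suc j) \<noteq> 0"
  then have "0 < u j"
    using arrival_rate_bounds(1)[OF u, of "Suc j"] Uset_range[OF u, of "Suc j"] lam_pos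
    by (auto simp: arrival_rate_def zero_le_mult_iff)
  then show "arrive w (Suc j) \<in> OmegaS"
    by (intro arrive_OmegaS w top)
next
  fix j
  assume "departure_rate q w (Suc j) \<noteq> 0"
  then have "w (Suc (Suc j)) \<noteq> w (Suc j)"
    by (auto simp: departure_rate_def)
  then have "w (Suc (Suc j)) < w (Suc j)"
    using OmegaS_antimono[OF w, of "Suc j" "Suc (Suc j)"] by simp
  then show "depart w (Suc j) \<in> OmegaS"
    by (rule depart_OmegaS[OF w])
qed

lemma genN_level_generator:
  assumes m: "m \<in> Sn n" and "0 < n" and f: "\<And>m'. \<bar>f m' - f m\<bar> \<le> C"
  shows "genN lam q n f m =
    real n * level_generator (\<lambda>j. arrival_rate lam (uOf n m) (Suc j)) (\<lambda>j. departure_rate q (toO m) (Suc j)) f m"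
proof -
  have "lam * (real (m j) - real (m (Suc j))) = real n * arrival_rate lam (uOf n m) (Suc j)" for j
    using \<open>0 < n\<close> by (simp add: arrival_rate_def uOf_def field_simps)
  then show ?thesis
    unfolding genN_def level_generator_def jump_generator_def distrib_left
      suminf_mult[OF bounded_rates_suminf(1)[OF bounded_rates_arrival[OF uOf_Uset[OF m \<open>0 < n\<close>]] f], symmetric]
      suminf_mult[OF bounded_rates_suminf(1)[OF bounded_rates_departure[OF toO_OmegaS[OF m]] f], symmetric]
    by (simp add: departure_rate_toO arrive_def depart_def mult.assoc)
qed

lemma genN_bound:
  assumes m: "m \<in> Sn n" and n: "0 < n" and f: "\<And>m'. \<bar>f m' - f m\<bar> \<le> C"
  shows "\<bar>genN lam q n f m\<bar> \<le> real n * (lam + 1) * C"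
proof -
  have "\<bar>level_generator (\<lambda>j. arrival_rate lam (uOf n m) (Suc j)) (\<lambda>j. departure_rate q (toO m) (Suc j)) f m\<bar>
      \<le> lam * C + 1 * C"
    unfolding level_generator_def
    by (intro order_trans[OF abs_triangle_ineq add_mono] jump_generator_bound f
        bounded_rates_arrival[OF uOf_Uset[OF m n]] bounded_rates_departure[OF toO_OmegaS[OF m]])
  from mult_left_mono[OF this, of "real n"] show ?thesis
    unfolding genN_level_generator[of m n f, OF m n f] abs_mult by (simp add: algebra_simps)
qed

lemma genN_square_le:
  assumes m: "m \<in> Sn n" and n: "0 < n" and f: "\<And>m'. \<bar>f m'\<bar> \<le> B"
    and arrive: "\<And>j. \<bar>f (arrive m (Suc j)) - f m\<bar> \<le> C" and depart: "\<And>j. \<bar>f (depart m (Suc j)) - f m\<bar> \<le> C"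
  shows "genN lam q n (\<lambda>m'. (f m')\<^sup>2) m - 2 * f m * genN lam q n f m \<le> real n * (lam + 1) * C\<^sup>2"
proof -
  let ?G = "level_generator (\<lambda>j. arrival_rate lam (uOf n m) (Suc j)) (\<lambda>j. departure_rate q (toO m) (Suc j))"
  have diff: "\<bar>f m' - f m\<bar> \<le> 2 * B" for m'
    using f[of m'] f[of m] by linarith
  have square_diff: "\<bar>(f m')\<^sup>2 - (f m)\<^sup>2\<bar> \<le> B\<^sup>2" for m'
    using power_mono[OF f abs_ge_zero, of m' 2] power_mono[OF f abs_ge_zero, of m 2]
      zero_le_power2[of "f m"] zero_le_power2[of "f m'"] unfolding power2_abs abs_le_iff by linarith
  have "?G (\<lambda>m'. (f m')\<^sup>2) m - 2 * f m * ?G f m \<le> lam * C\<^sup>2 + 1 * C\<^sup>2"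
    using jump_generator_square_le[where f=f and w=m and v="\<lambda>j. arrive m (Suc j)",
        OF bounded_rates_arrival[OF uOf_Uset[OF m n]] f arrive]
      jump_generator_square_le[where f=f and w=m and v="\<lambda>j. depart m (Suc j)",
        OF bounded_rates_departure[OF toO_OmegaS[OF m]] f depart]
    unfolding level_generator_def by (simp add: algebra_simps)
  then have "real n * (?G (\<lambda>m'. (f m')\<^sup>2) m - 2 * f m * ?G f m) \<le> real n * (lam * C\<^sup>2 + 1 * C\<^sup>2)"
    by (intro mult_left_mono) auto
  then show ?thesis
    unfolding genN_level_generator[of m n f, OF m n diff] genN_level_generator[of m n "\<lambda>m'. (f m')\<^sup>2", OF m n square_diff]
    by (simp add: algebra_simps)
qed

lemma genN_toO:
  assumes m: "m \<in> Sn n" and n: "0 < n" and f: "\<And>w. \<bar>f w - f (toO m)\<bar> \<le> C"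
  shows "genN lam q n (\<lambda>m. f (toO m)) m = real n * genO lam q (uOf n m) f (toO m)"
proof -
  have "genN lam q n (\<lambda>m. f (toO m)) m = real n * level_generator (\<lambda>j. arrival_rate lam (uOf n m) (Suc j))
      (\<lambda>j. departure_rate q (toO m) (Suc j)) (\<lambda>m. f (toO m)) m"
    by (rule genN_level_generator[OF m n]) (rule f)
  then show ?thesis
    by (simp add: genO_level_generator level_generator_def jump_generator_def toO_arrive toO_depart)
qed

text \<open>The truncation at \<open>n\<close> makes the coordinate a bounded function on the whole type and is
  invisible on the state space.\<close>

lemma arrival_rate_truncated_coordinate:
  assumes m: "m \<in> Sn n"
  shows "arrival_rate lam (uOf n m) (Suc i) * (real (min (arrive m (Suc i) (Suc i)) n) - real (min (m (Suc i)) n))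
    = arrival_rate lam (uOf n m) (Suc i)"
proof (cases "m (Suc i) = n")
  case True
  then have "m i = n"
    using m Sn_le[OF m, of i] by (auto simp: Sn_def intro: antisym)
  with True have "arrival_rate lam (uOf n m) (Suc i) = 0"
    by (simp add: arrival_rate_def uOf_def)
  then show ?thesis
    by simp
next
  case False
  then show ?thesis
    using Sn_le[OF m, of "Suc i"] by (simp add: arrive_def min_def)
qed

lemma departure_rate_truncated_coordinate:
  assumes m: "m \<in> Sn n"
  shows "departure_rate q (toO m) (Suc i) * (real (min (depart m (Suc i) (Suc i)) n) - real (min (m (Suc i)) n))
    = - departure_rate q (toO m) (Suc i)"
proof (cases "m (Suc i) = 0")
  case True
  have "m (Suc (Suc i)) \<le> m (Suc i)"
    using m by (simp add: Sn_def)
  with True have "departure_rate q (toO m) (Suc i) = 0"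
    by (simp add: departure_rate_toO)
  then show ?thesis
    by simp
next
  case False
  then have "real (min (depart m (Suc i) (Suc i)) n) - real (min (m (Suc i)) n) = - 1"
    using Sn_le[OF m, of "Suc i"] by (simp add: depart_def min_def of_nat_diff)
  then show ?thesis
    by (simp only: mult_minus1_right)
qed

lemma genN_coordinate:
  assumes m: "m \<in> Sn n" and n: "0 < n" and k: "1 \<le> k"
  shows "genN lam q n (\<lambda>m. real (min (m k) n)) m =
    real n * (arrival_rate lam (uOf n m) k - departure_rate q (toO m) k)"
proof -
  obtain i where i: "k = Suc i"
    using k by (cases k) auto
  let ?f = "\<lambda>m :: nat \<Rightarrow> nat. real (min (m k) n)"
  have "level_generator (\<lambda>j. arrival_rate lam (uOf n m) (Suc j)) (\<lambda>j. departure_rate q (toO m) (Suc j)) ?f m =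
      (\<Sum>j\<in>{i}. arrival_rate lam (uOf n m) (Suc j) * (?f (arrive m (Suc j)) - ?f m)
        + departure_rate q (toO m) (Suc j) * (?f (depart m (Suc j)) - ?f m))"
    by (rule level_generator_finite) (auto simp: arrive_def depart_def i)
  also have "\<dots> = arrival_rate lam (uOf n m) k - departure_rate q (toO m) k"
    using arrival_rate_truncated_coordinate[OF m] departure_rate_truncated_coordinate[OF m] by (simp add: i)
  finally show ?thesis
    by (subst genN_level_generator[OF m n, of _ "real n"]) auto
qed

end

section \<open>The metrics of the slow and the fast variables\<close>

lemma tendsto_coordinatewise:
  fixes f :: "'a \<Rightarrow> 'i \<Rightarrow> 'b::topological_space"
  assumes "\<And>i. ((\<lambda>x. f x i) \<longlongrightarrow> l i) F"
  shows "(f \<longlongrightarrow> l) F"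
  using assms limitin_componentwise[of "\<lambda>_. euclidean" UNIV f l F] by (simp add: euclidean_product_topology)

lemma abs_le_weighted_SUP:
  fixes d :: "nat \<Rightarrow> real"
  assumes d: "\<And>k. \<bar>d k\<bar> \<le> 1" and k: "1 \<le> k"
  shows "\<bar>d k\<bar> \<le> real k * (SUP k\<in>{1..}. \<bar>d k\<bar> / real k)"
proof -
  have "\<bar>d i\<bar> / real i \<le> 1" if "1 \<le> i" for i
    using d[of i] that by (simp add: divide_le_eq)
  then have "\<bar>d k\<bar> / real k \<le> (SUP k\<in>{1..}. \<bar>d k\<bar> / real k)"
    using k by (intro cSUP_upper bdd_aboveI2[where M=1]) auto
  then show ?thesis
    using k by (simp add: divide_le_eq mult.commute)
qed

lemma abs_diff_le_rhoU:
  assumes u: "u \<in> Uset" and u': "u' \<in> Uset"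
  shows "\<bar>u k - u' k\<bar> \<le> real k * rhoU u u'"
proof (cases "k = 0")
  case True
  then show ?thesis
    using u u' by (simp add: Uset_zero)
next
  case False
  have "\<bar>u k - u' k\<bar> \<le> 1" for k
    using Uset_range[OF u, of k] Uset_range[OF u', of k] by linarith
  then show ?thesis
    unfolding rhoU_def using False by (intro abs_le_weighted_SUP) auto
qed

lemma rhoU_le_1:
  assumes u: "u \<in> Uset" and u': "u' \<in> Uset"
  shows "rhoU u u' \<le> 1"
  unfolding rhoU_def
proof (rule cSUP_least)
  fix k :: nat
  assume "k \<in> {1..}"
  then show "\<bar>u k - u' k\<bar> / real k \<le> 1"
    using Uset_range[OF u, of k] Uset_range[OF u', of k] by (simp add: divide_le_eq) linarith
qed simp

lemma rhoU_tendsto_diff: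
  assumes "((\<lambda>i. rhoU (f i) (g i)) \<longlongrightarrow> 0) F" "\<forall>\<^sub>F i in F. f i \<in> Uset \<and> g i \<in> Uset"
  shows "((\<lambda>i. f i k - g i k) \<longlongrightarrow> 0) F"
proof (rule Lim_null_comparison)
  show "((\<lambda>i. real k * rhoU (f i) (g i)) \<longlongrightarrow> 0) F"
    using tendsto_mult[OF tendsto_const[of "real k"] assms(1)] by simp
  show "\<forall>\<^sub>F i in F. norm (f i k - g i k) \<le> real k * rhoU (f i) (g i)"
    using assms(2) by eventually_elim (simp add: abs_diff_le_rhoU)
qed

lemma rhoU_tendsto:
  assumes "((\<lambda>i. rhoU (f i) u) \<longlongrightarrow> 0) F" "\<forall>\<^sub>F i in F. f i \<in> Uset" "u \<in> Uset"
  shows "(f \<longlongrightarrow> u) F"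
proof (rule tendsto_coordinatewise)
  fix k
  have "((\<lambda>i. f i k - u k) \<longlongrightarrow> 0) F"
    using assms by (intro rhoU_tendsto_diff) auto
  then show "((\<lambda>i. f i k) \<longlongrightarrow> u k) F"
    by (simp add: LIM_zero_iff)
qed

lemma hO_range: "0 \<le> hO e" "hO e \<le> 1"
  by (cases e; simp add: hO_def)+

lemma hO_less_iff: "hO a < hO b \<longleftrightarrow> b < a"
  by (cases a; cases b) (auto simp: hO_def field_simps)

lemma rhoO_tendsto:
  assumes rho: "((\<lambda>i. rhoO (f i) w) \<longlongrightarrow> 0) F" and f: "\<forall>\<^sub>F i in F. f i \<in> OmegaS" and w: "w \<in> OmegaS"
  shows "(f \<longlongrightarrow> w) F"
proof (rule tendsto_coordinatewise)
  fix k
  show "((\<lambda>i. f i k) \<longlongrightarrow> w k) F"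
  proof (cases "k = 0")
    case True
    have "\<forall>\<^sub>F i in F. f i k = w k"
      using f by eventually_elim (simp add: True OmegaS_zero w)
    then show ?thesis
      by (rule tendsto_eventually)
  next
    case False
    have "((\<lambda>i. hO (f i k) - hO (w k)) \<longlongrightarrow> 0) F"
    proof (rule Lim_null_comparison)
      show "((\<lambda>i. real k * rhoO (f i) w) \<longlongrightarrow> 0) F"
        using tendsto_mult[OF tendsto_const[of "real k"] rho] by simp
      have "\<bar>hO (f i k) - hO (w k)\<bar> \<le> real k * rhoO (f i) w" for i
        unfolding rhoO_def
      proof (rule abs_le_weighted_SUP)
        show "\<bar>hO (f i k) - hO (w k)\<bar> \<le> 1" for k
          using hO_range[of "f i k"] hO_range[of "w k"] by linarith
      qed (use False in simp)
      then show "\<forall>\<^sub>F i in F. norm (hO (f i k) - hO (w k)) \<le> real k * rhoO (f i) w"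
        by simp
    qed
    then have lim: "((\<lambda>i. hO (f i k)) \<longlongrightarrow> hO (w k)) F"
      by (simp add: LIM_zero_iff)
    show ?thesis
    proof (rule order_tendstoI)
      show "\<forall>\<^sub>F i in F. a < f i k" if "a < w k" for a
        using order_tendstoD(2)[OF lim, of "hO a"] that by (simp add: hO_less_iff)
      show "\<forall>\<^sub>F i in F. f i k < a" if "w k < a" for a
        using order_tendstoD(1)[OF lim, of "hO a"] that by (simp add: hO_less_iff)
    qed
  qed
qed

section \<open>Paths with left limits\<close>

lemma Dsp_Uset: "x \<in> Dsp \<Longrightarrow> 0 \<le> t \<Longrightarrow> x t \<in> Uset"
  by (simp add: Dsp_def)

lemma Dsp_right_continuous:
  assumes x: "x \<in> Dsp" and t: "0 \<le> t"
  shows "(x \<longlongrightarrow> x t) (at_right t)"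
proof (rule rhoU_tendsto)
  show "((\<lambda>s. rhoU (x s) (x t)) \<longlongrightarrow> 0) (at_right t)"
    using x t by (simp add: Dsp_def)
  show "\<forall>\<^sub>F s in at_right t. x s \<in> Uset"
    unfolding eventually_at_right_field using t Dsp_Uset[OF x] by (intro exI[of _ "t + 1"]) auto
qed (rule Dsp_Uset[OF x t])

lemma Dsp_left_limit:
  assumes x: "x \<in> Dsp" and t: "0 < t"
  shows "\<exists>u. (x \<longlongrightarrow> u) (at_left t)"
proof -
  obtain u where "u \<in> Uset" "((\<lambda>s. rhoU (x s) u) \<longlongrightarrow> 0) (at_left t)"
    using x t by (auto simp: Dsp_def)
  moreover have "\<forall>\<^sub>F s in at_left t. x s \<in> Uset"
    unfolding eventually_at_left_field using t Dsp_Uset[OF x] by (intro exI[of _ 0]) auto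
  ultimately show ?thesis
    using rhoU_tendsto by blast
qed

lemma borel_measurable_along_path:
  fixes a :: "real \<Rightarrow> (nat \<Rightarrow> real) \<Rightarrow> real"
  assumes x: "x \<in> Dsp" and a: "continuous_on UNIV (\<lambda>(s, u). a s u)"
  shows "(\<lambda>s. a (max 0 s) (x (max 0 s))) \<in> borel_measurable borel"
proof (rule borel_measurable_right_continuous)
  fix t :: real
  assume "0 \<le> t"
  then have "((\<lambda>s. (s, x s)) \<longlongrightarrow> (t, x t)) (at_right t)"
    by (intro tendsto_Pair tendsto_ident_at Dsp_right_continuous x)
  moreover have "isCont (\<lambda>(s, u). a s u) (t, x t)"
    using a by (simp add: continuous_on_eq_continuous_at)
  ultimately show "((\<lambda>s. a s (x s)) \<longlongrightarrow> a t (x t)) (at_right t)"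
    using isCont_tendsto_compose[of "(t, x t)" "\<lambda>(s, u). a s u" "\<lambda>s. (s, x s)"] by simp
qed

lemma LambdaJ_zero:
  assumes l: "l \<in> LambdaJ"
  shows "l 0 = 0"
proof -
  have im: "l ` {0..} = {0..}" and mono: "strict_mono_on {0..} l"
    using l by (auto simp: LambdaJ_def)
  then have "0 \<in> l ` {0..}"
    by simp
  then obtain s where s: "0 \<le> s" "l s = 0"
    by auto
  have "0 \<le> l 0"
    using im by auto
  moreover have "l 0 \<le> l s"
    using mono s(1) by (cases "s = 0") (auto simp: strict_mono_on_def intro: less_imp_le)
  ultimately show ?thesis
    using s(2) by simp
qed

lemma LambdaJ_nonneg: "l \<in> LambdaJ \<Longrightarrow> 0 \<le> s \<Longrightarrow> 0 \<le> l s"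
  by (auto simp: LambdaJ_def)

lemma LambdaJ_bounds:
  assumes l: "l \<in> LambdaJ" and s: "0 \<le> s"
  shows "s * exp (- gammaJ l) \<le> l s" "l s \<le> s * exp (gammaJ l)"
proof -
  have "s * exp (- gammaJ l) \<le> l s \<and> l s \<le> s * exp (gammaJ l)"
  proof (cases "s = 0")
    case True
    then show ?thesis
      using LambdaJ_zero[OF l] by simp
  next
    case False
    then have "0 < s"
      using s by simp
    then have "l 0 < l s"
      using l by (auto simp: LambdaJ_def strict_mono_on_def)
    then have "0 < l s / s"
      using LambdaJ_zero[OF l] \<open>0 < s\<close> by simp
    have "\<bar>ln ((l s - l 0) / (s - 0))\<bar> \<le> gammaJ l"
      unfolding gammaJ_def
    proof (rule cSup_upper)
      show "bdd_above {\<bar>ln ((l s - l t) / (s - t))\<bar> | s t. 0 \<le> t \<and> t < s}"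
        using l by (simp add: LambdaJ_def)
    qed (use \<open>0 < s\<close> in blast)
    then have "- gammaJ l \<le> ln (l s / s)" "ln (l s / s) \<le> gammaJ l"
      using LambdaJ_zero[OF l] by (auto simp: abs_le_iff)
    then have "exp (- gammaJ l) \<le> exp (ln (l s / s))" "exp (ln (l s / s)) \<le> exp (gammaJ l)"
      by simp_all
    then have "exp (- gammaJ l) \<le> l s / s" "l s / s \<le> exp (gammaJ l)"
      unfolding exp_ln[OF \<open>0 < l s / s\<close>] .
    then show ?thesis
      using \<open>0 < s\<close> by (simp add: field_simps)
  qed
  then show "s * exp (- gammaJ l) \<le> l s" "l s \<le> s * exp (gammaJ l)"
    by auto
qed

lemma J1conv_time_changes:
  assumes J: "J1conv xs x" and xs: "\<And>m. xs m \<in> Dsp" and x: "x \<in> Dsp"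
  obtains ls where "\<And>m. ls m \<in> LambdaJ" "\<And>s. 0 \<le> s \<Longrightarrow> (\<lambda>m. ls m s) \<longlonglongrightarrow> s"
    "\<And>s. 0 \<le> s \<Longrightarrow> (\<lambda>m. rhoU (xs m s) (x (ls m s))) \<longlonglongrightarrow> 0"
proof -
  obtain ls where ls: "\<And>m. ls m \<in> LambdaJ" and \<gamma>: "(\<lambda>m. gammaJ (ls m)) \<longlonglongrightarrow> 0"
    and unif: "\<And>T. T > 0 \<Longrightarrow> (\<lambda>m. SUP t\<in>{0..T}. rhoU (xs m t) (x (ls m t))) \<longlonglongrightarrow> 0"
    using J unfolding J1conv_def by blast
  have "(\<lambda>m. ls m s) \<longlonglongrightarrow> s" if s: "0 \<le> s" for s
  proof (rule real_tendsto_sandwich)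
    show "(\<lambda>m. s * exp (- gammaJ (ls m))) \<longlonglongrightarrow> s" "(\<lambda>m. s * exp (gammaJ (ls m))) \<longlonglongrightarrow> s"
      using tendsto_mult[OF tendsto_const[of s] tendsto_exp[OF tendsto_minus[OF \<gamma>]]]
        tendsto_mult[OF tendsto_const[of s] tendsto_exp[OF \<gamma>]] by simp_all
  qed (use LambdaJ_bounds[OF ls s] in auto)
  moreover have "(\<lambda>m. rhoU (xs m s) (x (ls m s))) \<longlonglongrightarrow> 0" if s: "0 \<le> s" for s
  proof (rule real_tendsto_sandwich[OF _ _ tendsto_const unif[of "s + 1"]])
    have in_Uset: "xs m t \<in> Uset" "x (ls m t) \<in> Uset" if "0 \<le> t" for m t
      using that by (auto intro: Dsp_Uset xs x LambdaJ_nonneg[OF ls])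
    have "0 \<le> rhoU (xs m s) (x (ls m s))" for m
      using order_trans[OF abs_ge_zero abs_diff_le_rhoU[OF in_Uset(1)[OF s, of m] in_Uset(2)[OF s, of m], of 1]] by simp
    then show "\<forall>\<^sub>F m in sequentially. 0 \<le> rhoU (xs m s) (x (ls m s))"
      by simp
    have "rhoU (xs m s) (x (ls m s)) \<le> (SUP t\<in>{0..s + 1}. rhoU (xs m t) (x (ls m t)))" for m
      using s by (intro cSUP_upper bdd_aboveI2[where M=1] rhoU_le_1 in_Uset) auto
    then show "\<forall>\<^sub>F m in sequentially. rhoU (xs m s) (x (ls m s)) \<le> (SUP t\<in>{0..s + 1}. rhoU (xs m t) (x (ls m t)))"
      by simp
  qed (use s in simp)
  ultimately show thesis
    using that ls by blast
qed

lemma J1conv_pointwise: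
  assumes J: "J1conv xs x" and xs: "\<And>m. xs m \<in> Dsp" and x: "x \<in> Dsp" and s: "0 \<le> s"
    and left_cont: "0 < s \<Longrightarrow> (x \<longlongrightarrow> x s) (at_left s)"
  shows "(\<lambda>m. xs m s) \<longlonglongrightarrow> x s"
proof -
  obtain ls where ls: "\<And>m. ls m \<in> LambdaJ" and ls_lim: "\<And>s. 0 \<le> s \<Longrightarrow> (\<lambda>m. ls m s) \<longlonglongrightarrow> s"
    and near: "\<And>s. 0 \<le> s \<Longrightarrow> (\<lambda>m. rhoU (xs m s) (x (ls m s))) \<longlonglongrightarrow> 0"
    using J1conv_time_changes[OF J xs x] by blast
  have x_ls: "(\<lambda>m. x (ls m s)) \<longlonglongrightarrow> x s"
  proof (cases "s = 0")
    case True
    then show ?thesis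
      using LambdaJ_zero[OF ls] by simp
  next
    case False
    then have "isCont x s"
      using left_cont Dsp_right_continuous[OF x s] s unfolding isCont_def by (simp add: filterlim_at_split)
    then show ?thesis
      by (rule isCont_tendsto_compose[OF _ ls_lim[OF s]])
  qed
  show ?thesis
  proof (rule tendsto_coordinatewise)
    fix k
    have "(\<lambda>m. x (ls m s) k) \<longlonglongrightarrow> x s k"
      using continuous_on_tendsto_compose[OF continuous_on_product_coordinates x_ls] by simp
    moreover have "(\<lambda>m. xs m s k - x (ls m s) k) \<longlonglongrightarrow> 0"
      using near[OF s] s
      by (intro rhoU_tendsto_diff always_eventually) (auto intro: Dsp_Uset xs x LambdaJ_nonneg[OF ls])
    ultimately show "(\<lambda>m. xs m s k) \<longlonglongrightarrow> x s k"
      using tendsto_add by fastforce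
  qed
qed

lemma J1conv_L1:
  fixes a :: "real \<Rightarrow> (nat \<Rightarrow> real) \<Rightarrow> real"
  assumes J: "J1conv xs x" and xs: "\<And>m. xs m \<in> Dsp" and x: "x \<in> Dsp"
    and a: "continuous_on UNIV (\<lambda>(s, u). a s u)" and B: "\<And>s u. s \<in> {0..t} \<Longrightarrow> u \<in> Uset \<Longrightarrow> \<bar>a s u\<bar> \<le> B"
  shows "(\<lambda>m. LINT s:{0..t}|lborel. \<bar>a (max 0 s) (xs m (max 0 s)) - a (max 0 s) (x (max 0 s))\<bar>) \<longlonglongrightarrow> 0"
proof (rule set_integral_abs_diff_tendsto_zero[where B=B])
  let ?D = "{s. 0 < s \<and> \<not> (x \<longlongrightarrow> x s) (at_left s)}"
  have "?D \<in> null_sets lborel"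
    by (intro countable_imp_null_set_lborel countable_left_discontinuities Dsp_left_limit x)
  then have "AE s in lborel. s \<notin> ?D"
    by (rule AE_not_in)
  then show "AE s in lborel. s \<in> {0..t} \<longrightarrow> (\<lambda>m. a (max 0 s) (xs m (max 0 s))) \<longlonglongrightarrow> a (max 0 s) (x (max 0 s))"
  proof (eventually_elim, intro impI)
    fix s
    assume "s \<notin> ?D" "s \<in> {0..t}"
    then have "(\<lambda>m. (s, xs m s)) \<longlonglongrightarrow> (s, x s)"
      by (intro tendsto_Pair tendsto_const J1conv_pointwise[OF J xs x]) auto
    then have "(\<lambda>m. (\<lambda>(s, u). a s u) (s, xs m s)) \<longlonglongrightarrow> (\<lambda>(s, u). a s u) (s, x s)"
      by (rule continuous_on_tendsto_compose[OF a]) auto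
    then show "(\<lambda>m. a (max 0 s) (xs m (max 0 s))) \<longlonglongrightarrow> a (max 0 s) (x (max 0 s))"
      using \<open>s \<in> {0..t}\<close> by simp
  qed
qed (use B Dsp_Uset[OF x] Dsp_Uset[OF xs] in
    \<open>auto intro: borel_measurable_along_path[OF x a] borel_measurable_along_path[OF xs a]\<close>)

section \<open>Occupation measures\<close>

abbreviation strip :: "real \<Rightarrow> (real \<times> (nat \<Rightarrow> enat)) set" where
  "strip t \<equiv> {0..<t} \<times> OmegaS"

lemma measurable_SpaceL_fst [measurable]: "fst \<in> SpaceL \<rightarrow>\<^sub>M borel"
  by (simp add: SpaceL_def)

lemma measurable_SpaceL_snd [measurable]: "snd \<in> SpaceL \<rightarrow>\<^sub>M count_space UNIV"
  by (simp add: SpaceL_def)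

lemma measurable_SpaceL_section [measurable (raw)]:
  "h \<in> SpaceL \<rightarrow>\<^sub>M N \<Longrightarrow> (\<lambda>s. h (s, w)) \<in> borel \<rightarrow>\<^sub>M N"
  by (rule measurable_compose[of "\<lambda>s. (s, w)"]) (simp_all add: SpaceL_def)

lemma times_sets_SpaceL [measurable]: "A \<in> sets borel \<Longrightarrow> A \<times> B \<in> sets SpaceL"
  by (simp add: SpaceL_def)

lemma Lset_sets: "\<mu> \<in> Lset \<Longrightarrow> sets \<mu> = sets SpaceL"
  by (simp add: Lset_def)

lemma Lset_space: "\<mu> \<in> Lset \<Longrightarrow> space \<mu> = UNIV"
  using sets_eq_imp_space_eq[OF Lset_sets, of \<mu>] by (simp add: SpaceL_def space_pair_measure)

lemma Lset_measurable: "\<mu> \<in> Lset \<Longrightarrow> \<mu> \<rightarrow>\<^sub>M N = SpaceL \<rightarrow>\<^sub>M N"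
  by (rule measurable_cong_sets) (simp_all add: Lset_sets)

lemma Lset_emeasure_strip: "\<mu> \<in> Lset \<Longrightarrow> emeasure \<mu> (strip t) = (if t \<le> 0 then 0 else ennreal t)"
  by (auto simp: Lset_def)

definition time_marginal :: "(real \<times> 'a) measure \<Rightarrow> 'a set \<Rightarrow> real measure" where
  "time_marginal \<mu> B = distr (density \<mu> (indicator ({0..} \<times> B))) borel fst"

lemma nn_integral_time_marginal:
  assumes \<mu>: "\<mu> \<in> Lset" and h [measurable]: "h \<in> borel_measurable borel"
  shows "(\<integral>\<^sup>+s. h s \<partial>time_marginal \<mu> B) = (\<integral>\<^sup>+z. indicator ({0..} \<times> B) z * h (fst z) \<partial>\<mu>)"
proof -
  have [measurable]: "fst \<in> \<mu> \<rightarrow>\<^sub>M borel" "{0..} \<times> B \<in> sets \<mu>"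
    by (simp_all add: Lset_measurable[OF \<mu>] Lset_sets[OF \<mu>] measurable_SpaceL_fst times_sets_SpaceL)
  show ?thesis
    unfolding time_marginal_def by (subst nn_integral_distr; (subst nn_integral_density)?) auto
qed

lemma emeasure_time_marginal:
  assumes \<mu>: "\<mu> \<in> Lset" and A: "A \<in> sets borel"
  shows "emeasure (time_marginal \<mu> B) A = emeasure \<mu> ((A \<inter> {0..}) \<times> B)"
proof -
  have "emeasure (time_marginal \<mu> B) A = (\<integral>\<^sup>+s. indicator A s \<partial>time_marginal \<mu> B)"
    using A by (simp add: time_marginal_def)
  also have "\<dots> = (\<integral>\<^sup>+z. indicator ((A \<inter> {0..}) \<times> B) z \<partial>\<mu>)"
    using A by (subst nn_integral_time_marginal[OF \<mu>])
      (auto intro!: nn_integral_cong simp: indicator_def)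
  also have "\<dots> = emeasure \<mu> ((A \<inter> {0..}) \<times> B)"
    using A by (intro nn_integral_indicator) (simp add: Lset_sets[OF \<mu>] times_sets_SpaceL)
  finally show ?thesis .
qed

lemma time_marginal_OmegaS:
  assumes \<mu>: "\<mu> \<in> Lset"
  shows "time_marginal \<mu> OmegaS = density lborel (indicator {0..})"
proof (rule measure_eqI_generator_eq[where E="range lessThan" and \<Omega>=UNIV and A="\<lambda>i. {..<real i}"])
  have marginal: "emeasure (time_marginal \<mu> OmegaS) {..<c} = (if c \<le> 0 then 0 else ennreal c)" for c :: real
  proof -
    have "{..<c} \<inter> {0..} = {0..<c}"
      by auto
    then show ?thesis
      by (simp add: emeasure_time_marginal[OF \<mu>] Lset_emeasure_strip[OF \<mu>])
  qed
  have half_line: "emeasure (density lborel (indicator {0..})) {..<c} = (if c \<le> 0 then 0 else ennreal c)" for c :: real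
  proof -
    have "emeasure (density lborel (indicator {0..})) {..<c} = (\<integral>\<^sup>+s. indicator {0..} s * indicator {..<c} s \<partial>lborel)"
      by (rule emeasure_density) auto
    also have "\<dots> = (\<integral>\<^sup>+s. indicator {0..<c} s \<partial>lborel)"
      by (rule nn_integral_cong) (auto simp: indicator_def)
    also have "\<dots> = (if c \<le> 0 then 0 else ennreal c)"
      by (cases "c \<le> 0") auto
    finally show ?thesis .
  qed
  show "Int_stable (range (lessThan :: real \<Rightarrow> real set))"
  proof -
    have "{..<a} \<inter> {..<b} = {..<min a b}" for a b :: real
      by auto
    then show ?thesis
      by (auto simp: Int_stable_def)
  qed
  show "emeasure (time_marginal \<mu> OmegaS) X = emeasure (density lborel (indicator {0..})) X"
    if "X \<in> range lessThan" for X
    using that marginal half_line by auto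
  show "emeasure (time_marginal \<mu> OmegaS) {..<real i} \<noteq> \<infinity>" for i
    using marginal by auto
  show "(\<Union>i. {..<real i}) = UNIV"
    using reals_Archimedean2 by auto
qed (auto simp: time_marginal_def borel_Iio)

lemma abs_strip_integral_le:
  fixes h :: "real \<times> (nat \<Rightarrow> enat) \<Rightarrow> real" and b :: "real \<Rightarrow> real"
  assumes \<mu>: "\<mu> \<in> Lset" and b: "set_integrable lborel {0..t} b" "b \<in> borel_measurable borel" "\<And>s. 0 \<le> b s"
    and hb: "\<And>z. z \<in> strip t \<Longrightarrow> \<bar>h z\<bar> \<le> b (fst z)"
  shows "\<bar>LINT z:strip t|\<mu>. h z\<bar> \<le> (LINT s:{0..t}|lborel. b s)"
proof (cases "set_integrable \<mu> (strip t) h")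
  case True
  have "ennreal \<bar>LINT z:strip t|\<mu>. h z\<bar> \<le> (\<integral>\<^sup>+z. ennreal (norm (indicator (strip t) z *\<^sub>R h z)) \<partial>\<mu>)"
    using integral_norm_bound_ennreal[OF True[unfolded set_integrable_def]]
    by (simp add: set_lebesgue_integral_def)
  also have "\<dots> \<le> (\<integral>\<^sup>+z. indicator ({0..} \<times> OmegaS) z * (ennreal (b (fst z)) * indicator {..<t} (fst z)) \<partial>\<mu>)"
    by (rule nn_integral_mono) (use hb in \<open>auto simp: indicator_def intro!: ennreal_leI\<close>)
  also have "\<dots> = (\<integral>\<^sup>+s. ennreal (b s) * indicator {..<t} s \<partial>time_marginal \<mu> OmegaS)"
    using b(2) by (intro nn_integral_time_marginal[OF \<mu>, symmetric]) auto
  also have "\<dots> = (\<integral>\<^sup>+s. indicator {0..} s * (ennreal (b s) * indicator {..<t} s) \<partial>lborel)"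
    unfolding time_marginal_OmegaS[OF \<mu>] using b(2) by (intro nn_integral_density) auto
  also have "\<dots> \<le> (\<integral>\<^sup>+s. ennreal (indicator {0..t} s *\<^sub>R b s) \<partial>lborel)"
    by (rule nn_integral_mono) (auto simp: indicator_def)
  also have "\<dots> = ennreal (LINT s:{0..t}|lborel. b s)"
    unfolding set_lebesgue_integral_def
    by (rule nn_integral_eq_integral) (use b in \<open>auto simp: set_integrable_def\<close>)
  finally show ?thesis
    using b(3)
    by (subst (asm) ennreal_le_iff) (auto simp: set_lebesgue_integral_def intro!: integral_nonneg)
next
  case False
  then have "(LINT z:strip t|\<mu>. h z) = 0"
    by (simp add: set_lebesgue_integral_def set_integrable_def not_integrable_integral_eq)
  then show ?thesis
    using b(3) by (auto simp: set_lebesgue_integral_def intro!: integral_nonneg)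
qed

lemma strip_integrable:
  fixes h :: "real \<times> (nat \<Rightarrow> enat) \<Rightarrow> real"
  assumes \<mu>: "\<mu> \<in> Lset" and h: "h \<in> borel_measurable SpaceL" and B: "\<And>z. z \<in> strip t \<Longrightarrow> \<bar>h z\<bar> \<le> B"
  shows "set_integrable \<mu> (strip t) h"
proof (rule set_integrable_bounded)
  show "strip t \<in> sets \<mu>" "h \<in> borel_measurable \<mu>"
    using h by (simp_all add: Lset_sets[OF \<mu>] Lset_measurable[OF \<mu>] times_sets_SpaceL)
  show "emeasure \<mu> (strip t) < \<infinity>"
    by (simp add: Lset_emeasure_strip[OF \<mu>])
qed (use B in auto)

section \<open>Enumeration of the fast variables\<close>

lemma OmegaS_eventually_constant:
  assumes w: "w \<in> OmegaS"
  obtains K where "\<And>k. K \<le> k \<Longrightarrow> w k = w K"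
proof -
  obtain K where K: "w K = (LEAST e. e \<in> range w)"
    using LeastI[of "\<lambda>e. e \<in> range w" "w 0"] by auto
  have "w k = w K" if "K \<le> k" for k
    using OmegaS_antimono[OF w that] Least_le[of "\<lambda>e. e \<in> range w" "w k"] K by simp
  then show thesis
    by (rule that)
qed

lemma countable_OmegaS: "countable OmegaS"
proof -
  define extend :: "enat list \<Rightarrow> nat \<Rightarrow> enat" where "extend xs k = (if k < length xs then xs ! k else last xs)" for xs k
  have "OmegaS \<subseteq> range extend"
  proof
    fix w
    assume w: "w \<in> OmegaS"
    obtain K where tail: "\<And>k. K \<le> k \<Longrightarrow> w k = w K"
      using OmegaS_eventually_constant[OF w] by blast
    have "extend (map w [0..<Suc K]) k = w k" for k
    proof (cases "k < Suc K")
      case True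
      then show ?thesis
        by (simp add: extend_def del: upt_Suc)
    next
      case False
      then show ?thesis
        using tail[of k] by (simp add: extend_def)
    qed
    then show "w \<in> range extend"
      by (metis ext rangeI)
  qed
  then show ?thesis
    by (rule countable_subset) simp
qed

lemma infinite_OmegaS: "infinite OmegaS"
proof -
  define f :: "nat \<Rightarrow> nat \<Rightarrow> enat" where "f n k = (if k = 0 then \<infinity> else enat n)" for n k
  have "inj f"
    by (rule injI) (metis enat.inject f_def one_neq_zero)
  moreover have "range f \<subseteq> OmegaS"
    by (auto simp: f_def OmegaS_def)
  ultimately show ?thesis
    using infinite_iff_countable_subset by blast
qed

abbreviation enum_OmegaS :: "nat \<Rightarrow> nat \<Rightarrow> enat" where
  "enum_OmegaS \<equiv> from_nat_into OmegaS"

lemma bij_enum_OmegaS: "bij_betw enum_OmegaS UNIV OmegaS"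
  by (rule bij_betw_from_nat_into[OF countable_OmegaS infinite_OmegaS])

lemma inj_enum_OmegaS: "inj enum_OmegaS"
  using bij_enum_OmegaS by (simp add: bij_betw_def)

lemma range_enum_OmegaS: "range enum_OmegaS = OmegaS"
  using bij_enum_OmegaS by (simp add: bij_betw_def)

lemma enum_OmegaS_in: "enum_OmegaS n \<in> OmegaS"
  using range_enum_OmegaS by blast

section \<open>Disintegration of occupation measures\<close>

lemma expectation_pmf_bounded:
  fixes g :: "'a \<Rightarrow> real"
  assumes "\<And>w. w \<in> set_pmf \<rho> \<Longrightarrow> \<bar>g w\<bar> \<le> B"
  shows "integrable (measure_pmf \<rho>) g" "\<bar>measure_pmf.expectation \<rho> g\<bar> \<le> B"
proof -
  show int: "integrable (measure_pmf \<rho>) g"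
    by (rule measure_pmf.integrable_const_bound[of _ B]) (use assms in \<open>auto simp: AE_measure_pmf_iff\<close>)
  have "\<bar>measure_pmf.expectation \<rho> g\<bar> \<le> measure_pmf.expectation \<rho> (\<lambda>w. \<bar>g w\<bar>)"
    by (rule integral_abs_bound)
  also have "\<dots> \<le> measure_pmf.expectation \<rho> (\<lambda>w. B)"
    by (rule integral_mono_AE) (use int assms in \<open>auto simp: AE_measure_pmf_iff\<close>)
  finally show "\<bar>measure_pmf.expectation \<rho> g\<bar> \<le> B"
    by simp
qed

definition disintegrates :: "(real \<times> (nat \<Rightarrow> enat)) measure \<Rightarrow> (real \<Rightarrow> (nat \<Rightarrow> enat) pmf) \<Rightarrow> bool" where
  "disintegrates \<mu> \<kappa> \<longleftrightarrow> (\<forall>s. set_pmf (\<kappa> s) \<subseteq> OmegaS) \<and>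
     (\<forall>t h B. h \<in> borel_measurable SpaceL \<longrightarrow> (\<forall>s\<in>{0..t}. \<forall>w\<in>OmegaS. \<bar>h (s, w)\<bar> \<le> (B :: real)) \<longrightarrow>
        set_integrable lborel {0..t} (\<lambda>s. measure_pmf.expectation (\<kappa> s) (\<lambda>w. h (s, w))) \<and>
        (LINT z:strip t|\<mu>. h z) = (LINT s:{0..t}|lborel. measure_pmf.expectation (\<kappa> s) (\<lambda>w. h (s, w))))"

lemma disintegrates_support: "disintegrates \<mu> \<kappa> \<Longrightarrow> set_pmf (\<kappa> s) \<subseteq> OmegaS"
  by (simp add: disintegrates_def)

lemma disintegrates_integral:
  assumes "disintegrates \<mu> \<kappa>" "h \<in> borel_measurable SpaceL"
    and "\<And>s w. s \<in> {0..t} \<Longrightarrow> w \<in> OmegaS \<Longrightarrow> \<bar>h (s, w)\<bar> \<le> (B :: real)"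
  shows "set_integrable lborel {0..t} (\<lambda>s. measure_pmf.expectation (\<kappa> s) (\<lambda>w. h (s, w)))"
    "(LINT z:strip t|\<mu>. h z) = (LINT s:{0..t}|lborel. measure_pmf.expectation (\<kappa> s) (\<lambda>w. h (s, w)))"
proof -
  have "\<forall>s\<in>{0..t}. \<forall>w\<in>OmegaS. \<bar>h (s, w)\<bar> \<le> B"
    using assms(3) by blast
  note * = assms(1)[unfolded disintegrates_def, THEN conjunct2, THEN spec, THEN spec, THEN spec,
      THEN mp, THEN mp, OF assms(2) this]
  show "set_integrable lborel {0..t} (\<lambda>s. measure_pmf.expectation (\<kappa> s) (\<lambda>w. h (s, w)))"
    using * by (rule conjunct1)
  show "(LINT z:strip t|\<mu>. h z) = (LINT s:{0..t}|lborel. measure_pmf.expectation (\<kappa> s) (\<lambda>w. h (s, w)))"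
    using * by (rule conjunct2)
qed

lemma pmf_kernel_of_densities:
  fixes p :: "nat \<Rightarrow> 'a \<Rightarrow> ennreal"
  assumes [measurable]: "\<And>n. p n \<in> borel_measurable M"
  obtains \<rho> where "\<And>n. (\<lambda>s. pmf (\<rho> s) n) \<in> borel_measurable M"
    "\<And>s n. (\<Sum>n. p n s) = 1 \<Longrightarrow> ennreal (pmf (\<rho> s) n) = p n s"
proof -
  define good where "good s \<longleftrightarrow> (\<Sum>n. p n s) = 1" for s
  have [measurable]: "Measurable.pred M good"
    unfolding good_def[abs_def] by measurable
  define \<rho> where "\<rho> s = (if good s then embed_pmf (\<lambda>n. enn2real (p n s)) else return_pmf 0)" for s
  have finite: "ennreal (enn2real (p n s)) = p n s" if "good s" for s n
  proof -
    have "p n s \<le> (\<Sum>n. p n s)"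
      by (rule sum_le_suminf[of _ "{n}", simplified]) auto
    also have "\<dots> < \<infinity>"
      using that by (simp add: good_def)
    finally show ?thesis
      by simp
  qed
  have pmf_\<rho>: "pmf (\<rho> s) n = (if good s then enn2real (p n s) else indicator {0} n)" for s n
  proof (cases "good s")
    case True
    have "(\<integral>\<^sup>+n. ennreal (enn2real (p n s)) \<partial>count_space UNIV) = 1"
      unfolding finite[OF True] nn_integral_count_space_nat using True by (simp add: good_def)
    then show ?thesis
      using True by (simp add: \<rho>_def pmf_embed_pmf)
  qed (auto simp: \<rho>_def indicator_def)
  show thesis
  proof
    show "(\<lambda>s. pmf (\<rho> s) n) \<in> borel_measurable M" for n
      unfolding pmf_\<rho> by measurable
    show "ennreal (pmf (\<rho> s) n) = p n s" if "(\<Sum>n. p n s) = 1" for s n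
      using finite[of s n] that by (simp add: pmf_\<rho> good_def)
  qed
qed

lemma time_marginal_density:
  assumes \<mu>: "\<mu> \<in> Lset" and w: "w \<in> OmegaS"
  shows "\<exists>p\<in>borel_measurable borel. density lborel p = time_marginal \<mu> {w}"
proof -
  have "\<exists>p\<in>borel_measurable lborel. density lborel p = time_marginal \<mu> {w}"
  proof (rule sigma_finite_measure.Radon_Nikodym[OF lborel.sigma_finite_measure_axioms])
    show "absolutely_continuous lborel (time_marginal \<mu> {w})"
      unfolding absolutely_continuous_def
    proof
      fix A :: "real set"
      assume A: "A \<in> null_sets lborel"
      then have [measurable]: "A \<in> sets borel"
        by auto
      have "emeasure (time_marginal \<mu> {w}) A \<le> emeasure (time_marginal \<mu> OmegaS) A"
        using w
        by (simp add: emeasure_time_marginal[OF \<mu>]) (rule emeasure_mono, auto simp: Lset_sets[OF \<mu>] times_sets_SpaceL)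
      also have "\<dots> = (\<integral>\<^sup>+s. indicator {0..} s * indicator A s \<partial>lborel)"
        unfolding time_marginal_OmegaS[OF \<mu>] by (rule emeasure_density) auto
      also have "\<dots> \<le> (\<integral>\<^sup>+s. indicator A s \<partial>lborel)"
        by (rule nn_integral_mono) (auto simp: indicator_def)
      also have "\<dots> = 0"
        by (subst nn_integral_indicator) (use A in auto)
      finally show "A \<in> null_sets (time_marginal \<mu> {w})"
        by (auto simp: null_sets_def time_marginal_def)
    qed
  qed (simp add: time_marginal_def)
  then show ?thesis
    by simp
qed

lemma Lset_densities:
  assumes \<mu>: "\<mu> \<in> Lset"
  obtains p :: "nat \<Rightarrow> real \<Rightarrow> ennreal" where "\<And>n. p n \<in> borel_measurable borel"
    "\<And>n. time_marginal \<mu> {enum_OmegaS n} = density lborel (p n)"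
    "AE s in lborel. (\<Sum>n. p n s) = indicator {0..} s"
proof -
  obtain p where [measurable]: "\<And>n. p n \<in> borel_measurable borel"
    and p: "\<And>n. density lborel (p n) = time_marginal \<mu> {enum_OmegaS n}"
    using time_marginal_density[OF \<mu> enum_OmegaS_in] by metis
  have "density lborel (\<lambda>s. \<Sum>n. p n s) = density lborel (indicator {0..})"
  proof (rule measure_eqI)
    fix A :: "real set"
    assume "A \<in> sets (density lborel (\<lambda>s. \<Sum>n. p n s))"
    then have A [measurable]: "A \<in> sets borel"
      by simp
    have "emeasure (density lborel (\<lambda>s. \<Sum>n. p n s)) A = (\<integral>\<^sup>+s. (\<Sum>n. p n s * indicator A s) \<partial>lborel)"
      by (subst emeasure_density) auto
    also have "\<dots> = (\<Sum>n. emeasure (density lborel (p n)) A)"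
      by (subst nn_integral_suminf) (auto simp: emeasure_density)
    also have "\<dots> = (\<Sum>n. emeasure \<mu> ((A \<inter> {0..}) \<times> {enum_OmegaS n}))"
      by (simp add: p emeasure_time_marginal[OF \<mu>])
    also have "\<dots> = emeasure \<mu> (\<Union>n. (A \<inter> {0..}) \<times> {enum_OmegaS n})"
    proof (rule suminf_emeasure)
      show "range (\<lambda>n. (A \<inter> {0..}) \<times> {enum_OmegaS n}) \<subseteq> sets \<mu>"
        by (auto simp: Lset_sets[OF \<mu>] times_sets_SpaceL)
      show "disjoint_family (\<lambda>n. (A \<inter> {0..}) \<times> {enum_OmegaS n})"
        using inj_enum_OmegaS by (auto simp: disjoint_family_on_def inj_def)
    qed
    also have "(\<Union>n. (A \<inter> {0..}) \<times> {enum_OmegaS n}) = (A \<inter> {0..}) \<times> range enum_OmegaS"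
      by auto
    also have "emeasure \<mu> \<dots> = emeasure (density lborel (indicator {0..})) A"
      unfolding range_enum_OmegaS
      by (simp add: time_marginal_OmegaS[OF \<mu>, symmetric] emeasure_time_marginal[OF \<mu>])
    finally show "emeasure (density lborel (\<lambda>s. \<Sum>n. p n s)) A = emeasure (density lborel (indicator {0..})) A" .
  qed simp
  then have "AE s in lborel. (\<Sum>n. p n s) = indicator {0..} s"
    by (intro sigma_finite_measure.density_unique[OF lborel.sigma_finite_measure_axioms]) auto
  then show thesis
    by (intro that[of p]) (simp_all add: p)
qed

lemma nn_integral_strip_densities:
  assumes \<mu>: "\<mu> \<in> Lset" and [measurable]: "h \<in> borel_measurable SpaceL" "\<And>n. p n \<in> borel_measurable borel"
    and p: "\<And>n. time_marginal \<mu> {enum_OmegaS n} = density lborel (p n)"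
  shows "(\<integral>\<^sup>+z. h z * indicator (strip t) z \<partial>\<mu>) =
    (\<integral>\<^sup>+s. (\<Sum>n. p n s * h (s, enum_OmegaS n)) * indicator {..<t} s \<partial>lborel)"
proof -
  let ?slice = "\<lambda>n. {0..<t} \<times> {enum_OmegaS n}"
  have slice: "(\<integral>\<^sup>+z. h z * indicator (?slice n) z \<partial>\<mu>) = (\<integral>\<^sup>+s. p n s * h (s, enum_OmegaS n) * indicator {..<t} s \<partial>lborel)" for n
  proof -
    have "(\<integral>\<^sup>+z. h z * indicator (?slice n) z \<partial>\<mu>) =
        (\<integral>\<^sup>+z. indicator ({0..} \<times> {enum_OmegaS n}) z * (h (fst z, enum_OmegaS n) * indicator {..<t} (fst z)) \<partial>\<mu>)"
      by (rule nn_integral_cong) (auto simp: indicator_def)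
    also have "\<dots> = (\<integral>\<^sup>+s. h (s, enum_OmegaS n) * indicator {..<t} s \<partial>time_marginal \<mu> {enum_OmegaS n})"
      by (rule nn_integral_time_marginal[OF \<mu>, symmetric]) measurable
    also have "\<dots> = (\<integral>\<^sup>+s. p n s * (h (s, enum_OmegaS n) * indicator {..<t} s) \<partial>lborel)"
      unfolding p by (rule nn_integral_density) auto
    finally show ?thesis
      by (simp add: mult.assoc)
  qed
  have "h z * indicator (strip t) z = (\<Sum>n. h z * indicator (?slice n) z)" for z
  proof (cases "z \<in> strip t")
    case True
    then obtain m where m: "enum_OmegaS m = snd z"
      using range_enum_OmegaS by (metis imageE mem_Times_iff)
    have "(\<Sum>n. h z * indicator (?slice n) z) = (\<Sum>n\<in>{m}. h z * indicator (?slice n) z)"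
      by (rule suminf_finite) (use m inj_enum_OmegaS in \<open>auto simp: indicator_def inj_def\<close>)
    then show ?thesis
      using True m by (auto simp: indicator_def mem_Times_iff)
  next
    case False
    then have "z \<notin> ?slice n" for n
      using enum_OmegaS_in by auto
    then show ?thesis
      using False by simp
  qed
  then have "(\<integral>\<^sup>+z. h z * indicator (strip t) z \<partial>\<mu>) = (\<Sum>n. \<integral>\<^sup>+z. h z * indicator (?slice n) z \<partial>\<mu>)"
    by (subst nn_integral_suminf[symmetric])
       (simp_all add: Lset_measurable[OF \<mu>] borel_measurable_times borel_measurable_indicator times_sets_SpaceL)
  also have "\<dots> = (\<integral>\<^sup>+s. (\<Sum>n. p n s * h (s, enum_OmegaS n) * indicator {..<t} s) \<partial>lborel)"
    unfolding slice by (rule nn_integral_suminf[symmetric]) measurable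
  finally show ?thesis
    by simp
qed

definition nn_disintegrates :: "(real \<times> (nat \<Rightarrow> enat)) measure \<Rightarrow> (real \<Rightarrow> (nat \<Rightarrow> enat) pmf) \<Rightarrow> bool" where
  "nn_disintegrates \<mu> \<kappa> \<longleftrightarrow> (\<forall>s. set_pmf (\<kappa> s) \<subseteq> OmegaS) \<and>
     (\<forall>h\<in>borel_measurable SpaceL. (\<lambda>s. \<integral>\<^sup>+w. h (s, w) \<partial>measure_pmf (\<kappa> s)) \<in> borel_measurable borel \<and>
        (\<forall>t. (\<integral>\<^sup>+z. h z * indicator (strip t) z \<partial>\<mu>) =
          (\<integral>\<^sup>+s. (\<integral>\<^sup>+w. h (s, w) \<partial>measure_pmf (\<kappa> s)) * indicator {0..t} s \<partial>lborel)))"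

lemma nn_disintegrates_densities:
  assumes \<mu>: "\<mu> \<in> Lset" and [measurable]: "\<And>n. p n \<in> borel_measurable borel"
    and p: "\<And>n. time_marginal \<mu> {enum_OmegaS n} = density lborel (p n)"
    and total: "AE s in lborel. (\<Sum>n. p n s) = indicator {0..} s"
    and [measurable]: "\<And>n. (\<lambda>s. pmf (\<rho> s) n) \<in> borel_measurable borel"
    and \<rho>: "\<And>s n. (\<Sum>n. p n s) = 1 \<Longrightarrow> ennreal (pmf (\<rho> s) n) = p n s"
  shows "nn_disintegrates \<mu> (\<lambda>s. map_pmf enum_OmegaS (\<rho> s))"
  unfolding nn_disintegrates_def
proof (intro conjI allI ballI)
  have kernel_sum: "(\<integral>\<^sup>+w. h w \<partial>measure_pmf (map_pmf enum_OmegaS (\<rho> s))) = (\<Sum>n. ennreal (pmf (\<rho> s) n) * h (enum_OmegaS n))" for s h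
    unfolding nn_integral_map_pmf by (simp add: nn_integral_measure_pmf nn_integral_count_space_nat)
  show "set_pmf (map_pmf enum_OmegaS (\<rho> s)) \<subseteq> OmegaS" for s
    by (auto simp: enum_OmegaS_in)
  fix h :: "real \<times> (nat \<Rightarrow> enat) \<Rightarrow> ennreal" and t
  assume [measurable]: "h \<in> borel_measurable SpaceL"
  let ?N = "\<lambda>s. \<integral>\<^sup>+w. h (s, w) \<partial>measure_pmf (map_pmf enum_OmegaS (\<rho> s))"
  show "?N \<in> borel_measurable borel"
    unfolding kernel_sum by measurable
  have "AE s in lborel. (\<Sum>n. p n s * h (s, enum_OmegaS n)) * indicator {..<t} s = ?N s * indicator {0..t} s"
    using total AE_lborel_singleton[of t]
  proof eventually_elim
    case (elim s)
    show ?case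
    proof (cases "0 \<le> s")
      case True
      then have "(indicator {..<t} s :: ennreal) = indicator {0..t} s"
        using elim(2) by (auto simp: indicator_def)
      then show ?thesis
        unfolding kernel_sum using \<rho>[of s] elim(1) True by simp
    next
      case False
      then have "p n s = 0" for n
        using elim(1) by (simp add: suminf_eq_zero_iff)
      then show ?thesis
        using False by simp
    qed
  qed
  then show "(\<integral>\<^sup>+z. h z * indicator (strip t) z \<partial>\<mu>) = (\<integral>\<^sup>+s. ?N s * indicator {0..t} s \<partial>lborel)"
    by (subst nn_integral_strip_densities[OF \<mu> _ _ p]) (auto intro: nn_integral_cong_AE)
qed

lemma Lset_nn_disintegration:
  assumes \<mu>: "\<mu> \<in> Lset"
  obtains \<kappa> where "nn_disintegrates \<mu> \<kappa>"
proof -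
  obtain p where p: "\<And>n. p n \<in> borel_measurable borel"
    "\<And>n. time_marginal \<mu> {enum_OmegaS n} = density lborel (p n)"
    "AE s in lborel. (\<Sum>n. p n s) = indicator {0..} s"
    by (rule Lset_densities[OF \<mu>]) (rule that)
  obtain \<rho> where \<rho>: "\<And>n. (\<lambda>s. pmf (\<rho> s) n) \<in> borel_measurable borel"
    "\<And>s n. (\<Sum>n. p n s) = 1 \<Longrightarrow> ennreal (pmf (\<rho> s) n) = p n s"
    by (rule pmf_kernel_of_densities[of p borel]) (rule p(1), rule that)
  from \<mu> p \<rho> have "nn_disintegrates \<mu> (\<lambda>s. map_pmf enum_OmegaS (\<rho> s))"
    by (rule nn_disintegrates_densities)
  then show thesis
    by (rule that)
qed

lemma nn_disintegrates_bounded_nonneg: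
  fixes h :: "real \<times> (nat \<Rightarrow> enat) \<Rightarrow> real"
  assumes \<mu>: "\<mu> \<in> Lset" and \<kappa>: "nn_disintegrates \<mu> \<kappa>" and [measurable]: "h \<in> borel_measurable SpaceL"
    and h0: "\<And>z. 0 \<le> h z" and B: "\<And>s w. s \<in> {0..t} \<Longrightarrow> w \<in> OmegaS \<Longrightarrow> \<bar>h (s, w)\<bar> \<le> B"
  shows "set_integrable lborel {0..t} (\<lambda>s. measure_pmf.expectation (\<kappa> s) (\<lambda>w. h (s, w)))"
    "(LINT z:strip t|\<mu>. h z) = (LINT s:{0..t}|lborel. measure_pmf.expectation (\<kappa> s) (\<lambda>w. h (s, w)))"
proof -
  let ?E = "\<lambda>s. measure_pmf.expectation (\<kappa> s) (\<lambda>w. h (s, w))"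
  let ?N = "\<lambda>s. \<integral>\<^sup>+w. ennreal (h (s, w)) \<partial>measure_pmf (\<kappa> s)"
  have bounded: "integrable (measure_pmf (\<kappa> s)) (\<lambda>w. h (s, w))" "\<bar>?E s\<bar> \<le> B" if "s \<in> {0..t}" for s
    using expectation_pmf_bounded[of "\<kappa> s" "\<lambda>w. h (s, w)" B] B[OF that] \<kappa>
    by (auto simp: nn_disintegrates_def)
  have kernel: "?N \<in> borel_measurable borel"
    "(\<integral>\<^sup>+z. ennreal (h z) * indicator (strip t) z \<partial>\<mu>) = (\<integral>\<^sup>+s. ?N s * indicator {0..t} s \<partial>lborel)"
    using \<kappa>[unfolded nn_disintegrates_def, THEN conjunct2, rule_format, of "\<lambda>z. ennreal (h z)"] by simp_all
  have "?E s = enn2real (?N s)" for s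
    using h0 by (intro integral_eq_nn_integral) auto
  then have [measurable]: "?E \<in> borel_measurable borel"
    using kernel(1) by simp
  show "set_integrable lborel {0..t} ?E"
    by (rule set_integrable_bounded_Icc[where B=B]) (use bounded(2) in auto)
  have [measurable]: "h \<in> borel_measurable \<mu>" "strip t \<in> sets \<mu>"
    by (simp_all add: Lset_measurable[OF \<mu>] Lset_sets[OF \<mu>] times_sets_SpaceL)
  have "(LINT z:strip t|\<mu>. h z) = enn2real (\<integral>\<^sup>+z. ennreal (h z) * indicator (strip t) z \<partial>\<mu>)"
    unfolding set_lebesgue_integral_def using h0
    by (subst integral_eq_nn_integral)
      (auto simp: indicator_def intro!: arg_cong[of _ _ enn2real] nn_integral_cong)
  also have "\<dots> = enn2real (\<integral>\<^sup>+s. ennreal (indicator {0..t} s *\<^sub>R ?E s) \<partial>lborel)"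
  proof -
    have "?N s = ennreal (?E s)" if "s \<in> {0..t}" for s
      using bounded(1)[OF that] h0 by (intro nn_integral_eq_integral) auto
    then show ?thesis
      unfolding kernel(2) by (auto simp: indicator_def intro!: arg_cong[of _ _ enn2real] nn_integral_cong)
  qed
  also have "\<dots> = (LINT s:{0..t}|lborel. ?E s)"
    unfolding set_lebesgue_integral_def using h0 by (intro integral_eq_nn_integral[symmetric]) auto
  finally show "(LINT z:strip t|\<mu>. h z) = (LINT s:{0..t}|lborel. ?E s)" .
qed

lemma nn_disintegrates_bounded:
  fixes h :: "real \<times> (nat \<Rightarrow> enat) \<Rightarrow> real"
  assumes \<mu>: "\<mu> \<in> Lset" and \<kappa>: "nn_disintegrates \<mu> \<kappa>" and [measurable]: "h \<in> borel_measurable SpaceL"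
    and B: "\<And>s w. s \<in> {0..t} \<Longrightarrow> w \<in> OmegaS \<Longrightarrow> \<bar>h (s, w)\<bar> \<le> B"
  shows "set_integrable lborel {0..t} (\<lambda>s. measure_pmf.expectation (\<kappa> s) (\<lambda>w. h (s, w)))"
    "(LINT z:strip t|\<mu>. h z) = (LINT s:{0..t}|lborel. measure_pmf.expectation (\<kappa> s) (\<lambda>w. h (s, w)))"
proof -
  let ?E = "\<lambda>h s. measure_pmf.expectation (\<kappa> s) (\<lambda>w. h (s, w))"
  define pos where "pos z = max 0 (h z)" for z
  define neg where "neg z = max 0 (- h z)" for z
  have parts: "h z = pos z - neg z" "0 \<le> pos z" "0 \<le> neg z" for z
    by (auto simp: pos_def neg_def)
  have part_bounds: "\<bar>pos (s, w)\<bar> \<le> B" "\<bar>neg (s, w)\<bar> \<le> B" if "s \<in> {0..t}" "w \<in> OmegaS" for s w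
    using B[OF that] by (auto simp: pos_def neg_def)
  have parts_measurable: "pos \<in> borel_measurable SpaceL" "neg \<in> borel_measurable SpaceL"
    unfolding pos_def[abs_def] neg_def[abs_def] by measurable
  note pos = nn_disintegrates_bounded_nonneg[where h=pos, OF \<mu> \<kappa> parts_measurable(1) parts(2) part_bounds(1)]
  note neg = nn_disintegrates_bounded_nonneg[where h=neg, OF \<mu> \<kappa> parts_measurable(2) parts(3) part_bounds(2)]
  have E_split: "?E h s = ?E pos s - ?E neg s" if s: "s \<in> {0..t}" for s
  proof -
    have support: "set_pmf (\<kappa> s) \<subseteq> OmegaS"
      using \<kappa> by (simp add: nn_disintegrates_def)
    have "integrable (measure_pmf (\<kappa> s)) (\<lambda>w. pos (s, w))" "integrable (measure_pmf (\<kappa> s)) (\<lambda>w. neg (s, w))"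
      by (rule expectation_pmf_bounded[where B=B]; use support part_bounds s in blast)+
    then show ?thesis
      unfolding parts(1)[of "(s, _)"] by simp
  qed
  have "set_integrable lborel {0..t} (\<lambda>s. ?E pos s - ?E neg s)"
    by (intro set_integral_diff(1) pos(1) neg(1))
  then show "set_integrable lborel {0..t} (?E h)"
    by (subst set_integrable_cong[OF refl refl, where f'="\<lambda>s. ?E pos s - ?E neg s"])
      (simp_all only: E_split)
  have "set_integrable \<mu> (strip t) pos" "set_integrable \<mu> (strip t) neg"
    by (rule strip_integrable[OF \<mu>, where B=B]; use parts_measurable part_bounds in force)+
  then have "(LINT z:strip t|\<mu>. h z) = (LINT z:strip t|\<mu>. pos z) - (LINT z:strip t|\<mu>. neg z)"
    unfolding parts(1) by (rule set_integral_diff(2))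
  also have "\<dots> = (LINT s:{0..t}|lborel. ?E pos s - ?E neg s)"
    using set_integral_diff(2)[OF pos(1) neg(1)] pos(2) neg(2) by simp
  also have "\<dots> = (LINT s:{0..t}|lborel. ?E h s)"
    by (rule set_lebesgue_integral_cong) (use E_split in auto)
  finally show "(LINT z:strip t|\<mu>. h z) = (LINT s:{0..t}|lborel. ?E h s)" .
qed

lemma Lset_disintegration:
  assumes \<mu>: "\<mu> \<in> Lset"
  obtains \<kappa> where "disintegrates \<mu> \<kappa>"
proof -
  obtain \<kappa> where \<kappa>: "nn_disintegrates \<mu> \<kappa>"
    by (rule Lset_nn_disintegration[OF \<mu>])
  have "disintegrates \<mu> \<kappa>"
    unfolding disintegrates_def
  proof (intro conjI allI impI)
    show "set_pmf (\<kappa> s) \<subseteq> OmegaS" for s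
      using \<kappa> by (simp add: nn_disintegrates_def)
  qed (rule nn_disintegrates_bounded[OF \<mu> \<kappa>]; blast)+
  then show thesis
    by (rule that)
qed

lemma disintegrates_modify:
  assumes d: "disintegrates \<mu> \<kappa>" and N: "N \<in> null_sets lborel" and w0: "w0 \<in> OmegaS"
  shows "disintegrates \<mu> (\<lambda>s. if s \<in> N then return_pmf w0 else \<kappa> s)"
  unfolding disintegrates_def
proof (intro conjI allI impI)
  show "set_pmf (if s \<in> N then return_pmf w0 else \<kappa> s) \<subseteq> OmegaS" for s
    using disintegrates_support[OF d] w0 by simp
  fix t B and h :: "real \<times> (nat \<Rightarrow> enat) \<Rightarrow> real"
  assume h: "h \<in> borel_measurable SpaceL" and B: "\<forall>s\<in>{0..t}. \<forall>w\<in>OmegaS. \<bar>h (s, w)\<bar> \<le> B"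
  have [measurable]: "(\<lambda>s. h (s, w0)) \<in> borel_measurable borel" "N \<in> sets borel"
    using h N by (auto intro: measurable_SpaceL_section)
  let ?f = "\<lambda>s. measure_pmf.expectation (\<kappa> s) (\<lambda>w. h (s, w))"
  let ?g = "\<lambda>s. measure_pmf.expectation (if s \<in> N then return_pmf w0 else \<kappa> s) (\<lambda>w. h (s, w))"
  have f: "set_integrable lborel {0..t} ?f" "(LINT z:strip t|\<mu>. h z) = (LINT s:{0..t}|lborel. ?f s)"
    using disintegrates_integral[OF d h] B by blast+
  have [measurable]: "(\<lambda>s. indicator {0..t} s * ?f s) \<in> borel_measurable borel"
    using borel_measurable_integrable[OF f(1)[unfolded set_integrable_def]] by simp
  have "indicator {0..t} s * ?g s = (if s \<in> N then indicator {0..t} s * h (s, w0) else indicator {0..t} s * ?f s)" for s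
    by simp
  then have [measurable]: "(\<lambda>s. indicator {0..t} s * ?g s) \<in> borel_measurable borel"
    by (simp only:) measurable
  have ae: "AE s in lborel. indicator {0..t} s * ?f s = indicator {0..t} s * ?g s"
    using AE_not_in[OF N] by eventually_elim simp
  show "set_integrable lborel {0..t} ?g"
    using f(1) integrable_cong_AE[OF _ _ ae] by (simp add: set_integrable_def)
  show "(LINT z:strip t|\<mu>. h z) = (LINT s:{0..t}|lborel. ?g s)"
    using f(2) integral_cong_AE[OF _ _ ae] by (simp add: set_lebesgue_integral_def)
qed

lemma disintegrates_prob:
  assumes d: "disintegrates \<mu> \<kappa>" and \<mu>: "\<mu> \<in> Lset" and A: "A \<subseteq> OmegaS"
  shows "set_integrable lborel {0..t} (\<lambda>s. measure_pmf.prob (\<kappa> s) A)"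
    "measure \<mu> ({0..<t} \<times> A) = (LINT s:{0..t}|lborel. measure_pmf.prob (\<kappa> s) A)"
proof -
  have "(\<lambda>z. indicator A (snd z) :: real) \<in> borel_measurable SpaceL"
    by (rule measurable_compose[OF measurable_SpaceL_snd]) simp
  note D = disintegrates_integral[OF d this, of t 1]
  show "set_integrable lborel {0..t} (\<lambda>s. measure_pmf.prob (\<kappa> s) A)"
    using D(1) by simp
  have "(LINT z:strip t|\<mu>. indicator A (snd z) :: real) = (\<integral>z. indicator ({0..<t} \<times> A) z \<partial>\<mu>)"
    unfolding set_lebesgue_integral_def
    by (rule Bochner_Integration.integral_cong) (use A in \<open>auto simp: indicator_def\<close>)
  then show "measure \<mu> ({0..<t} \<times> A) = (LINT s:{0..t}|lborel. measure_pmf.prob (\<kappa> s) A)"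
    using D(2) by (simp add: Lset_space[OF \<mu>])
qed

section \<open>Continuous functions of the fast variables\<close>

lemma continuous_on_enat:
  fixes \<phi> :: "enat \<Rightarrow> 'b::topological_space"
  assumes lim: "(\<lambda>n. \<phi> (enat n)) \<longlonglongrightarrow> \<phi> \<infinity>"
  shows "continuous_on UNIV \<phi>"
proof -
  have "(\<phi> \<longlongrightarrow> \<phi> e) (nhds e)" for e
  proof (rule topological_tendstoI)
    fix S
    assume S: "open S" "\<phi> e \<in> S"
    show "\<forall>\<^sub>F e' in nhds e. \<phi> e' \<in> S"
    proof (cases e)
      case (enat n)
      then show ?thesis
        using S by (simp add: nhds_enat eventually_principal)
    next
      case infinity
      then obtain N where N: "\<And>n. N \<le> n \<Longrightarrow> \<phi> (enat n) \<in> S"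
        using topological_tendstoD[OF lim] S by (auto simp: eventually_sequentially)
      have "\<forall>\<^sub>F e' in nhds e. enat N < e'"
        using infinity by (intro order_tendstoD(1)[OF filterlim_ident]) simp
      then show ?thesis
      proof eventually_elim
        case (elim e')
        then show ?case
          using N S infinity by (cases e') auto
      qed
    qed
  qed
  then show ?thesis
    by (auto simp: continuous_on_def intro: tendsto_mono[OF at_within_le_nhds])
qed

lemma continuous_on_enat_pred: "continuous_on UNIV (\<lambda>e :: enat. e - 1)"
proof (rule continuous_on_enat)
  show "(\<lambda>n. enat n - 1) \<longlonglongrightarrow> \<infinity> - 1"
  proof (rule order_tendstoI)
    fix a :: enat
    assume "a < \<infinity> - 1"
    then obtain m where m: "a = enat m"
      by (cases a) auto
    show "\<forall>\<^sub>F n in sequentially. a < enat n - 1"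
      using eventually_gt_at_top[of "Suc m"] by eventually_elim (simp add: m one_enat_def)
  qed simp
qed

lemma continuous_on_level:
  "continuous_on UNIV \<phi> \<Longrightarrow> continuous_on UNIV (\<lambda>w :: nat \<Rightarrow> 'a::topological_space. \<phi> (w k))"
  by (rule continuous_on_compose2[OF _ continuous_on_product_coordinates]) auto

lemma continuous_on_arrive: "continuous_on UNIV (\<lambda>w :: nat \<Rightarrow> enat. arrive w k)"
proof (rule continuous_on_coordinatewise_then_product)
  fix i
  show "continuous_on UNIV (\<lambda>w :: nat \<Rightarrow> enat. arrive w k i)"
    by (cases "i = k") (simp_all add: arrive_def continuous_on_add)
qed

lemma continuous_on_depart: "continuous_on UNIV (\<lambda>w :: nat \<Rightarrow> enat. depart w k)"
proof (rule continuous_on_coordinatewise_then_product)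
  fix i
  show "continuous_on UNIV (\<lambda>w :: nat \<Rightarrow> enat. depart w k i)"
    using continuous_on_level[OF continuous_on_enat_pred, of k]
    by (cases "i = k") (simp_all add: depart_def)
qed

lemma (in lcq_parameters) continuous_on_departure_rate: "continuous_on UNIV (\<lambda>w. departure_rate q w k)"
proof -
  have "(\<lambda>n. (1 - q) ^ n) \<longlonglongrightarrow> 0"
    by (rule LIMSEQ_power_zero) (use q_pos q_le_1 in simp)
  then have "continuous_on UNIV (pw q)"
    by (intro continuous_on_enat) (simp add: pw_def)
  then show ?thesis
    unfolding departure_rate_def by (intro continuous_on_diff continuous_on_level)
qed

lemma continuous_on_indicator_less: "continuous_on UNIV (indicator {..<enat N} :: enat \<Rightarrow> real)"
proof (rule continuous_on_enat)
  show "(\<lambda>n. indicator {..<enat N} (enat n)) \<longlonglongrightarrow> (indicator {..<enat N} \<infinity> :: real)"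
    by (rule tendsto_eventually) (auto simp: eventually_sequentially indicator_def intro: exI[of _ N])
qed

section \<open>Continuous functionals of paths and occupation measures\<close>

lemma Ftest_compose2:
  fixes h :: "real \<Rightarrow> real \<Rightarrow> real"
  assumes F: "Ftest F" and G: "Ftest G" and h: "continuous_on UNIV (\<lambda>(a, b). h a b)"
  shows "Ftest (\<lambda>p. h (F p) (G p))"
  unfolding Ftest_def
proof (intro conjI allI impI)
  have "bounded (F ` (Dsp \<times> Lset))" "bounded (G ` (Dsp \<times> Lset))"
    using F G unfolding Ftest_def by blast+
  then obtain A B where AB: "\<And>p. p \<in> Dsp \<times> Lset \<Longrightarrow> F p \<in> cball 0 A" "\<And>p. p \<in> Dsp \<times> Lset \<Longrightarrow> G p \<in> cball 0 B"
    unfolding bounded_iff by (auto simp: dist_real_def) metis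
  have "compact ((\<lambda>(a, b). h a b) ` (cball 0 A \<times> cball 0 B))"
    by (intro compact_continuous_image continuous_on_subset[OF h] compact_Times compact_cball) simp
  moreover have "(\<lambda>p. h (F p) (G p)) ` (Dsp \<times> Lset) \<subseteq> (\<lambda>(a, b). h a b) ` (cball 0 A \<times> cball 0 B)"
  proof (rule image_subsetI)
    fix p
    assume "p \<in> Dsp \<times> Lset"
    then have "(F p, G p) \<in> cball 0 A \<times> cball 0 B"
      using AB by blast
    then show "h (F p) (G p) \<in> (\<lambda>(a, b). h a b) ` (cball 0 A \<times> cball 0 B)"
      by force
  qed
  ultimately show "bounded ((\<lambda>p. h (F p) (G p)) ` (Dsp \<times> Lset))"
    by (rule bounded_subset[OF compact_imp_bounded])
  show "h (F (x, \<mu>)) (G (x, \<mu>)) = h (F (\<lambda>t. x (max 0 t), \<mu>)) (G (\<lambda>t. x (max 0 t), \<mu>))" for x \<mu>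
    using F G unfolding Ftest_def by metis
  fix xs x \<mu>s \<mu>
  assume "\<forall>m. xs m \<in> Dsp \<and> \<mu>s m \<in> Lset" "x \<in> Dsp" "\<mu> \<in> Lset" "J1conv xs x" "Lconv \<mu>s \<mu>"
  then have "(\<lambda>m. F (xs m, \<mu>s m)) \<longlonglongrightarrow> F (x, \<mu>)" "(\<lambda>m. G (xs m, \<mu>s m)) \<longlonglongrightarrow> G (x, \<mu>)"
    using F G unfolding Ftest_def by blast+
  then have "(\<lambda>m. (F (xs m, \<mu>s m), G (xs m, \<mu>s m))) \<longlonglongrightarrow> (F (x, \<mu>), G (x, \<mu>))"
    by (rule tendsto_Pair)
  from continuous_on_tendsto_compose[OF h this]
  show "(\<lambda>m. h (F (xs m, \<mu>s m)) (G (xs m, \<mu>s m))) \<longlonglongrightarrow> h (F (x, \<mu>)) (G (x, \<mu>))"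
    by simp
qed

lemma Ftest_add: "Ftest F \<Longrightarrow> Ftest G \<Longrightarrow> Ftest (\<lambda>p. F p + G p)"
  by (rule Ftest_compose2[where h="(+)"]) (auto intro!: continuous_intros simp: split_beta')

lemma Ftest_diff: "Ftest F \<Longrightarrow> Ftest G \<Longrightarrow> Ftest (\<lambda>p. F p - G p)"
  by (rule Ftest_compose2[where h="(-)"]) (auto intro!: continuous_intros simp: split_beta')

lemma Ftest_cmult: "Ftest F \<Longrightarrow> Ftest (\<lambda>p. c * F p)"
  by (rule Ftest_compose2[where h="\<lambda>a b. c * a"]) (auto intro!: continuous_intros simp: split_beta')

lemma Ftest_abs: "Ftest F \<Longrightarrow> Ftest (\<lambda>p. \<bar>F p\<bar>)"
  by (rule Ftest_compose2[where h="\<lambda>a b. \<bar>a\<bar>"]) (auto intro!: continuous_intros simp: split_beta')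

lemma Ftest_cong:
  assumes F: "Ftest F" and eq: "\<And>p. p \<in> Dsp \<times> Lset \<Longrightarrow> F p = G p"
    and half_line: "\<And>x \<mu>. G (x, \<mu>) = G (\<lambda>t. x (max 0 t), \<mu>)"
  shows "Ftest G"
  unfolding Ftest_def
proof (intro conjI allI impI half_line)
  show "bounded (G ` (Dsp \<times> Lset))"
    using F eq unfolding Ftest_def by (simp cong: image_cong)
  fix xs x \<mu>s \<mu>
  assume mem: "\<forall>m. xs m \<in> Dsp \<and> \<mu>s m \<in> Lset" "x \<in> Dsp" "\<mu> \<in> Lset" and "J1conv xs x" "Lconv \<mu>s \<mu>"
  then have "(\<lambda>m. F (xs m, \<mu>s m)) \<longlonglongrightarrow> F (x, \<mu>)"
    using F unfolding Ftest_def by blast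
  then show "(\<lambda>m. G (xs m, \<mu>s m)) \<longlonglongrightarrow> G (x, \<mu>)"
    using mem by (simp add: eq)
qed

lemma Ftest_initial: "Ftest (\<lambda>p. fst p 0 k)"
  unfolding Ftest_def
proof (intro conjI allI impI)
  show "bounded ((\<lambda>p. fst p 0 k) ` (Dsp \<times> Lset))"
    unfolding bounded_iff using Uset_range[OF Dsp_Uset, of _ 0 k] by (intro exI[of _ 1]) auto
  show "fst (x, \<mu>) 0 k = fst (\<lambda>t. x (max 0 t), \<mu>) 0 k"
    for x :: "real \<Rightarrow> nat \<Rightarrow> real" and \<mu> :: "(real \<times> (nat \<Rightarrow> enat)) measure"
    by simp
  fix xs x and \<mu>s :: "nat \<Rightarrow> (real \<times> (nat \<Rightarrow> enat)) measure" and \<mu>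
  assume "\<forall>m. xs m \<in> Dsp \<and> \<mu>s m \<in> Lset" "x \<in> Dsp" "J1conv xs x"
  then have "(\<lambda>m. xs m 0) \<longlonglongrightarrow> x 0"
    by (intro J1conv_pointwise) auto
  from continuous_on_tendsto_compose[OF continuous_on_product_coordinates this]
  show "(\<lambda>m. fst (xs m, \<mu>s m) 0 k) \<longlonglongrightarrow> fst (x, \<mu>) 0 k"
    by simp
qed

lemma product_strip_integral_diff_le:
  fixes g :: "(nat \<Rightarrow> enat) \<Rightarrow> real" and y y' :: "real \<Rightarrow> real"
  assumes \<mu>: "\<mu> \<in> Lset" and [measurable]: "y \<in> borel_measurable borel" "y' \<in> borel_measurable borel"
    and C: "\<And>s. \<bar>y s\<bar> \<le> C" "\<And>s. \<bar>y' s\<bar> \<le> C" and B: "\<And>w. \<bar>g w\<bar> \<le> B"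
  shows "\<bar>(LINT z:strip t|\<mu>. y (fst z) * g (snd z)) - (LINT z:strip t|\<mu>. y' (fst z) * g (snd z))\<bar>
    \<le> B * (LINT s:{0..t}|lborel. \<bar>y s - y' s\<bar>)"
proof -
  have "0 \<le> B" "0 \<le> C"
    using B[of undefined] C(1)[of 0] by linarith+
  have [measurable]: "(\<lambda>z. g (snd z)) \<in> borel_measurable SpaceL"
    by (rule measurable_compose[OF measurable_SpaceL_snd]) simp
  have int: "set_integrable \<mu> (strip t) (\<lambda>z. y (fst z) * g (snd z))"
    "set_integrable \<mu> (strip t) (\<lambda>z. y' (fst z) * g (snd z))"
    by (rule strip_integrable[OF \<mu>, where B="C * B"]; auto simp: abs_mult intro!: mult_mono C B \<open>0 \<le> C\<close>)+
  have "\<bar>LINT z:strip t|\<mu>. (y (fst z) - y' (fst z)) * g (snd z)\<bar> \<le> (LINT s:{0..t}|lborel. B * \<bar>y s - y' s\<bar>)"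
  proof (rule abs_strip_integral_le[OF \<mu>])
    have "\<bar>y s - y' s\<bar> \<le> 2 * C" for s
      using C(1)[of s] C(2)[of s] by linarith
    then show "set_integrable lborel {0..t} (\<lambda>s. B * \<bar>y s - y' s\<bar>)"
      by (intro set_integrable_mult_right set_integrable_bounded_Icc[where B="2 * C"]) auto
    show "\<bar>(y (fst z) - y' (fst z)) * g (snd z)\<bar> \<le> B * \<bar>y (fst z) - y' (fst z)\<bar>" for z
      using mult_left_mono[OF B[of "snd z"], of "\<bar>y (fst z) - y' (fst z)\<bar>"]
      by (simp add: abs_mult mult.commute)
  qed (use \<open>0 \<le> B\<close> in auto)
  then show ?thesis
    using set_integral_diff(2)[OF int] by (simp add: left_diff_distrib)
qed

lemma Lconv_continuous_product:
  fixes g :: "(nat \<Rightarrow> enat) \<Rightarrow> real" and y :: "real \<Rightarrow> real"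
  assumes L: "Lconv \<mu>s \<mu>" and t: "0 < t" and g: "continuous_on UNIV g" "\<And>w. \<bar>g w\<bar> \<le> B"
    and y: "continuous_on UNIV y" "\<And>s. \<bar>y s\<bar> \<le> C"
  shows "(\<lambda>m. LINT z:strip t|\<mu>s m. y (fst z) * g (snd z)) \<longlonglongrightarrow> (LINT z:strip t|\<mu>. y (fst z) * g (snd z))"
proof -
  have "bounded ((\<lambda>z. y (fst z) * g (snd z)) ` strip t)"
    unfolding bounded_iff
  proof (intro exI ballI, elim imageE)
    fix r z
    assume "r = y (fst z) * g (snd z)"
    moreover have "\<bar>y (fst z)\<bar> * \<bar>g (snd z)\<bar> \<le> C * B"
      using y(2)[of "fst z"] by (intro mult_mono g) auto
    ultimately show "norm r \<le> C * B"
      by (simp add: abs_mult)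
  qed
  moreover have "(\<lambda>z. y (fst z) * g (snd z)) \<in> borel_measurable SpaceL"
    using borel_measurable_continuous_onI[OF y(1)] measurable_compose[OF measurable_SpaceL_snd, of g borel]
    by (intro borel_measurable_times measurable_compose[OF measurable_SpaceL_fst]) auto
  moreover have "cont_on_strip t (\<lambda>z. y (fst z) * g (snd z))"
    unfolding cont_on_strip_def
  proof (intro allI impI)
    fix ss ws s w
    assume "\<forall>j. ss j \<in> {0..<t} \<and> ws j \<in> OmegaS" "w \<in> OmegaS" "ss \<longlonglongrightarrow> s" "(\<lambda>j. rhoO (ws j) w) \<longlonglongrightarrow> 0"
    then have "(\<lambda>j. y (ss j)) \<longlonglongrightarrow> y s" "(\<lambda>j. g (ws j)) \<longlonglongrightarrow> g w"
      by (auto intro!: continuous_on_tendsto_compose[OF y(1)] continuous_on_tendsto_compose[OF g(1)] rhoO_tendsto)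
    then show "(\<lambda>j. y (fst (ss j, ws j)) * g (snd (ss j, ws j))) \<longlonglongrightarrow> y (fst (s, w)) * g (snd (s, w))"
      by (simp add: tendsto_mult)
  qed
  ultimately show ?thesis
    using L t unfolding Lconv_def by blast
qed

text \<open>A bounded measurable time factor is approximated in \<open>L\<^sup>1\<close> by continuous ones; the
  error is uniform over all occupation measures because they share the time marginal.\<close>

lemma Lconv_product:
  fixes g :: "(nat \<Rightarrow> enat) \<Rightarrow> real" and y :: "real \<Rightarrow> real"
  assumes L: "Lconv \<mu>s \<mu>" and \<mu>s: "\<And>m. \<mu>s m \<in> Lset" and \<mu>: "\<mu> \<in> Lset" and t: "0 < t"
    and g: "continuous_on UNIV g" "\<And>w. \<bar>g w\<bar> \<le> B" and y: "y \<in> borel_measurable borel" "\<And>s. \<bar>y s\<bar> \<le> C"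
  shows "(\<lambda>m. LINT z:strip t|\<mu>s m. y (fst z) * g (snd z)) \<longlonglongrightarrow> (LINT z:strip t|\<mu>. y (fst z) * g (snd z))"
  unfolding tendsto_iff
proof (intro allI impI)
  fix e :: real
  assume "0 < e"
  obtain \<phi> :: "nat \<Rightarrow> real \<Rightarrow> real" where \<phi>: "\<And>n. continuous_on UNIV (\<phi> n)" "\<And>n s. \<bar>\<phi> n s\<bar> \<le> C"
    "AE s in lborel. (\<lambda>n. \<phi> n s) \<longlonglongrightarrow> y s"
    by (rule borel_measurable_AE_limit_of_continuous[OF y]) (rule that)
  have \<phi>_meas: "\<phi> n \<in> borel_measurable borel" for n
    by (rule borel_measurable_continuous_onI[OF \<phi>(1)])
  have "(\<lambda>n. LINT s:{0..t}|lborel. \<bar>\<phi> n s - y s\<bar>) \<longlonglongrightarrow> 0"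
    by (rule set_integral_abs_diff_tendsto_zero[where B=C]) (use y \<phi>(2,3) \<phi>_meas in auto)
  then have "(\<lambda>n. B * (LINT s:{0..t}|lborel. \<bar>\<phi> n s - y s\<bar>)) \<longlonglongrightarrow> B * 0"
    by (intro tendsto_mult tendsto_const)
  then have "\<forall>\<^sub>F n in sequentially. B * (LINT s:{0..t}|lborel. \<bar>\<phi> n s - y s\<bar>) < e / 3"
    using \<open>0 < e\<close> by (intro order_tendstoD(2)) auto
  then obtain n where n: "B * (LINT s:{0..t}|lborel. \<bar>\<phi> n s - y s\<bar>) < e / 3"
    by (auto simp: eventually_sequentially)
  let ?I = "\<lambda>y \<mu>. LINT z:strip t|\<mu>. y (fst z) * g (snd z)"
  have near: "\<bar>?I (\<phi> n) \<mu> - ?I y \<mu>\<bar> < e / 3" if "\<mu> \<in> Lset" for \<mu>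
    using product_strip_integral_diff_le[OF that \<phi>_meas[of n] y(1) \<phi>(2) y(2) g(2)] n
    by (rule order_le_less_trans)
  have "\<forall>\<^sub>F m in sequentially. dist (?I (\<phi> n) (\<mu>s m)) (?I (\<phi> n) \<mu>) < e / 3"
    using Lconv_continuous_product[OF L t g \<phi>(1) \<phi>(2)] \<open>0 < e\<close> by (intro tendstoD) auto
  then show "\<forall>\<^sub>F m in sequentially. dist (?I y (\<mu>s m)) (?I y \<mu>) < e"
  proof eventually_elim
    case (elim m)
    then show ?case
      using near[OF \<mu>s, of m] near[OF \<mu>] unfolding dist_real_def by linarith
  qed
qed

section \<open>Observables\<close>

inductive observable :: "(real \<Rightarrow> (nat \<Rightarrow> real) \<Rightarrow> (nat \<Rightarrow> enat) \<Rightarrow> real) \<Rightarrow> bool" where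
  observable_product: "observable (\<lambda>s u w. a s u * g w)"
    if "continuous_on UNIV (\<lambda>(s, u). a s u)" "\<And>t. bounded ((\<lambda>(s, u). a s u) ` ({0..t} \<times> Uset))"
      "continuous_on UNIV g" "bounded (range g)"
| observable_add: "observable (\<lambda>s u w. h s u w + h' s u w)" if "observable h" "observable h'"

definition occ_integral :: "real \<Rightarrow> (real \<Rightarrow> (nat \<Rightarrow> real) \<Rightarrow> (nat \<Rightarrow> enat) \<Rightarrow> real) \<Rightarrow> DL \<Rightarrow> real" where
  "occ_integral t h p = (LINT z:strip t|snd p. h (max 0 (fst z)) (fst p (max 0 (fst z))) (snd z))"

lemma observable_sum:
  assumes "finite J" "\<And>j. j \<in> J \<Longrightarrow> observable (h j)"
  shows "observable (\<lambda>s u w. \<Sum>j\<in>J. h j s u w)"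
  using assms
proof (induction J rule: finite_induct)
  case empty
  show ?case
    using observable_product[of "\<lambda>_ _. 0" "\<lambda>_. 0"] by (simp add: image_constant_conv split_beta')
next
  case (insert j J)
  then show ?case
    by (auto intro: observable_add)
qed

lemma observable_bounded:
  assumes "observable h"
  shows "\<exists>B. \<forall>s\<in>{0..t}. \<forall>u\<in>Uset. \<forall>w. \<bar>h s u w\<bar> \<le> B"
  using assms
proof induction
  case (observable_product a g)
  obtain A where A: "\<And>s u. s \<in> {0..t} \<Longrightarrow> u \<in> Uset \<Longrightarrow> \<bar>a s u\<bar> \<le> A"
    using observable_product.hyps(2)[of t] unfolding bounded_iff by fastforce
  obtain B where B: "\<And>w. \<bar>g w\<bar> \<le> B"
    using observable_product.hyps(4) unfolding bounded_iff by auto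
  have "\<bar>a s u * g w\<bar> \<le> A * B" if "s \<in> {0..t}" "u \<in> Uset" for s u w
    unfolding abs_mult using A[OF that] B[of w] by (intro mult_mono) auto
  then show ?case
    by blast
next
  case (observable_add h h')
  then obtain A B where "\<forall>s\<in>{0..t}. \<forall>u\<in>Uset. \<forall>w. \<bar>h s u w\<bar> \<le> A" "\<forall>s\<in>{0..t}. \<forall>u\<in>Uset. \<forall>w. \<bar>h' s u w\<bar> \<le> B"
    by blast
  then have "\<bar>h s u w + h' s u w\<bar> \<le> A + B" if "s \<in> {0..t}" "u \<in> Uset" for s u w
    using that by (intro order_trans[OF abs_triangle_ineq add_mono]) auto
  then show ?case
    by blast
qed

lemma observable_measurable:
  assumes "observable h" and x: "x \<in> Dsp"
  shows "(\<lambda>z. h (max 0 (fst z)) (x (max 0 (fst z))) (snd z)) \<in> borel_measurable SpaceL"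
  using assms(1)
proof induction
  case (observable_product a g)
  show ?case
  proof (rule borel_measurable_times)
    show "(\<lambda>z. a (max 0 (fst z)) (x (max 0 (fst z)))) \<in> borel_measurable SpaceL"
      by (rule measurable_compose[OF measurable_SpaceL_fst])
         (rule borel_measurable_along_path[OF x observable_product.hyps(1)])
    show "(\<lambda>z. g (snd z)) \<in> borel_measurable SpaceL"
      by (rule measurable_compose[OF measurable_SpaceL_snd]) simp
  qed
qed (rule borel_measurable_add)

lemma observable_strip_integrable:
  assumes h: "observable h" and x: "x \<in> Dsp" and \<mu>: "\<mu> \<in> Lset"
  shows "set_integrable \<mu> (strip t) (\<lambda>z. h (max 0 (fst z)) (x (max 0 (fst z))) (snd z))"
proof -
  obtain B where B: "\<And>s u w. s \<in> {0..t} \<Longrightarrow> u \<in> Uset \<Longrightarrow> \<bar>h s u w\<bar> \<le> B"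
    using observable_bounded[OF h] by blast
  show ?thesis
    by (rule strip_integrable[OF \<mu> observable_measurable[OF h x], where B=B])
       (use B Dsp_Uset[OF x] in auto)
qed

lemma occ_integral_add:
  assumes "observable h" "observable h'" "p \<in> Dsp \<times> Lset"
  shows "occ_integral t (\<lambda>s u w. h s u w + h' s u w) p = occ_integral t h p + occ_integral t h' p"
  using assms unfolding occ_integral_def by (intro set_integral_add(2) observable_strip_integrable) auto

definition time_factor :: "real \<Rightarrow> (real \<Rightarrow> (nat \<Rightarrow> real) \<Rightarrow> real) \<Rightarrow> (real \<Rightarrow> nat \<Rightarrow> real) \<Rightarrow> real \<Rightarrow> real" where
  "time_factor t a x s = indicator {0..t} s * a (max 0 s) (x (max 0 s))"

lemma occ_integral_product:
  "occ_integral t (\<lambda>s u w. a s u * g w) (x, \<mu>) = (LINT z:strip t|\<mu>. time_factor t a x (fst z) * g (snd z))"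
  unfolding occ_integral_def set_lebesgue_integral_def
  by (rule Bochner_Integration.integral_cong) (auto simp: time_factor_def indicator_def)

lemma time_factor_measurable:
  assumes "continuous_on UNIV (\<lambda>(s, u). a s u)" "x \<in> Dsp"
  shows "time_factor t a x \<in> borel_measurable borel"
  using borel_measurable_along_path[OF assms(2,1)] unfolding time_factor_def[abs_def] by measurable

lemma time_factor_bounded:
  assumes "bounded ((\<lambda>(s, u). a s u) ` ({0..t} \<times> Uset))"
  obtains A where "0 \<le> A" "\<And>x s. x \<in> Dsp \<Longrightarrow> \<bar>time_factor t a x s\<bar> \<le> A"
proof -
  obtain A where A: "\<And>s u. s \<in> {0..t} \<Longrightarrow> u \<in> Uset \<Longrightarrow> \<bar>a s u\<bar> \<le> A"
    using assms unfolding bounded_iff by fastforce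
  show thesis
  proof (rule that)
    show "0 \<le> max 0 A"
      by simp
    show "\<bar>time_factor t a x s\<bar> \<le> max 0 A" if "x \<in> Dsp" for x s
      using A[OF _ Dsp_Uset[OF that], of s s] by (auto simp: time_factor_def indicator_def max_def)
  qed
qed

lemma occ_integral_product_bounded:
  fixes g :: "(nat \<Rightarrow> enat) \<Rightarrow> real"
  assumes a: "continuous_on UNIV (\<lambda>(s, u). a s u)" "bounded ((\<lambda>(s, u). a s u) ` ({0..t} \<times> Uset))"
    and B: "\<And>w. \<bar>g w\<bar> \<le> B" and t: "0 \<le> t"
  shows "bounded (occ_integral t (\<lambda>s u w. a s u * g w) ` (Dsp \<times> Lset))"
proof -
  obtain A where A: "0 \<le> A" "\<And>x s. x \<in> Dsp \<Longrightarrow> \<bar>time_factor t a x s\<bar> \<le> A"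
    using time_factor_bounded[OF a(2)] by blast
  have "0 \<le> B"
    using order_trans[OF abs_ge_zero B] .
  have "\<bar>occ_integral t (\<lambda>s u w. a s u * g w) (x, \<mu>)\<bar> \<le> B * (A * t)" if x: "x \<in> Dsp"
    and \<mu>: "\<mu> \<in> Lset" for x \<mu>
  proof -
    let ?y = "time_factor t a x"
    note y = time_factor_measurable[OF a(1) x, of t]
    have "\<bar>LINT s:{0..t}|lborel. \<bar>?y s\<bar>\<bar> \<le> A * (t - 0)"
      using y A(2)[OF x] t by (intro abs_set_integral_le_Icc set_integrable_bounded_Icc[where B=A]) auto
    then have "B * (LINT s:{0..t}|lborel. \<bar>?y s\<bar>) \<le> B * (A * t)"
      using \<open>0 \<le> B\<close> by (intro mult_left_mono) auto
    then show ?thesis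
      using product_strip_integral_diff_le[OF \<mu> y borel_measurable_const, of A 0 g B t] A(2)[OF x] B \<open>0 \<le> A\<close>
      by (simp add: occ_integral_product)
  qed
  then show ?thesis
    unfolding bounded_iff by (intro exI[of _ "B * (A * t)"]) auto
qed

lemma occ_integral_product_tendsto:
  fixes g :: "(nat \<Rightarrow> enat) \<Rightarrow> real" and a :: "real \<Rightarrow> (nat \<Rightarrow> real) \<Rightarrow> real"
  assumes a: "continuous_on UNIV (\<lambda>(s, u). a s u)" "bounded ((\<lambda>(s, u). a s u) ` ({0..t} \<times> Uset))"
    and g: "continuous_on UNIV g" "\<And>w. \<bar>g w\<bar> \<le> B" and t: "0 < t"
    and xs: "\<And>m. xs m \<in> Dsp" and \<mu>s: "\<And>m. \<mu>s m \<in> Lset" and x: "x \<in> Dsp" and \<mu>: "\<mu> \<in> Lset"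
    and J: "J1conv xs x" and L: "Lconv \<mu>s \<mu>"
  shows "(\<lambda>m. occ_integral t (\<lambda>s u w. a s u * g w) (xs m, \<mu>s m)) \<longlonglongrightarrow> occ_integral t (\<lambda>s u w. a s u * g w) (x, \<mu>)"
proof -
  obtain A where A: "\<And>x s. x \<in> Dsp \<Longrightarrow> \<bar>time_factor t a x s\<bar> \<le> A"
    using time_factor_bounded[OF a(2)] by blast
  obtain A' where A': "\<And>s u. s \<in> {0..t} \<Longrightarrow> u \<in> Uset \<Longrightarrow> \<bar>a s u\<bar> \<le> A'"
    using a(2) unfolding bounded_iff by fastforce
  let ?y = "time_factor t a"
  let ?I = "\<lambda>x \<mu>. LINT z:strip t|\<mu>. ?y x (fst z) * g (snd z)"
  note y = time_factor_measurable[OF a(1)]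
  have "(\<lambda>m. ?I (xs m) (\<mu>s m) - ?I x (\<mu>s m)) \<longlonglongrightarrow> 0"
  proof (rule Lim_null_comparison)
    have "(LINT s:{0..t}|lborel. \<bar>?y (xs m) s - ?y x s\<bar>) =
        (LINT s:{0..t}|lborel. \<bar>a (max 0 s) (xs m (max 0 s)) - a (max 0 s) (x (max 0 s))\<bar>)" for m
      by (rule set_lebesgue_integral_cong) (auto simp: time_factor_def)
    then have "(\<lambda>m. LINT s:{0..t}|lborel. \<bar>?y (xs m) s - ?y x s\<bar>) \<longlonglongrightarrow> 0"
      using J1conv_L1[OF J xs x a(1) A'] by simp
    then show "(\<lambda>m. B * (LINT s:{0..t}|lborel. \<bar>?y (xs m) s - ?y x s\<bar>)) \<longlonglongrightarrow> 0"
      by (rule tendsto_mult_right_zero)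
    have "\<bar>?I (xs m) (\<mu>s m) - ?I x (\<mu>s m)\<bar> \<le> B * (LINT s:{0..t}|lborel. \<bar>?y (xs m) s - ?y x s\<bar>)" for m
      by (rule product_strip_integral_diff_le[OF \<mu>s y[OF xs] y[OF x] A[OF xs] A[OF x] g(2)])
    then show "\<forall>\<^sub>F m in sequentially. norm (?I (xs m) (\<mu>s m) - ?I x (\<mu>s m)) \<le> B * (LINT s:{0..t}|lborel. \<bar>?y (xs m) s - ?y x s\<bar>)"
      by simp
  qed
  moreover have "(\<lambda>m. ?I x (\<mu>s m)) \<longlonglongrightarrow> ?I x \<mu>"
    by (rule Lconv_product[OF L \<mu>s \<mu> t g y[OF x] A[OF x]])
  ultimately show ?thesis
    unfolding occ_integral_product using tendsto_add by fastforce
qed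

lemma Ftest_occ_integral_product:
  fixes g :: "(nat \<Rightarrow> enat) \<Rightarrow> real" and a :: "real \<Rightarrow> (nat \<Rightarrow> real) \<Rightarrow> real"
  assumes a: "continuous_on UNIV (\<lambda>(s, u). a s u)" "\<And>t. bounded ((\<lambda>(s, u). a s u) ` ({0..t} \<times> Uset))"
    and g: "continuous_on UNIV g" "bounded (range g)" and t: "0 < t"
  shows "Ftest (occ_integral t (\<lambda>s u w. a s u * g w))"
proof -
  obtain B where B: "\<And>w. \<bar>g w\<bar> \<le> B"
    using g(2) unfolding bounded_iff by auto
  have "bounded (occ_integral t (\<lambda>s u w. a s u * g w) ` (Dsp \<times> Lset))"
    by (rule occ_integral_product_bounded[OF a B less_imp_le[OF t]])
  then show ?thesis
    unfolding Ftest_def using occ_integral_product_tendsto[OF a g(1) B t]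
    by (simp add: occ_integral_def)
qed

lemma Ftest_occ_integral:
  assumes "observable h" and t: "0 < t"
  shows "Ftest (occ_integral t h)"
  using assms(1)
proof induction
  case (observable_product a g)
  then show ?case
    by (intro Ftest_occ_integral_product t)
next
  case (observable_add h h')
  show ?case
  proof (rule Ftest_cong[OF Ftest_add[OF observable_add.IH]])
    show "occ_integral t h p + occ_integral t h' p = occ_integral t (\<lambda>s u w. h s u w + h' s u w) p"
      if "p \<in> Dsp \<times> Lset" for p
      using occ_integral_add observable_add.hyps that by simp
  qed (simp add: occ_integral_def)
qed

lemma occ_integral_disintegrates:
  assumes h: "observable h" and x: "x \<in> Dsp" and d: "disintegrates \<mu> \<kappa>"
  shows "set_integrable lborel {0..t} (\<lambda>s. measure_pmf.expectation (\<kappa> s) (h s (x s)))"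
    "occ_integral t h (x, \<mu>) = (LINT s:{0..t}|lborel. measure_pmf.expectation (\<kappa> s) (h s (x s)))"
proof -
  let ?h = "\<lambda>z. h (max 0 (fst z)) (x (max 0 (fst z))) (snd z)"
  obtain B where B: "\<And>s u w. s \<in> {0..t} \<Longrightarrow> u \<in> Uset \<Longrightarrow> \<bar>h s u w\<bar> \<le> B"
    using observable_bounded[OF h] by blast
  have "\<bar>?h (s, w)\<bar> \<le> B" if "s \<in> {0..t}" "w \<in> OmegaS" for s w
    using B[of s "x s"] Dsp_Uset[OF x] that(1) by simp
  note D = disintegrates_integral[OF d observable_measurable[OF h x] this]
  have clip: "measure_pmf.expectation (\<kappa> s) (\<lambda>w. ?h (s, w)) = measure_pmf.expectation (\<kappa> s) (h s (x s))"
    if "s \<in> {0..t}" for s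
    using that by (simp add: max_absorb2)
  show "set_integrable lborel {0..t} (\<lambda>s. measure_pmf.expectation (\<kappa> s) (h s (x s)))"
    using D(1) by (subst set_integrable_cong[OF refl refl clip[symmetric]]) simp_all
  show "occ_integral t h (x, \<mu>) = (LINT s:{0..t}|lborel. measure_pmf.expectation (\<kappa> s) (h s (x s)))"
  proof -
    have "occ_integral t h (x, \<mu>) = (LINT z:strip t|\<mu>. ?h z)"
      by (simp add: occ_integral_def)
    also have "\<dots> = (LINT s:{0..t}|lborel. measure_pmf.expectation (\<kappa> s) (\<lambda>w. ?h (s, w)))"
      by (rule D(2))
    also have "\<dots> = (LINT s:{0..t}|lborel. measure_pmf.expectation (\<kappa> s) (h s (x s)))"
      by (rule set_lebesgue_integral_cong) (use clip in auto)
    finally show ?thesis .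
  qed
qed

lemma bounded_time_level_product:
  fixes \<psi> :: "real \<Rightarrow> real"
  assumes \<psi>: "continuous_on UNIV \<psi>" and a: "\<And>u. u \<in> Uset \<Longrightarrow> \<bar>a u\<bar> \<le> A"
  shows "bounded ((\<lambda>(s, u). \<psi> s * a u) ` ({0..t} \<times> Uset))"
proof -
  have "bounded (\<psi> ` {0..t})"
    by (intro compact_imp_bounded compact_continuous_image continuous_on_subset[OF \<psi>] compact_Icc) simp
  then obtain C where "\<And>s. s \<in> {0..t} \<Longrightarrow> \<bar>\<psi> s\<bar> \<le> C"
    unfolding bounded_iff by fastforce
  then have "\<bar>\<psi> s * a u\<bar> \<le> C * A" if "s \<in> {0..t}" "u \<in> Uset" for s u
    unfolding abs_mult using that a by (intro mult_mono) (auto intro: order_trans[OF abs_ge_zero])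
  then show ?thesis
    unfolding bounded_iff by (intro exI[of _ "C * A"]) auto
qed

lemma observable_time_level_product:
  fixes \<psi> :: "real \<Rightarrow> real"
  assumes "continuous_on UNIV \<psi>" "continuous_on UNIV a" "\<And>u. u \<in> Uset \<Longrightarrow> \<bar>a u\<bar> \<le> A"
    "continuous_on UNIV g" "\<And>w. \<bar>g w\<bar> \<le> B"
  shows "observable (\<lambda>s u w. \<psi> s * a u * g w)"
proof (rule observable_product)
  show "continuous_on UNIV (\<lambda>(s, u). \<psi> s * a u)"
    unfolding split_beta'
    by (intro continuous_on_mult continuous_on_compose2[OF assms(1)] continuous_on_compose2[OF assms(2)]
        continuous_on_fst continuous_on_snd continuous_on_id) auto
  show "bounded ((\<lambda>(s, u). \<psi> s * a u) ` ({0..t} \<times> Uset))" for t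
    by (rule bounded_time_level_product[OF assms(1,3)])
  show "bounded (range g)"
    unfolding bounded_iff using assms(5) by (intro exI[of _ B]) auto
qed (rule assms(4))

lemma continuous_on_arrival_rate: "continuous_on UNIV (\<lambda>u. arrival_rate lam u k)"
  unfolding arrival_rate_def by (intro continuous_intros continuous_on_product_coordinates)

lemma observable_level: "observable (\<lambda>s u w. u k)"
  using observable_time_level_product[of "\<lambda>_. 1" "\<lambda>u. u k" 1 "\<lambda>_. 1" 1] Uset_range[of _ k] by simp

lemma observable_level_below: "observable (\<lambda>s u w. u k * indicator {..<enat N} (w k))"
  using observable_time_level_product[of "\<lambda>_. 1" "\<lambda>u. u k" 1 "\<lambda>w. indicator {..<enat N} (w k)" 1]
    continuous_on_level[OF continuous_on_indicator_less, of N k] Uset_range[of _ k] by (simp add: indicator_def)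

definition depends_on_levels :: "nat \<Rightarrow> ((nat \<Rightarrow> 'a) \<Rightarrow> real) \<Rightarrow> bool" where
  "depends_on_levels N f \<longleftrightarrow> (\<forall>w k e. N < k \<longrightarrow> f (w(k := e)) = f w)"

context lcq_parameters
begin

lemma observable_weighted_drift:
  assumes \<psi>: "continuous_on UNIV \<psi>"
  shows "observable (\<lambda>s u w. \<psi> s * (arrival_rate lam u k - departure_rate q w k))"
proof -
  have "observable (\<lambda>s u w. \<psi> s * arrival_rate lam u k * 1)"
    using arrival_rate_bounds
    by (intro observable_time_level_product[where A=lam and B=1] \<psi> continuous_on_arrival_rate continuous_on_const) auto
  moreover have "observable (\<lambda>s u w. \<psi> s * 1 * - departure_rate q w k)"
    using departure_rate_abs_le
    by (intro observable_time_level_product[where A=1 and B=1] \<psi> continuous_on_const continuous_on_minus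
        continuous_on_departure_rate) auto
  ultimately have "observable (\<lambda>s u w. \<psi> s * arrival_rate lam u k * 1 + \<psi> s * 1 * - departure_rate q w k)"
    by (rule observable_add)
  then show ?thesis
    by (simp add: algebra_simps)
qed

lemma observable_genO:
  fixes f :: "(nat \<Rightarrow> enat) \<Rightarrow> real"
  assumes f: "continuous_on UNIV f" "\<And>w. \<bar>f w\<bar> \<le> B" "depends_on_levels N f"
  shows "observable (\<lambda>s u w. genO lam q u f w)"
proof -
  have arrive: "continuous_on UNIV (\<lambda>w. f (arrive w k) - f w)"
    and depart: "continuous_on UNIV (\<lambda>w. f (depart w k) - f w)" for k
    by (intro continuous_on_diff f continuous_on_compose2[OF f(1)] continuous_on_arrive continuous_on_depart; simp)+
  have diff: "\<bar>f v - f w\<bar> \<le> 2 * B" for v w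
    using f(2)[of v] f(2)[of w] by linarith
  have arrivals: "observable (\<lambda>s u w. 1 * arrival_rate lam u (Suc j) * (f (arrive w (Suc j)) - f w))" for j
    using arrival_rate_bounds
    by (intro observable_time_level_product[where A=lam and B="2 * B"] continuous_on_const
        continuous_on_arrival_rate arrive diff) simp
  have departures: "observable (\<lambda>s u w. 1 * 1 * (departure_rate q w (Suc j) * (f (depart w (Suc j)) - f w)))" for j
  proof (rule observable_time_level_product[where A=1 and B="1 * (2 * B)"])
    show "\<bar>departure_rate q w (Suc j) * (f (depart w (Suc j)) - f w)\<bar> \<le> 1 * (2 * B)" for w
      unfolding abs_mult by (intro mult_mono departure_rate_abs_le diff) auto
  qed (auto intro: continuous_on_const continuous_on_mult continuous_on_departure_rate depart)
  have "observable (\<lambda>s u w. \<Sum>j<N. 1 * arrival_rate lam u (Suc j) * (f (arrive w (Suc j)) - f w)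
      + 1 * 1 * (departure_rate q w (Suc j) * (f (depart w (Suc j)) - f w)))"
    by (intro observable_sum observable_add arrivals departures) simp
  moreover have "genO lam q u f w = (\<Sum>j<N. 1 * arrival_rate lam u (Suc j) * (f (arrive w (Suc j)) - f w)
      + 1 * 1 * (departure_rate q w (Suc j) * (f (depart w (Suc j)) - f w)))" for u w
  proof -
    have "genO lam q u f w = (\<Sum>j<N. arrival_rate lam u (Suc j) * (f (arrive w (Suc j)) - f w)
        + departure_rate q w (Suc j) * (f (depart w (Suc j)) - f w))"
      unfolding genO_level_generator
      by (rule level_generator_finite)
        (use f(3) in \<open>auto simp: depends_on_levels_def arrive_def depart_def\<close>)
    then show ?thesis
      by simp
  qed
  ultimately show ?thesis
    by (simp only:)
qed

end

section \<open>The fluid equation as a continuous functional\<close>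

definition fluid_drift :: "real \<Rightarrow> real \<Rightarrow> (nat \<Rightarrow> real) \<Rightarrow> (nat \<Rightarrow> enat) pmf \<Rightarrow> nat \<Rightarrow> real" where
  "fluid_drift lam q u \<pi> k = arrival_rate lam u k - measure_pmf.expectation \<pi> (\<lambda>w. departure_rate q w k)"

text \<open>The defect of the integral equation of level \<open>k\<close>, integrated over \<open>[0,t]\<close> because evaluation at a
  fixed time is not J1-continuous; Fubini turns the double integral of the drift into the weight \<open>t - s\<close>.\<close>

definition flow_defect :: "real \<Rightarrow> real \<Rightarrow> real \<Rightarrow> nat \<Rightarrow> DL \<Rightarrow> real" where
  "flow_defect lam q t k p = occ_integral t (\<lambda>s u w. u k) p - t * fst p 0 k
     - occ_integral t (\<lambda>s u w. (t - s) * (arrival_rate lam u k - departure_rate q w k)) p"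

context lcq_parameters
begin

lemma Ftest_flow_defect: "0 < t \<Longrightarrow> Ftest (flow_defect lam q t k)"
  unfolding flow_defect_def[abs_def]
  by (intro Ftest_diff Ftest_occ_integral observable_level Ftest_cmult Ftest_initial
      observable_weighted_drift continuous_intros)

lemma expectation_drift:
  "measure_pmf.expectation \<pi> (\<lambda>w. arrival_rate lam u k - departure_rate q w k) = fluid_drift lam q u \<pi> k"
  using expectation_pmf_bounded(1)[of \<pi> "\<lambda>w. departure_rate q w k" 1] departure_rate_abs_le
  by (simp add: fluid_drift_def)

lemma fluid_drift_integrable:
  assumes x: "x \<in> Dsp" and d: "disintegrates \<mu> \<kappa>"
  shows "set_integrable lborel {0..t} (\<lambda>s. fluid_drift lam q (x s) (\<kappa> s) k)"
  using occ_integral_disintegrates(1)[OF observable_weighted_drift[of "\<lambda>_. 1"] x d]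
  by (simp add: expectation_drift)

lemma flow_defect_disintegrates:
  assumes x: "x \<in> Dsp" and d: "disintegrates \<mu> \<kappa>" and t: "0 \<le> t"
  shows "set_integrable lborel {0..t} (\<lambda>s. x s k - x 0 k - (LINT r:{0..s}|lborel. fluid_drift lam q (x r) (\<kappa> r) k))"
    "flow_defect lam q t k (x, \<mu>) =
      (LINT s:{0..t}|lborel. x s k - x 0 k - (LINT r:{0..s}|lborel. fluid_drift lam q (x r) (\<kappa> r) k))"
proof -
  let ?b = "\<lambda>s. fluid_drift lam q (x s) (\<kappa> s) k"
  note b = fluid_drift_integrable[OF x d, of t k]
  have level: "set_integrable lborel {0..t} (\<lambda>s. x s k)"
    "occ_integral t (\<lambda>s u w. u k) (x, \<mu>) = (LINT s:{0..t}|lborel. x s k)"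
    using occ_integral_disintegrates[OF observable_level x d, of t k] by simp_all
  have start: "set_integrable lborel {0..t} (\<lambda>s. x 0 k)"
    by (rule set_integrable_bounded_Icc[where B="\<bar>x 0 k\<bar>"]) auto
  have "set_integrable lborel {0..t} (\<lambda>s. 1 * (LINT r:{0..s}|lborel. ?b r))"
    by (intro set_integrable_times_integral(1) b set_integrable_bounded_Icc[where B=1]) auto
  then have drift: "set_integrable lborel {0..t} (\<lambda>s. LINT r:{0..s}|lborel. ?b r)"
    by simp
  have "occ_integral t (\<lambda>s u w. (t - s) * (arrival_rate lam u k - departure_rate q w k)) (x, \<mu>) =
      (LINT s:{0..t}|lborel. (t - s) * ?b s)"
    using occ_integral_disintegrates(2)[OF observable_weighted_drift[of "\<lambda>s. t - s"] x d]
    by (simp add: expectation_drift continuous_intros)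
  moreover have "(LINT s:{0..t}|lborel. x 0 k) = t * x 0 k"
    using t by (subst set_integral_const) auto
  ultimately show "flow_defect lam q t k (x, \<mu>) = (LINT s:{0..t}|lborel. x s k - x 0 k - (LINT r:{0..s}|lborel. ?b r))"
    unfolding flow_defect_def level(2) set_integral_diff(2)[OF set_integral_diff(1)[OF level(1) start] drift]
      set_integral_diff(2)[OF level(1) start] integral_of_integral_upto[OF b] by simp
  show "set_integrable lborel {0..t} (\<lambda>s. x s k - x 0 k - (LINT r:{0..s}|lborel. ?b r))"
    by (intro set_integral_diff(1) level start drift)
qed

end

section \<open>The martingale problem of the finite system\<close>

lemma integral_increment_times_density:
  fixes b y :: "real \<Rightarrow> real"
  assumes b: "set_integrable lborel {a..t} b" and yb: "set_integrable lborel {a..t} (\<lambda>r. y r * b r)"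
  shows "(LINT r:{a..t}|lborel. (y t - y r - (LINT s:{r..t}|lborel. b s)) * b r) =
    y t * (LINT r:{a..t}|lborel. b r) - (LINT r:{a..t}|lborel. y r * b r) - (LINT r:{a..t}|lborel. b r)\<^sup>2 / 2"
proof -
  have "set_integrable lborel {a..t} (\<lambda>r. y t * b r)"
    using b by (rule set_integrable_mult_right)
  note int = this yb set_integrable_times_integral(2)[OF b b]
  have "(LINT r:{a..t}|lborel. (y t - y r - (LINT s:{r..t}|lborel. b s)) * b r) =
      (LINT r:{a..t}|lborel. y t * b r - y r * b r - b r * (LINT s:{r..t}|lborel. b s))"
    by (rule set_lebesgue_integral_cong) (auto simp: algebra_simps)
  also have "\<dots> = (LINT r:{a..t}|lborel. y t * b r) - (LINT r:{a..t}|lborel. y r * b r)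
      - (LINT r:{a..t}|lborel. b r * (LINT s:{r..t}|lborel. b s))"
    by (simp only: set_integral_diff(2)[OF set_integral_diff(1)[OF int(1,2)] int(3)] set_integral_diff(2)[OF int(1,2)])
  finally show ?thesis
    using integral_triangle_square[OF b] by simp
qed

lemma (in prob_space) expectation_set_integral_Icc:
  fixes W :: "'a \<Rightarrow> real \<Rightarrow> real"
  assumes [measurable]: "(\<lambda>(x, s). W x s) \<in> borel_measurable (M \<Otimes>\<^sub>M lborel)"
    and B: "\<And>x s. x \<in> space M \<Longrightarrow> s \<in> {a..b} \<Longrightarrow> \<bar>W x s\<bar> \<le> B"
  shows "integrable M (\<lambda>x. LINT s:{a..b}|lborel. W x s)"
    "expectation (\<lambda>x. LINT s:{a..b}|lborel. W x s) = (LINT s:{a..b}|lborel. expectation (\<lambda>x. W x s))"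
    "set_integrable lborel {a..b} (\<lambda>s. expectation (\<lambda>x. W x s))"
proof -
  interpret pair_sigma_finite M lborel ..
  have "set_integrable (M \<Otimes>\<^sub>M lborel) (space M \<times> {a..b}) (\<lambda>(x, s). W x s)"
    by (rule set_integrable_bounded[where B=B])
       (use B in \<open>auto simp: lborel.emeasure_pair_measure_Times emeasure_space_1 emeasure_lborel_Icc_eq\<close>)
  then have int: "integrable (M \<Otimes>\<^sub>M lborel) (\<lambda>(x, s). indicator {a..b} s *\<^sub>R W x s)"
    unfolding set_integrable_def
    by (rule Bochner_Integration.integrable_cong[THEN iffD1, rotated -1])
       (auto simp: space_pair_measure indicator_def)
  show "integrable M (\<lambda>x. LINT s:{a..b}|lborel. W x s)"
    using integrable_fst'[OF int] by (simp add: set_lebesgue_integral_def)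
  show "expectation (\<lambda>x. LINT s:{a..b}|lborel. W x s) = (LINT s:{a..b}|lborel. expectation (\<lambda>x. W x s))"
    using Fubini_integral[OF int] by (simp add: set_lebesgue_integral_def)
  show "set_integrable lborel {a..b} (\<lambda>s. expectation (\<lambda>x. W x s))"
    using integrable_snd[OF int] by (simp add: set_integrable_def)
qed

lemma (in prob_space) expectation_abs_le_sqrt:
  fixes f :: "'a \<Rightarrow> real"
  assumes "integrable M f" "integrable M (\<lambda>x. (f x)\<^sup>2)"
  shows "expectation (\<lambda>x. \<bar>f x\<bar>) \<le> sqrt (expectation (\<lambda>x. (f x)\<^sup>2))"
proof (rule real_le_rsqrt)
  have "0 \<le> variance (\<lambda>x. \<bar>f x\<bar>)"
    by (rule variance_positive)
  also have "\<dots> = expectation (\<lambda>x. (f x)\<^sup>2) - (expectation (\<lambda>x. \<bar>f x\<bar>))\<^sup>2"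
    using assms by (subst variance_eq) auto
  finally show "(expectation (\<lambda>x. \<bar>f x\<bar>))\<^sup>2 \<le> expectation (\<lambda>x. (f x)\<^sup>2)"
    by simp
qed

locale lcq_system = lcq_parameters lam q for lam q :: real +
  fixes n :: nat and M :: "'a measure" and X :: "'a \<Rightarrow> real \<Rightarrow> nat \<Rightarrow> nat"
  assumes chain: "lcq_chain lam q n M X" and n_pos: "0 < n"
begin

lemmas
  chain_prob_space = chain[unfolded lcq_chain_def, THEN conjunct1] and
  chain_Sn = chain[unfolded lcq_chain_def, THEN conjunct2, THEN conjunct1] and
  chain_random_variable = chain[unfolded lcq_chain_def, THEN conjunct2, THEN conjunct2, THEN conjunct1] and
  chain_paths = chain[unfolded lcq_chain_def, THEN conjunct2, THEN conjunct2, THEN conjunct2, THEN conjunct1] and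
  chain_martingale = chain[unfolded lcq_chain_def, THEN conjunct2, THEN conjunct2, THEN conjunct2, THEN conjunct2]

sublocale prob_space M
  by (fact chain_prob_space)

definition state :: "'a \<Rightarrow> real \<Rightarrow> nat \<Rightarrow> nat" where
  "state x t = X x (max 0 t)"

lemma state_eq: "0 \<le> t \<Longrightarrow> state x t = X x t"
  by (simp add: state_def)

lemma state_Sn: "state x t \<in> Sn n"
  using chain_Sn by (simp add: state_def)

lemma state_fun_random_variable:
  fixes g :: "(nat \<Rightarrow> nat) \<Rightarrow> real"
  shows "(\<lambda>x. g (state x t)) \<in> borel_measurable M"
proof -
  have "(\<lambda>x. state x t) \<in> M \<rightarrow>\<^sub>M count_space UNIV"
    using chain_random_variable by (simp add: state_def)
  then show ?thesis
    by (rule measurable_compose) simp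
qed

lemma X_right_constant:
  assumes "0 \<le> t"
  shows "\<forall>\<^sub>F s in at_right t. X x s = X x t"
proof -
  obtain \<delta> where \<delta>: "\<delta> > 0" "\<And>s. t \<le> s \<Longrightarrow> s < t + \<delta> \<Longrightarrow> X x s = X x t"
    using chain_paths[THEN spec, THEN conjunct1, THEN spec, THEN mp, OF assms] by blast
  show ?thesis
    unfolding eventually_at_right_field
    by (intro exI[of _ "t + \<delta>"] conjI allI impI \<delta>(2)) (use \<delta>(1) in simp_all)
qed

lemma X_left_constant:
  assumes "0 < t"
  obtains s where "0 \<le> s" "\<forall>\<^sub>F s' in at_left t. X x s' = X x s"
proof -
  obtain \<delta> where \<delta>: "\<delta> > 0" "\<And>s s'. t - \<delta> < s \<Longrightarrow> s < t \<Longrightarrow> t - \<delta> < s' \<Longrightarrow> s' < t \<Longrightarrow> X x s = X x s'"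
    using chain_paths[THEN spec, THEN conjunct2, THEN spec, THEN mp, OF assms] by blast
  define s where "s = max (t / 2) (t - \<delta> / 2)"
  have s: "t - \<delta> < s" "s < t" "0 \<le> s"
    using assms \<delta>(1) by (auto simp: s_def)
  then have "\<forall>\<^sub>F s' in at_left t. X x s' = X x s"
    unfolding eventually_at_left_field
    by (intro exI[of _ "t - \<delta>"] conjI allI impI \<delta>(2)) (use \<delta>(1) in simp_all)
  then show thesis
    using s(3) that by blast
qed

lemma state_pair_measurable:
  fixes g :: "(nat \<Rightarrow> nat) \<Rightarrow> real"
  shows "(\<lambda>z. g (state (fst z) (snd z))) \<in> borel_measurable (M \<Otimes>\<^sub>M (lborel :: real measure))"
  unfolding state_def
proof (rule borel_measurable_right_continuous_process[of "\<lambda>x t. g (X x t)"])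
  show "(\<lambda>x. g (X x t)) \<in> borel_measurable M" if "0 \<le> t" for t
    using state_fun_random_variable[of g t] that by (simp add: state_eq)
  show "((\<lambda>t. g (X x t)) \<longlongrightarrow> g (X x t)) (at_right t)" if "0 \<le> t" for x t
    by (rule tendsto_eventually) (use X_right_constant[OF that, of x] in eventually_elim, simp)
qed

lemma state_measurable:
  fixes g :: "(nat \<Rightarrow> nat) \<Rightarrow> real"
  assumes "\<xi> \<in> N \<rightarrow>\<^sub>M M" "a \<in> borel_measurable N"
  shows "(\<lambda>z. g (state (\<xi> z) (a z))) \<in> borel_measurable N"
proof -
  have "a \<in> N \<rightarrow>\<^sub>M lborel"
    using assms(2) by simp
  from measurable_compose[OF measurable_Pair[OF assms(1) this] state_pair_measurable[of g]]
  show ?thesis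
    by simp
qed

lemma state_path_measurable:
  fixes g :: "(nat \<Rightarrow> nat) \<Rightarrow> real"
  shows "(\<lambda>s. g (state x s)) \<in> borel_measurable borel"
  unfolding state_def
proof (rule borel_measurable_right_continuous[of "\<lambda>s. g (X x s)"])
  show "((\<lambda>s. g (X x s)) \<longlongrightarrow> g (X x t)) (at_right t)" if "0 \<le> t" for t
    by (rule tendsto_eventually) (use X_right_constant[OF that, of x] in eventually_elim, simp)
qed

lemma state_integrable:
  fixes g :: "(nat \<Rightarrow> nat) \<Rightarrow> real"
  assumes "\<And>m. m \<in> Sn n \<Longrightarrow> \<bar>g m\<bar> \<le> K"
  shows "set_integrable lborel {a..b} (\<lambda>s. g (state x s))"
proof (rule set_integrable_bounded_Icc)
  show "norm (g (state x s)) \<le> K" for s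
    using assms[OF state_Sn, of x s] by simp
qed (rule state_path_measurable)

lemma state_integral_abs_le:
  fixes g :: "(nat \<Rightarrow> nat) \<Rightarrow> real"
  assumes "\<And>m. m \<in> Sn n \<Longrightarrow> \<bar>g m\<bar> \<le> K" "a \<le> b"
  shows "\<bar>LINT s:{a..b}|lborel. g (state x s)\<bar> \<le> K * (b - a)"
proof (rule abs_set_integral_le_Icc)
  show "set_integrable lborel {a..b} (\<lambda>s. g (state x s))"
    using assms(1) by (rule state_integrable)
  show "\<bar>g (state x s)\<bar> \<le> K" for s
    using assms(1)[OF state_Sn] .
qed (fact assms(2))

definition dynkin :: "((nat \<Rightarrow> nat) \<Rightarrow> real) \<Rightarrow> real \<Rightarrow> real \<Rightarrow> 'a \<Rightarrow> real" where
  "dynkin f s t x = f (state x t) - f (state x s) - (LINT r:{s..t}|lborel. genN lam q n f (state x r))"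

lemma genN_bounded:
  assumes f: "\<And>m. \<bar>f m\<bar> \<le> B" and m: "m \<in> Sn n"
  shows "\<bar>genN lam q n f m\<bar> \<le> real n * (lam + 1) * (2 * B)"
proof (rule genN_bound[OF m n_pos])
  show "\<bar>f m' - f m\<bar> \<le> 2 * B" for m'
    using f[of m'] f[of m] by linarith
qed

lemma dynkin_orthogonal:
  fixes f g :: "(nat \<Rightarrow> nat) \<Rightarrow> real"
  assumes f: "\<And>m. \<bar>f m\<bar> \<le> B" and g: "\<And>m. m \<in> Sn n \<Longrightarrow> \<bar>g m\<bar> \<le> C" and "0 \<le> s" "s \<le> t"
  shows "expectation (\<lambda>x. dynkin f s t x * g (state x s)) = 0"
proof -
  define g' where "g' m = (if m \<in> Sn n then g m else 0)" for m
  have "\<bar>g' m\<bar> \<le> \<bar>C\<bar>" for m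
    using g[of m] by (auto simp: g'_def)
  then have g'_bounded: "bounded (range g')"
    unfolding bounded_iff by auto
  have f_bounded: "bounded (range f)"
    unfolding bounded_iff using f by auto
  have "(\<integral>x. (f (X x t) - f (X x s) - (LINT r:{s..t}|lborel. genN lam q n f (X x r)))
      * (\<Prod>i<length [s]. g' (X x ([s] ! i))) \<partial>M) = 0"
    using chain_martingale[rule_format, OF f_bounded \<open>0 \<le> s\<close> \<open>s \<le> t\<close>, of "[s]" "\<lambda>_. g'"] g'_bounded \<open>0 \<le> s\<close> by simp
  moreover have "(LINT r:{s..t}|lborel. genN lam q n f (X x r)) = (LINT r:{s..t}|lborel. genN lam q n f (state x r))" for x
    by (rule set_lebesgue_integral_cong) (use \<open>0 \<le> s\<close> in \<open>auto simp: state_eq\<close>)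
  moreover have "g' (X x s) = g (state x s)" for x
    using state_Sn[of x s] \<open>0 \<le> s\<close> by (simp add: g'_def state_eq)
  ultimately show ?thesis
    using \<open>0 \<le> s\<close> \<open>s \<le> t\<close> by (simp add: dynkin_def state_eq)
qed

lemma dynkin_measurable:
  assumes \<xi> [measurable]: "\<xi> \<in> N \<rightarrow>\<^sub>M M" and a: "a \<in> borel_measurable N" and b: "b \<in> borel_measurable N"
  shows "(\<lambda>z. dynkin f (a z) (b z) (\<xi> z)) \<in> borel_measurable N"
proof -
  have "(\<lambda>(z, r). genN lam q n f (state (\<xi> z) r)) \<in> borel_measurable (N \<Otimes>\<^sub>M lborel)"
    unfolding split_beta'
    by (rule state_measurable[where \<xi>="\<lambda>z. \<xi> (fst z)" and a=snd]) measurable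
  then have "(\<lambda>z. LINT r:{a z..b z}|lborel. genN lam q n f (state (\<xi> z) r)) \<in> borel_measurable N"
    by (rule borel_measurable_interval_integral[where a=a and b=b, OF _ a b])
  then show ?thesis
    unfolding dynkin_def
    by (intro borel_measurable_diff state_measurable[where g=f, OF \<xi> b] state_measurable[where g=f, OF \<xi> a])
qed

lemma dynkin_random_variable: "dynkin f s t \<in> borel_measurable M"
  using dynkin_measurable[of "\<lambda>x. x" M "\<lambda>_. s" "\<lambda>_. t" f] by simp

lemma dynkin_bounded:
  assumes f: "\<And>m. \<bar>f m\<bar> \<le> B" and "0 \<le> T"
  obtains K where "0 \<le> K" "\<And>s t x. 0 \<le> s \<Longrightarrow> s \<le> t \<Longrightarrow> t \<le> T \<Longrightarrow> \<bar>dynkin f s t x\<bar> \<le> K"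
proof (rule that)
  define L where "L = real n * (lam + 1) * (2 * B)"
  have "0 \<le> B"
    using f[of undefined] by linarith
  then have "0 \<le> L"
    using lam_pos by (simp add: L_def)
  then show "0 \<le> 2 * B + L * T"
    using \<open>0 \<le> B\<close> \<open>0 \<le> T\<close> by simp
  fix s t x
  assume st: "0 \<le> s" "s \<le> t" "t \<le> T"
  have "\<bar>LINT r:{s..t}|lborel. genN lam q n f (state x r)\<bar> \<le> L * (t - s)"
    unfolding L_def by (rule state_integral_abs_le[OF genN_bounded[OF f] st(2)])
  also have "\<dots> \<le> L * T"
    using st \<open>0 \<le> L\<close> by (intro mult_left_mono) auto
  finally show "\<bar>dynkin f s t x\<bar> \<le> 2 * B + L * T"
    using f[of "state x t"] f[of "state x s"] unfolding dynkin_def by linarith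
qed

lemma dynkin_integrable:
  assumes f: "\<And>m. \<bar>f m\<bar> \<le> B" and t: "0 \<le> t"
  shows "integrable M (dynkin f 0 t)" "integrable M (\<lambda>x. (dynkin f 0 t x)\<^sup>2)"
proof -
  obtain K where K: "0 \<le> K" "\<And>s r x. 0 \<le> s \<Longrightarrow> s \<le> r \<Longrightarrow> r \<le> t \<Longrightarrow> \<bar>dynkin f s r x\<bar> \<le> K"
    using dynkin_bounded[where f=f, OF f t] by blast
  have bound: "\<bar>dynkin f 0 t x\<bar> \<le> K" for x
    by (rule K(2)[OF order_refl t order_refl])
  then show "integrable M (dynkin f 0 t)"
    by (intro integrable_const_bound[of _ K] dynkin_random_variable) simp
  have "(dynkin f 0 t x)\<^sup>2 \<le> K\<^sup>2" for x
    using power_mono[OF bound abs_ge_zero, of x 2] by simp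
  then show "integrable M (\<lambda>x. (dynkin f 0 t x)\<^sup>2)"
    by (intro integrable_const_bound[of _ "K\<^sup>2"] borel_measurable_power dynkin_random_variable) simp
qed

text \<open>The time integral of the carre du champ is the predictable quadratic variation of the Dynkin
  martingale.\<close>

definition carre_du_champ :: "((nat \<Rightarrow> nat) \<Rightarrow> real) \<Rightarrow> (nat \<Rightarrow> nat) \<Rightarrow> real" where
  "carre_du_champ f m = genN lam q n (\<lambda>m. (f m)\<^sup>2) m - 2 * f m * genN lam q n f m"

lemma carre_du_champ_bounded:
  assumes f: "\<And>m. \<bar>f m\<bar> \<le> B"
  obtains K where "\<And>m. m \<in> Sn n \<Longrightarrow> \<bar>carre_du_champ f m\<bar> \<le> K"
proof
  fix m assume m: "m \<in> Sn n"
  define L where "L = real n * (lam + 1)"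
  have "0 \<le> L"
    using lam_pos by (simp add: L_def)
  have "\<bar>(f m)\<^sup>2\<bar> \<le> B\<^sup>2" for m
    using power_mono[OF f abs_ge_zero, of m 2] by simp
  from genN_bounded[OF this m] have square: "\<bar>genN lam q n (\<lambda>m. (f m)\<^sup>2) m\<bar> \<le> L * (2 * B\<^sup>2)"
    by (simp add: L_def)
  have gen: "\<bar>genN lam q n f m\<bar> \<le> L * (2 * B)"
    using genN_bounded[OF f m] by (simp add: L_def)
  have "\<bar>2 * f m * genN lam q n f m\<bar> \<le> (2 * B) * (L * (2 * B))"
    unfolding abs_mult[of "2 * f m"] using f[of m] gen \<open>0 \<le> L\<close> by (intro mult_mono) auto
  with square show "\<bar>carre_du_champ f m\<bar> \<le> L * (2 * B\<^sup>2) + (2 * B) * (L * (2 * B))"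
    unfolding carre_du_champ_def by linarith
qed

lemma dynkin_square:
  fixes f :: "(nat \<Rightarrow> nat) \<Rightarrow> real"
  assumes f: "\<And>m. \<bar>f m\<bar> \<le> B"
  shows "(dynkin f 0 t x)\<^sup>2 = dynkin (\<lambda>m. (f m)\<^sup>2) 0 t x
    + (LINT r:{0..t}|lborel. carre_du_champ f (state x r))
    - 2 * (dynkin f 0 t x * f (state x 0))
    - 2 * (LINT r:{0..t}|lborel. dynkin f r t x * genN lam q n f (state x r))"
proof -
  let ?b = "\<lambda>r. genN lam q n f (state x r)"
  let ?c = "\<lambda>r. genN lam q n (\<lambda>m. (f m)\<^sup>2) (state x r)"
  have "\<bar>(f m)\<^sup>2\<bar> \<le> B\<^sup>2" for m
    using power_mono[OF f abs_ge_zero, of m 2] by simp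
  note c = state_integrable[OF genN_bounded[OF this], where a=0 and b=t and x=x]
  note b = state_integrable[OF genN_bounded[OF f], where a=0 and b=t and x=x]
  have "\<bar>f m * genN lam q n f m\<bar> \<le> B * (real n * (lam + 1) * (2 * B))" if "m \<in> Sn n" for m
    unfolding abs_mult[of "f m"] using f[of m] genN_bounded[OF f that] by (intro mult_mono) auto
  note fb = state_integrable[where g="\<lambda>m. f m * genN lam q n f m", OF this, where a=0 and b=t and x=x]
  have correction: "(LINT r:{0..t}|lborel. dynkin f r t x * ?b r) = f (state x t) * (LINT r:{0..t}|lborel. ?b r)
      - (LINT r:{0..t}|lborel. f (state x r) * ?b r) - (LINT r:{0..t}|lborel. ?b r)\<^sup>2 / 2"
    using integral_increment_times_density[OF b fb] unfolding dynkin_def .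
  have "(LINT r:{0..t}|lborel. carre_du_champ f (state x r)) =
      (LINT r:{0..t}|lborel. ?c r) - 2 * (LINT r:{0..t}|lborel. f (state x r) * ?b r)"
    using set_integral_diff(2)[OF c set_integrable_mult_right[OF fb, of 2]]
    by (simp add: carre_du_champ_def mult.assoc)
  then show ?thesis
    unfolding correction dynkin_def[of f 0 t x] dynkin_def[of "\<lambda>m. (f m)\<^sup>2"]
    by (simp add: power2_eq_square algebra_simps)
qed

lemma expectation_integral_dynkin:
  fixes f g :: "(nat \<Rightarrow> nat) \<Rightarrow> real"
  assumes f: "\<And>m. \<bar>f m\<bar> \<le> B" and g: "\<And>m. m \<in> Sn n \<Longrightarrow> \<bar>g m\<bar> \<le> C" and t: "0 \<le> t"
  shows "integrable M (\<lambda>x. LINT r:{0..t}|lborel. dynkin f r t x * g (state x r))"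
    "expectation (\<lambda>x. LINT r:{0..t}|lborel. dynkin f r t x * g (state x r)) = 0"
proof -
  obtain K where K: "0 \<le> K" "\<And>s r x. 0 \<le> s \<Longrightarrow> s \<le> r \<Longrightarrow> r \<le> t \<Longrightarrow> \<bar>dynkin f s r x\<bar> \<le> K"
    using dynkin_bounded[where f=f, OF f t] by blast
  have bound: "\<bar>dynkin f r t x * g (state x r)\<bar> \<le> K * C" if "r \<in> {0..t}" for x r
    unfolding abs_mult using K(2)[of r t x] g[OF state_Sn, of x r] that K(1)
    by (intro mult_mono) auto
  have meas: "(\<lambda>(x, r). dynkin f r t x * g (state x r)) \<in> borel_measurable (M \<Otimes>\<^sub>M lborel)"
    unfolding split_beta'
    by (intro borel_measurable_times dynkin_measurable[where \<xi>=fst and a=snd and b="\<lambda>_. t"]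
        state_pair_measurable) auto
  show "integrable M (\<lambda>x. LINT r:{0..t}|lborel. dynkin f r t x * g (state x r))"
    by (rule expectation_set_integral_Icc(1)[where B="K * C", OF meas]) (rule bound)
  have "expectation (\<lambda>x. LINT r:{0..t}|lborel. dynkin f r t x * g (state x r)) =
      (LINT r:{0..t}|lborel. expectation (\<lambda>x. dynkin f r t x * g (state x r)))"
    by (rule expectation_set_integral_Icc(2)[where B="K * C", OF meas]) (rule bound)
  also have "\<dots> = (LINT r:{0..t}|lborel. 0)"
  proof (rule set_lebesgue_integral_cong)
    show "\<forall>r. r \<in> {0..t} \<longrightarrow> expectation (\<lambda>x. dynkin f r t x * g (state x r)) = 0"
      using dynkin_orthogonal[where f=f and g=g, OF f g] by simp
  qed simp
  finally show "expectation (\<lambda>x. LINT r:{0..t}|lborel. dynkin f r t x * g (state x r)) = 0"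
    by simp
qed

lemma dynkin_isometry:
  fixes f :: "(nat \<Rightarrow> nat) \<Rightarrow> real"
  assumes f: "\<And>m. \<bar>f m\<bar> \<le> B" and t: "0 \<le> t"
  shows "integrable M (\<lambda>x. LINT r:{0..t}|lborel. carre_du_champ f (state x r))"
    "expectation (\<lambda>x. (dynkin f 0 t x)\<^sup>2) = expectation (\<lambda>x. LINT r:{0..t}|lborel. carre_du_champ f (state x r))"
proof -
  let ?G = "\<lambda>x. LINT r:{0..t}|lborel. carre_du_champ f (state x r)"
  have f2: "\<bar>(f m)\<^sup>2\<bar> \<le> B\<^sup>2" for m
    using power_mono[OF f abs_ge_zero, of m 2] by simp
  obtain K where K: "\<And>m. m \<in> Sn n \<Longrightarrow> \<bar>carre_du_champ f m\<bar> \<le> K"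
    using carre_du_champ_bounded[where f=f, OF f] by blast
  have "(\<lambda>(x, r). carre_du_champ f (state x r)) \<in> borel_measurable (M \<Otimes>\<^sub>M lborel)"
    unfolding split_beta' by (rule state_pair_measurable)
  then show G: "integrable M ?G"
    by (rule expectation_set_integral_Icc(1)) (use K[OF state_Sn] in simp)
  have start_eq: "expectation (\<lambda>x. dynkin f 0 t x * f (state x 0)) = 0"
    using dynkin_orthogonal[where f=f and g=f, OF f f order_refl t] by simp
  obtain D where D: "0 \<le> D" "\<And>s r x. 0 \<le> s \<Longrightarrow> s \<le> r \<Longrightarrow> r \<le> t \<Longrightarrow> \<bar>dynkin f s r x\<bar> \<le> D"
    using dynkin_bounded[where f=f, OF f t] by blast
  have start: "integrable M (\<lambda>x. dynkin f 0 t x * f (state x 0))"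
  proof (rule integrable_const_bound)
    show "AE x in M. norm (dynkin f 0 t x * f (state x 0)) \<le> D * B"
      unfolding real_norm_def abs_mult
      by (intro AE_I2 mult_mono D(2)[OF order_refl t order_refl] f D(1) abs_ge_zero)
    show "(\<lambda>x. dynkin f 0 t x * f (state x 0)) \<in> borel_measurable M"
      by (rule borel_measurable_times[OF dynkin_random_variable state_fun_random_variable])
  qed
  note correction = expectation_integral_dynkin[where f=f and g="genN lam q n f", OF f genN_bounded[where f=f, OF f] t]
  note square = dynkin_integrable(1)[where f="\<lambda>m. (f m)\<^sup>2" and B="B\<^sup>2", OF f2 t]
  have "expectation (\<lambda>x. dynkin (\<lambda>m. (f m)\<^sup>2) 0 t x * 1) = 0"
    by (rule dynkin_orthogonal[where f="\<lambda>m. (f m)\<^sup>2" and g="\<lambda>_. 1" and C=1, OF f2]) (simp_all add: t)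
  then have square_eq: "expectation (\<lambda>x. dynkin (\<lambda>m. (f m)\<^sup>2) 0 t x) = 0"
    by (simp only: mult_1_right)
  show "expectation (\<lambda>x. (dynkin f 0 t x)\<^sup>2) = expectation ?G"
    unfolding dynkin_square[where f=f, OF f]
    using square square_eq G start start_eq correction by simp
qed

lemma dynkin_second_moment:
  fixes f :: "(nat \<Rightarrow> nat) \<Rightarrow> real"
  assumes f: "\<And>m. \<bar>f m\<bar> \<le> B" and t: "0 \<le> t"
    and arrive: "\<And>m j. \<bar>f (arrive m (Suc j)) - f m\<bar> \<le> C"
    and depart: "\<And>m j. \<bar>f (depart m (Suc j)) - f m\<bar> \<le> C"
  shows "expectation (\<lambda>x. (dynkin f 0 t x)\<^sup>2) \<le> real n * (lam + 1) * C\<^sup>2 * t"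
proof -
  have rate: "carre_du_champ f (state x r) \<le> real n * (lam + 1) * C\<^sup>2" for x r
    unfolding carre_du_champ_def by (rule genN_square_le[where f=f, OF state_Sn n_pos f arrive depart])
  obtain K where K: "\<And>m. m \<in> Sn n \<Longrightarrow> \<bar>carre_du_champ f m\<bar> \<le> K"
    using carre_du_champ_bounded[where f=f, OF f] by blast
  have "(LINT r:{0..t}|lborel. carre_du_champ f (state x r)) \<le> real n * (lam + 1) * C\<^sup>2 * t" for x
  proof -
    have "(LINT r:{0..t}|lborel. carre_du_champ f (state x r)) \<le> (LINT r:{0..t}|lborel. real n * (lam + 1) * C\<^sup>2)"
      by (rule set_integral_mono[OF state_integrable[where g="carre_du_champ f", OF K] _ rate])
         (auto intro: set_integrable_bounded_Icc)
    then show ?thesis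
      using t by (simp add: set_lebesgue_integral_def mult_ac)
  qed
  then show ?thesis
    unfolding dynkin_isometry(2)[where f=f, OF f t]
    by (intro integral_le_const dynkin_isometry(1)[where f=f, OF f t]) simp
qed

lemma expectation_abs_dynkin_le:
  fixes f :: "(nat \<Rightarrow> nat) \<Rightarrow> real"
  assumes f: "\<And>m. \<bar>f m\<bar> \<le> B" and t: "0 \<le> t" and C: "0 \<le> C"
    and arrive: "\<And>m j. \<bar>f (arrive m (Suc j)) - f m\<bar> \<le> C"
    and depart: "\<And>m j. \<bar>f (depart m (Suc j)) - f m\<bar> \<le> C"
  shows "expectation (\<lambda>x. \<bar>dynkin f 0 t x\<bar>) \<le> C * sqrt (real n * (lam + 1) * t)"
proof -
  have "expectation (\<lambda>x. \<bar>dynkin f 0 t x\<bar>) \<le> sqrt (expectation (\<lambda>x. (dynkin f 0 t x)\<^sup>2))"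
    by (rule expectation_abs_le_sqrt[OF dynkin_integrable[where f=f, OF f t]])
  also have "\<dots> \<le> sqrt (C\<^sup>2 * (real n * (lam + 1) * t))"
    using dynkin_second_moment[where f=f, OF f t arrive depart] by (simp add: mult_ac)
  finally show ?thesis
    using C by (simp add: real_sqrt_mult)
qed

lemma expectation_integral_abs_dynkin_le:
  fixes f :: "(nat \<Rightarrow> nat) \<Rightarrow> real"
  assumes f: "\<And>m. \<bar>f m\<bar> \<le> B" and t: "0 \<le> t" and C: "0 \<le> C"
    and arrive: "\<And>m j. \<bar>f (arrive m (Suc j)) - f m\<bar> \<le> C"
    and depart: "\<And>m j. \<bar>f (depart m (Suc j)) - f m\<bar> \<le> C"
  shows "integrable M (\<lambda>x. LINT s:{0..t}|lborel. \<bar>dynkin f 0 s x\<bar>)"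
    "expectation (\<lambda>x. LINT s:{0..t}|lborel. \<bar>dynkin f 0 s x\<bar>) \<le> C * sqrt (real n * (lam + 1) * t) * t"
proof -
  obtain K where K: "0 \<le> K" "\<And>s r x. 0 \<le> s \<Longrightarrow> s \<le> r \<Longrightarrow> r \<le> t \<Longrightarrow> \<bar>dynkin f s r x\<bar> \<le> K"
    using dynkin_bounded[where f=f, OF f t] by blast
  have bound: "\<bar>\<bar>dynkin f 0 s x\<bar>\<bar> \<le> K" if "s \<in> {0..t}" for x s
    using K(2)[of 0 s x] that by simp
  have meas: "(\<lambda>(x, s). \<bar>dynkin f 0 s x\<bar>) \<in> borel_measurable (M \<Otimes>\<^sub>M lborel)"
    unfolding split_beta'
    by (intro borel_measurable_abs dynkin_measurable[where \<xi>=fst and a="\<lambda>_. 0" and b=snd]) auto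
  note swap = expectation_set_integral_Icc[where B=K, OF meas]
  show "integrable M (\<lambda>x. LINT s:{0..t}|lborel. \<bar>dynkin f 0 s x\<bar>)"
    using swap(1) bound by simp
  have "\<bar>LINT s:{0..t}|lborel. expectation (\<lambda>x. \<bar>dynkin f 0 s x\<bar>)\<bar> \<le> C * sqrt (real n * (lam + 1) * t) * (t - 0)"
  proof (rule abs_set_integral_le_Icc[OF _ _ t])
    show "set_integrable lborel {0..t} (\<lambda>s. expectation (\<lambda>x. \<bar>dynkin f 0 s x\<bar>))"
      using swap(3) bound by simp
    fix s
    assume s: "s \<in> {0..t}"
    have "expectation (\<lambda>x. \<bar>dynkin f 0 s x\<bar>) \<le> C * sqrt (real n * (lam + 1) * s)"
      by (rule expectation_abs_dynkin_le[where f=f, OF f _ C arrive depart]) (use s in auto)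
    also have "\<dots> \<le> C * sqrt (real n * (lam + 1) * t)"
      using s lam_pos C by (intro mult_left_mono) (simp_all add: mult_left_mono)
    finally show "\<bar>expectation (\<lambda>x. \<bar>dynkin f 0 s x\<bar>)\<bar> \<le> C * sqrt (real n * (lam + 1) * t)"
      by simp
  qed
  then show "expectation (\<lambda>x. LINT s:{0..t}|lborel. \<bar>dynkin f 0 s x\<bar>) \<le> C * sqrt (real n * (lam + 1) * t) * t"
    using swap(2) bound by simp
qed

end

section \<open>The finite system as a random element of the path and occupation space\<close>

lemma tendsto_rhoU_eventually:
  assumes "\<forall>\<^sub>F s in F. x s = u"
  shows "((\<lambda>s. rhoU (x s) u) \<longlongrightarrow> 0) F"
proof (rule tendsto_eventually)
  have "rhoU u u = 0"
    by (simp add: rhoU_def)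
  then show "\<forall>\<^sub>F s in F. rhoU (x s) u = 0"
    using assms by (auto elim: eventually_mono)
qed

lemma sqrt_mult_divide_self:
  fixes a c :: real
  assumes "0 < a"
  shows "sqrt (a * c) / a = sqrt (c / a)"
proof -
  have "sqrt (a * c) / a = sqrt (a * c) / sqrt (a * a)"
    using assms by simp
  also have "\<dots> = sqrt ((a * c) / (a * a))"
    by (rule real_sqrt_divide[symmetric])
  also have "(a * c) / (a * a) = c / a"
    using assms by simp
  finally show ?thesis .
qed

definition scaled_system :: "nat \<Rightarrow> (real \<Rightarrow> nat \<Rightarrow> nat) \<Rightarrow> DL" where
  "scaled_system n y = (\<lambda>t. uOf n (y t), occ y)"

context lcq_system
begin

lemma scaled_path_Dsp: "(\<lambda>t. uOf n (X x t)) \<in> Dsp"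
  unfolding Dsp_def
proof (intro CollectI conjI allI impI)
  show "uOf n (X x t) \<in> Uset" if "0 \<le> t" for t
    using uOf_Uset[OF state_Sn n_pos, of x t] that by (simp add: state_eq)
  show "((\<lambda>s. rhoU (uOf n (X x s)) (uOf n (X x t))) \<longlongrightarrow> 0) (at_right t)" if "0 \<le> t" for t
    by (rule tendsto_rhoU_eventually) (use X_right_constant[OF that, of x] in eventually_elim, simp)
  show "\<exists>u\<in>Uset. ((\<lambda>s. rhoU (uOf n (X x s)) u) \<longlongrightarrow> 0) (at_left t)" if t: "0 < t" for t
  proof -
    obtain s where s: "0 \<le> s" "\<forall>\<^sub>F s' in at_left t. X x s' = X x s"
      using X_left_constant[OF t] by blast
    have "((\<lambda>s'. rhoU (uOf n (X x s')) (uOf n (X x s))) \<longlongrightarrow> 0) (at_left t)"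
      by (rule tendsto_rhoU_eventually) (use s(2) in eventually_elim, simp)
    moreover have "uOf n (X x s) \<in> Uset"
      using uOf_Uset[OF state_Sn n_pos, of x s] s(1) by (simp add: state_eq)
    ultimately show ?thesis
      by blast
  qed
qed

lemma toO_state_measurable: "(\<lambda>s. toO (state x s)) \<in> borel \<rightarrow>\<^sub>M count_space UNIV"
proof (rule measurableI)
  fix A :: "(nat \<Rightarrow> enat) set"
  have "(\<lambda>s. indicator A (toO (state x s)) :: real) -` {1} \<inter> space borel \<in> sets borel"
    using state_path_measurable[of "\<lambda>m. indicator A (toO m)"] by (rule measurable_sets) simp
  moreover have "(\<lambda>s. indicator A (toO (state x s)) :: real) -` {1} = (\<lambda>s. toO (state x s)) -` A"
    by (auto simp: indicator_def split: if_splits)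
  ultimately show "(\<lambda>s. toO (state x s)) -` A \<inter> space borel \<in> sets borel"
    by simp
qed simp

lemma occ_eq_distr: "occ (X x) = distr (restrict_space lborel {0..}) SpaceL (\<lambda>s. (s, toO (state x s)))"
  unfolding occ_def by (rule distr_cong) (auto simp: space_restrict_space state_eq)

lemma time_state_measurable: "(\<lambda>s. (s, toO (state x s))) \<in> borel \<rightarrow>\<^sub>M SpaceL"
  unfolding SpaceL_def by (intro measurable_Pair toO_state_measurable) simp

lemma occ_disintegrates: "disintegrates (occ (X x)) (\<lambda>s. return_pmf (toO (state x s)))"
  unfolding disintegrates_def
proof (intro conjI allI impI)
  show "set_pmf (return_pmf (toO (state x s))) \<subseteq> OmegaS" for s
    using toO_OmegaS[OF state_Sn, of x s] by simp
next
  fix t B and h :: "real \<times> (nat \<Rightarrow> enat) \<Rightarrow> real"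
  assume h [measurable]: "h \<in> borel_measurable SpaceL" and B: "\<forall>s\<in>{0..t}. \<forall>w\<in>OmegaS. \<bar>h (s, w)\<bar> \<le> B"
  have meas [measurable]: "(\<lambda>s. h (s, toO (state x s))) \<in> borel_measurable borel"
    using measurable_compose[OF time_state_measurable h] .
  have bound: "\<bar>h (s, toO (state x s))\<bar> \<le> B" if "s \<in> {0..t}" for s
    using B that toO_OmegaS[OF state_Sn, of x s] by blast
  have "set_integrable lborel {0..t} (\<lambda>s. h (s, toO (state x s)))"
    by (rule set_integrable_bounded_Icc[OF meas]) (use bound in simp)
  then show "set_integrable lborel {0..t} (\<lambda>s. measure_pmf.expectation (return_pmf (toO (state x s))) (\<lambda>w. h (s, w)))"
    by simp
  let ?H = "\<lambda>z. indicator (strip t) z *\<^sub>R h z"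
  have strip: "strip t \<in> sets SpaceL"
    by (rule times_sets_SpaceL) simp
  have "(LINT z:strip t|occ (X x). h z) = (\<integral>s. ?H (s, toO (state x s)) \<partial>restrict_space lborel {0..})"
    unfolding set_lebesgue_integral_def occ_eq_distr
    by (rule integral_distr) (use strip in \<open>auto intro!: measurable_restrict_space1 time_state_measurable\<close>)
  also have "\<dots> = (LINT s|lborel. indicator {0..} s *\<^sub>R ?H (s, toO (state x s)))"
    by (rule integral_restrict_space) simp
  also have "\<dots> = (LINT s|lborel. indicator {0..<t} s *\<^sub>R h (s, toO (state x s)))"
    using toO_OmegaS[OF state_Sn, of x]
    by (intro Bochner_Integration.integral_cong) (auto simp: indicator_def)
  also have "\<dots> = (LINT s:{0..t}|lborel. h (s, toO (state x s)))"
    unfolding set_lebesgue_integral_def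
    by (rule integral_cong_AE)
      (use AE_lborel_singleton[of t] in \<open>auto elim!: eventually_mono simp: indicator_def\<close>)
  finally show "(LINT z:strip t|occ (X x). h z) =
      (LINT s:{0..t}|lborel. measure_pmf.expectation (return_pmf (toO (state x s))) (\<lambda>w. h (s, w)))"
    by simp
qed

lemma occ_integral_scaled_system:
  assumes h: "observable h"
  shows "occ_integral t h (scaled_system n (X x)) = (LINT s:{0..t}|lborel. h s (uOf n (state x s)) (toO (state x s)))"
proof -
  have "occ_integral t h (scaled_system n (X x)) = (LINT s:{0..t}|lborel. h s (uOf n (X x s)) (toO (state x s)))"
    unfolding scaled_system_def occ_integral_disintegrates(2)[OF h scaled_path_Dsp occ_disintegrates] by simp
  also have "\<dots> = (LINT s:{0..t}|lborel. h s (uOf n (state x s)) (toO (state x s)))"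
    by (rule set_lebesgue_integral_cong) (auto simp: state_eq)
  finally show ?thesis .
qed

lemma expectation_abs_occ_genO_le:
  fixes f :: "(nat \<Rightarrow> enat) \<Rightarrow> real"
  assumes f: "continuous_on UNIV f" "\<And>w. \<bar>f w\<bar> \<le> B" "depends_on_levels N f" and t: "0 \<le> t"
  shows "expectation (\<lambda>x. \<bar>occ_integral t (\<lambda>s u w. genO lam q u f w) (scaled_system n (X x))\<bar>)
    \<le> 2 * B * (1 / real n + sqrt ((lam + 1) * t / real n))"
proof -
  define g where "g m = f (toO m)" for m
  have g: "\<bar>g m\<bar> \<le> B" and jump: "\<bar>g m - g m'\<bar> \<le> 2 * B" for m m'
    using f(2)[of "toO m"] f(2)[of "toO m'"] by (auto simp: g_def)
  then have "0 \<le> B"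
    using abs_ge_zero order_trans by blast
  have "genO lam q (uOf n m) f (toO m) = genN lam q n g m / real n" if "m \<in> Sn n" for m
  proof -
    have "\<bar>f w - f (toO m)\<bar> \<le> 2 * B" for w
      using f(2)[of w] f(2)[of "toO m"] by linarith
    from genN_toO[where f=f, OF that n_pos this] show ?thesis
      using n_pos by (simp add: g_def[abs_def])
  qed
  then have path: "occ_integral t (\<lambda>s u w. genO lam q u f w) (scaled_system n (X x)) =
      (g (state x t) - g (state x 0) - dynkin g 0 t x) / real n" for x
    unfolding occ_integral_scaled_system[OF observable_genO[OF f]] dynkin_def by (simp add: state_Sn)
  have "\<bar>occ_integral t (\<lambda>s u w. genO lam q u f w) (scaled_system n (X x))\<bar> \<le> (2 * B + \<bar>dynkin g 0 t x\<bar>) / real n" for x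
    unfolding path abs_divide using jump[of "state x t" "state x 0"]
    by (intro divide_mono) (use n_pos in auto)
  then have "expectation (\<lambda>x. \<bar>occ_integral t (\<lambda>s u w. genO lam q u f w) (scaled_system n (X x))\<bar>)
      \<le> expectation (\<lambda>x. (2 * B + \<bar>dynkin g 0 t x\<bar>) / real n)"
    using dynkin_integrable(1)[where f=g, OF g t] \<open>0 \<le> B\<close> by (intro integral_mono') auto
  also have "\<dots> = (2 * B + expectation (\<lambda>x. \<bar>dynkin g 0 t x\<bar>)) / real n"
    using dynkin_integrable(1)[where f=g, OF g t] by (simp add: prob_space)
  also have "\<dots> \<le> (2 * B + 2 * B * sqrt (real n * (lam + 1) * t)) / real n"
    using expectation_abs_dynkin_le[where f=g, OF g t _ jump jump] \<open>0 \<le> B\<close> by (intro divide_right_mono) auto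
  also have "\<dots> = 2 * B * (1 / real n + sqrt ((lam + 1) * t / real n))"
    unfolding sqrt_mult_divide_self[OF of_nat_0_less_iff[THEN iffD2, OF n_pos], symmetric]
    by (simp add: add_divide_distrib algebra_simps)
  finally show ?thesis .
qed

lemma flow_defect_scaled_system:
  assumes k: "1 \<le> k" and t: "0 \<le> t"
  shows "flow_defect lam q t k (scaled_system n (X x)) =
    (LINT s:{0..t}|lborel. dynkin (\<lambda>m. real (min (m k) n)) 0 s x / real n)"
proof -
  let ?f = "\<lambda>m :: nat \<Rightarrow> nat. real (min (m k) n)"
  have f: "real (state x s k) = ?f (state x s)" for s
    using Sn_le[OF state_Sn, of x s k] by simp
  have drift: "fluid_drift lam q (uOf n (X x r)) (return_pmf (toO (state x r))) k = genN lam q n ?f (state x r) / real n"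
    if "0 \<le> r" for r
    using genN_coordinate[OF state_Sn n_pos k, of x r] n_pos that by (simp add: fluid_drift_def state_eq)
  have "(LINT r:{0..s}|lborel. fluid_drift lam q (uOf n (X x r)) (return_pmf (toO (state x r))) k) =
      (LINT r:{0..s}|lborel. genN lam q n ?f (state x r) / real n)" for s
    by (rule set_lebesgue_integral_cong) (auto simp: drift)
  moreover have "uOf n (X x s) k = ?f (state x s) / real n" if "0 \<le> s" for s
    using that f[of s] by (simp add: uOf_def state_eq)
  ultimately show ?thesis
    unfolding scaled_system_def flow_defect_disintegrates(2)[OF scaled_path_Dsp occ_disintegrates t]
    by (intro set_lebesgue_integral_cong) (auto simp: dynkin_def diff_divide_distrib)
qed

lemma expectation_abs_flow_defect_le:
  assumes k: "1 \<le> k" and t: "0 \<le> t"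
  shows "expectation (\<lambda>x. \<bar>flow_defect lam q t k (scaled_system n (X x))\<bar>) \<le> t * sqrt ((lam + 1) * t / real n)"
proof -
  define f where "f m = real (min (m k) n)" for m :: "nat \<Rightarrow> nat"
  have f: "\<bar>f m\<bar> \<le> real n" for m
    by (simp add: f_def)
  have jumps: "\<bar>f (arrive m (Suc j)) - f m\<bar> \<le> 1" "\<bar>f (depart m (Suc j)) - f m\<bar> \<le> 1" for m j
    by (auto simp: f_def arrive_def depart_def)
  note dynkin = expectation_integral_abs_dynkin_le[where f=f, OF f t zero_le_one jumps]
  have "\<bar>flow_defect lam q t k (scaled_system n (X x))\<bar> \<le> (LINT s:{0..t}|lborel. \<bar>dynkin f 0 s x\<bar>) / real n" for x
  proof -
    have "\<bar>LINT s:{0..t}|lborel. dynkin f 0 s x\<bar> \<le> (LINT s:{0..t}|lborel. \<bar>dynkin f 0 s x\<bar>)"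
      unfolding set_lebesgue_integral_def
      by (rule order_trans[OF integral_abs_bound]) (simp add: abs_mult)
    then show ?thesis
      unfolding flow_defect_scaled_system[OF k t] f_def[symmetric]
      using n_pos by (simp add: abs_divide divide_right_mono)
  qed
  then have "expectation (\<lambda>x. \<bar>flow_defect lam q t k (scaled_system n (X x))\<bar>)
      \<le> expectation (\<lambda>x. (LINT s:{0..t}|lborel. \<bar>dynkin f 0 s x\<bar>) / real n)"
    using dynkin(1) by (intro integral_mono') (auto simp: set_lebesgue_integral_def)
  also have "\<dots> \<le> 1 * sqrt (real n * (lam + 1) * t) * t / real n"
    using dynkin(2) by (simp add: divide_right_mono)
  also have "\<dots> = t * sqrt ((lam + 1) * t / real n)"
    unfolding sqrt_mult_divide_self[OF of_nat_0_less_iff[THEN iffD2, OF n_pos], symmetric]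
    by (simp add: mult_ac)
  finally show ?thesis .
qed

lemma expectation_abs_occ_level_below_le:
  assumes k: "1 \<le> k" and t: "0 \<le> t"
  shows "expectation (\<lambda>x. \<bar>occ_integral t (\<lambda>s u w. u k * indicator {..<enat N} (w k)) (scaled_system n (X x))\<bar>)
    \<le> real N * t / real n"
proof -
  define g where "g m = uOf n m k * indicator {..<enat N} (toO m k)" for m
  have g: "\<bar>g m\<bar> \<le> real N / real n" for m
    using k by (auto simp: g_def uOf_def toO_def indicator_def divide_right_mono)
  have "\<bar>LINT s:{0..t}|lborel. g (state x s)\<bar> \<le> real N / real n * (t - 0)" for x
    by (rule state_integral_abs_le[OF g t])
  then have "\<bar>occ_integral t (\<lambda>s u w. u k * indicator {..<enat N} (w k)) (scaled_system n (X x))\<bar> \<le> real N * t / real n" for x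
    unfolding occ_integral_scaled_system[OF observable_level_below] g_def by simp
  then have "expectation (\<lambda>x. \<bar>occ_integral t (\<lambda>s u w. u k * indicator {..<enat N} (w k)) (scaled_system n (X x))\<bar>)
      \<le> expectation (\<lambda>x. real N * t / real n)"
    using t by (intro integral_mono') auto
  then show ?thesis
    by (simp add: prob_space)
qed

end

section \<open>Stationarity from cylinder functions\<close>

definition truncate_level :: "nat \<Rightarrow> enat \<Rightarrow> enat" where
  "truncate_level N e = (if e < enat N then e else \<infinity>)"

definition truncate_levels :: "nat \<Rightarrow> (nat \<Rightarrow> enat) \<Rightarrow> nat \<Rightarrow> enat" where
  "truncate_levels N w k = truncate_level N (w (min k N))"

definition cylinder :: "nat \<Rightarrow> (nat \<Rightarrow> enat) \<Rightarrow> (nat \<Rightarrow> enat) \<Rightarrow> real" where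
  "cylinder N a w = (\<Prod>i\<le>N. indicator {a i} (truncate_level N (w i)))"

lemma finite_range_truncate_levels: "finite (range (truncate_levels N))"
proof (rule finite_subset)
  let ?E = "insert \<infinity> (enat ` {..<N})"
  have level: "truncate_level N e \<in> ?E" for e
    by (cases e) (auto simp: truncate_level_def)
  show "range (truncate_levels N) \<subseteq> (\<lambda>g k. g (min k N)) ` ({..N} \<rightarrow>\<^sub>E ?E)"
  proof (intro image_subsetI image_eqI)
    show "truncate_levels N w = (\<lambda>k. restrict (truncate_levels N w) {..N} (min k N))" for w
      by (auto simp: truncate_levels_def)
    show "restrict (truncate_levels N w) {..N} \<in> {..N} \<rightarrow>\<^sub>E ?E" for w
      unfolding truncate_levels_def restrict_PiE_iff using level by blast
  qed
  show "finite ((\<lambda>g k. g (min k N)) ` ({..N} \<rightarrow>\<^sub>E ?E))"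
    by (intro finite_imageI finite_PiE) auto
qed

lemma eventually_truncate_levels_eq:
  assumes w: "w \<in> OmegaS"
  shows "\<forall>\<^sub>F N in sequentially. truncate_levels N w = w"
proof -
  obtain K where eq_K: "\<And>k. K \<le> k \<Longrightarrow> w k = w K"
    using OmegaS_eventually_constant[OF w] by blast
  have "\<forall>\<^sub>F N in sequentially. truncate_level N e = e" for e
  proof (cases e)
    case (enat j)
    show ?thesis
      using eventually_gt_at_top[of j] by eventually_elim (simp add: enat truncate_level_def)
  qed (simp add: truncate_level_def)
  then have "\<forall>\<^sub>F N in sequentially. \<forall>k\<in>{..K}. truncate_level N (w k) = w k"
    by (simp add: eventually_ball_finite_distrib)
  then show ?thesis
    using eventually_ge_at_top[of K]
  proof eventually_elim
    case (elim N)
    show ?case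
    proof
      fix k
      have "w (min k N) = w (min k K)" "w k = w (min k K)"
        using eq_K[of k] eq_K[of "min k N"] elim(2) by (auto simp: min_def)
      then show "truncate_levels N w k = w k"
        using elim(1) by (simp add: truncate_levels_def)
    qed
  qed
qed

lemma continuous_on_cylinder: "continuous_on UNIV (cylinder N a)"
  unfolding cylinder_def
proof (intro continuous_on_prod continuous_on_level continuous_on_enat tendsto_eventually)
  show "\<forall>\<^sub>F n in sequentially. indicator {a i} (truncate_level N (enat n)) = (indicator {a i} (truncate_level N \<infinity>) :: real)" for i
    using eventually_ge_at_top[of N] by eventually_elim (simp add: truncate_level_def)
qed

lemma abs_cylinder_le: "\<bar>cylinder N a w\<bar> \<le> 1"
proof -
  have "0 \<le> cylinder N a w"
    unfolding cylinder_def by (rule prod_nonneg) simp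
  moreover have "cylinder N a w \<le> 1"
    unfolding cylinder_def by (rule prod_le_1) (simp add: indicator_def)
  ultimately show ?thesis
    by simp
qed

lemma depends_on_levels_cylinder: "depends_on_levels N (cylinder N a)"
  unfolding depends_on_levels_def cylinder_def by (auto intro: prod.cong)

lemma sum_cylinders:
  fixes f :: "(nat \<Rightarrow> enat) \<Rightarrow> real"
  shows "f (truncate_levels N w) = (\<Sum>a\<in>range (truncate_levels N). f a * cylinder N a w)"
proof -
  have "cylinder N a w = (if a = truncate_levels N w then 1 else 0)" if a: "a \<in> range (truncate_levels N)" for a
  proof (cases "a = truncate_levels N w")
    case True
    then show ?thesis
      by (simp add: cylinder_def truncate_levels_def)
  next
    case False
    obtain v where v: "a = truncate_levels N v"
      using a by blast
    from False obtain k where "a k \<noteq> truncate_levels N w k"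
      by blast
    then have "a (min k N) \<noteq> truncate_level N (w (min k N))"
      by (simp add: v truncate_levels_def)
    then have "cylinder N a w = 0"
      unfolding cylinder_def by (intro prod_zero) (auto intro!: bexI[of _ "min k N"])
    then show ?thesis
      using False by simp
  qed
  then have "(\<Sum>a\<in>range (truncate_levels N). f a * cylinder N a w) =
      (\<Sum>a\<in>range (truncate_levels N). if a = truncate_levels N w then f a else 0)"
    by (intro sum.cong) auto
  then show ?thesis
    by (simp add: finite_range_truncate_levels)
qed

context lcq_parameters
begin

lemma genO_bounded:
  assumes "u \<in> Uset" "w \<in> OmegaS" "\<And>v. \<bar>f v\<bar> \<le> B"
  shows "\<bar>genO lam q u f w\<bar> \<le> (lam + 1) * (2 * B)"
proof (rule genO_bound[OF assms(1,2)])
  show "\<bar>f v - f w\<bar> \<le> 2 * B" for v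
    using assms(3)[of v] assms(3)[of w] by linarith
qed

context
  fixes u :: "nat \<Rightarrow> real" and \<pi> :: "(nat \<Rightarrow> enat) pmf"
  assumes u: "u \<in> Uset" and \<pi>: "set_pmf \<pi> \<subseteq> OmegaS"
begin

lemma genO_pmf_integrable: "(\<And>v. \<bar>f v\<bar> \<le> B) \<Longrightarrow> integrable (measure_pmf \<pi>) (genO lam q u f)"
  using genO_bounded[OF u] \<pi> by (intro expectation_pmf_bounded(1)[of \<pi> _ "(lam + 1) * (2 * B)"]) auto

lemma expectation_genO_sum:
  assumes "finite A" and f: "\<And>a v. \<bar>f a v\<bar> \<le> B"
  shows "measure_pmf.expectation \<pi> (genO lam q u (\<lambda>v. \<Sum>a\<in>A. c a * f a v)) =
    (\<Sum>a\<in>A. c a * measure_pmf.expectation \<pi> (genO lam q u (f a)))"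
  using assms(1)
proof (induction A)
  case empty
  then show ?case
    by (simp add: genO_def)
next
  case (insert b A)
  let ?g = "\<lambda>v. \<Sum>a\<in>A. c a * f a v"
  have g: "\<bar>?g v\<bar> \<le> (\<Sum>a\<in>A. \<bar>c a\<bar> * B)" for v
    by (rule order_trans[OF sum_abs sum_mono]) (simp add: abs_mult mult_left_mono f)
  have "\<bar>?g v - ?g w\<bar> \<le> 2 * (\<Sum>a\<in>A. \<bar>c a\<bar> * B)" "\<bar>f b v - f b w\<bar> \<le> 2 * B" for v w
    using g[of v] g[of w] f[of b v] f[of b w] by linarith+
  then have "genO lam q u (\<lambda>v. ?g v + c b * f b v) w = genO lam q u ?g w + c b * genO lam q u (f b) w"
    if "w \<in> set_pmf \<pi>" for w
    using that \<pi> by (intro genO_linear[OF u]) auto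
  then have "measure_pmf.expectation \<pi> (genO lam q u (\<lambda>v. ?g v + c b * f b v)) =
      measure_pmf.expectation \<pi> (\<lambda>w. genO lam q u ?g w + c b * genO lam q u (f b) w)"
    by (intro integral_cong_AE) (auto simp: AE_measure_pmf_iff)
  also have "\<dots> = measure_pmf.expectation \<pi> (genO lam q u ?g) + c b * measure_pmf.expectation \<pi> (genO lam q u (f b))"
    using genO_pmf_integrable[OF g] genO_pmf_integrable[where f="f b", OF f] by simp
  finally show ?case
    using insert by (simp add: add.commute)
qed

lemma expectation_genO_tendsto:
  assumes f: "\<And>n v. \<bar>f n v\<bar> \<le> B" and lim: "\<And>v. (\<lambda>n. f n v) \<longlonglongrightarrow> g v"
  shows "(\<lambda>n. measure_pmf.expectation \<pi> (genO lam q u (f n))) \<longlonglongrightarrow> measure_pmf.expectation \<pi> (genO lam q u g)"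
proof (rule integral_dominated_convergence[where w="\<lambda>_. (lam + 1) * (2 * B)"])
  have diff: "\<bar>f n v - f n w\<bar> \<le> 2 * B" for n v w
    using f[of n v] f[of n w] by linarith
  show "AE w in measure_pmf \<pi>. (\<lambda>n. genO lam q u (f n) w) \<longlonglongrightarrow> genO lam q u g w"
    using \<pi> by (auto simp: AE_measure_pmf_iff intro!: genO_tendsto[OF u _ diff lim])
  show "AE w in measure_pmf \<pi>. norm (genO lam q u (f n) w) \<le> (lam + 1) * (2 * B)" for n
    using \<pi> genO_bounded[OF u _ f] by (auto simp: AE_measure_pmf_iff)
qed auto

lemma expectation_genO_cong:
  assumes top: "\<And>w k. w \<in> set_pmf \<pi> \<Longrightarrow> 0 < u k \<Longrightarrow> w k = \<infinity>" and eq: "\<And>v. v \<in> OmegaS \<Longrightarrow> f v = g v"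
  shows "measure_pmf.expectation \<pi> (genO lam q u f) = measure_pmf.expectation \<pi> (genO lam q u g)"
  using \<pi> top by (intro integral_cong_AE) (auto simp: AE_measure_pmf_iff intro!: genO_cong_OmegaS[OF u] eq)

lemma stationaryO_if_cylinders:
  assumes top: "\<And>w k. w \<in> set_pmf \<pi> \<Longrightarrow> 0 < u k \<Longrightarrow> w k = \<infinity>"
    and cylinders: "\<And>N a. a \<in> range (truncate_levels N) \<Longrightarrow> measure_pmf.expectation \<pi> (genO lam q u (cylinder N a)) = 0"
  shows "stationaryO lam q u \<pi>"
  unfolding stationaryO_def
proof (intro allI impI)
  fix f :: "(nat \<Rightarrow> enat) \<Rightarrow> real"
  assume "bounded (range f)"
  then obtain B where B: "\<And>v. \<bar>f v\<bar> \<le> B"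
    unfolding bounded_iff by auto
  define g where "g v = (if v \<in> OmegaS then f v else 0)" for v
  define h where "h N v = (if v \<in> OmegaS then f (truncate_levels N v) else 0)" for N v
  have "measure_pmf.expectation \<pi> (genO lam q u (h N)) = 0" for N
  proof -
    have "measure_pmf.expectation \<pi> (genO lam q u (h N)) =
        measure_pmf.expectation \<pi> (genO lam q u (\<lambda>v. \<Sum>a\<in>range (truncate_levels N). f a * cylinder N a v))"
      by (rule expectation_genO_cong, erule (1) top, simp add: h_def flip: sum_cylinders)
    also have "\<dots> = 0"
      unfolding expectation_genO_sum[OF finite_range_truncate_levels abs_cylinder_le]
      using cylinders by simp
    finally show ?thesis .
  qed
  moreover have "(\<lambda>N. measure_pmf.expectation \<pi> (genO lam q u (h N))) \<longlonglongrightarrow> measure_pmf.expectation \<pi> (genO lam q u g)"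
  proof (rule expectation_genO_tendsto)
    show "\<bar>h N v\<bar> \<le> B" for N v
      using B[of "truncate_levels N v"] order_trans[OF abs_ge_zero B] by (simp add: h_def)
    show "(\<lambda>N. h N v) \<longlonglongrightarrow> g v" for v
    proof (rule tendsto_eventually, cases "v \<in> OmegaS")
      case True
      show "\<forall>\<^sub>F N in sequentially. h N v = g v"
        using eventually_truncate_levels_eq[OF True] by eventually_elim (simp add: h_def g_def)
    qed (simp add: h_def g_def)
  qed
  ultimately have "measure_pmf.expectation \<pi> (genO lam q u g) = 0"
    by (simp add: LIMSEQ_const_iff)
  moreover have "measure_pmf.expectation \<pi> (genO lam q u f) = measure_pmf.expectation \<pi> (genO lam q u g)"
    by (rule expectation_genO_cong, erule (1) top, simp add: g_def)
  ultimately show "measure_pmf.expectation \<pi> (genO lam q u f) = 0"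
    by simp
qed

end

end

lemma stationaryO_infinite: "stationaryO lam q u (return_pmf (\<lambda>_. \<infinity>))"
proof -
  have "(\<lambda>_. \<infinity>)(Suc j := \<infinity> + 1) = (\<lambda>_. \<infinity> :: enat)" "(\<lambda>_. \<infinity>)(Suc j := \<infinity> - 1) = (\<lambda>_. \<infinity> :: enat)" for j :: nat
    by (auto simp: fun_eq_iff)
  then have "genO lam q u f (\<lambda>_. \<infinity>) = 0" for f
    unfolding genO_def by simp
  then show ?thesis
    by (simp add: stationaryO_def)
qed

section \<open>Identification of the limit\<close>

lemma zero_if_AE_zero_right_continuous:
  fixes h :: "real \<Rightarrow> real"
  assumes ae: "AE t in lborel. a < t \<longrightarrow> h t = 0" and h: "(h \<longlongrightarrow> h s) (at_right s)" and s: "a \<le> s"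
  shows "h s = 0"
proof (rule ccontr)
  assume "h s \<noteq> 0"
  with h have "\<forall>\<^sub>F t in at_right s. h t \<noteq> 0"
    by (rule tendsto_imp_eventually_ne)
  then obtain b where b: "s < b" "\<And>t. s < t \<Longrightarrow> t < b \<Longrightarrow> h t \<noteq> 0"
    unfolding eventually_at_right_field by blast
  have "AE t in lborel. t \<notin> {s<..<b}"
    using ae by eventually_elim (use b s in auto)
  then have "{s<..<b} \<in> null_sets lborel"
    by (subst AE_iff_null_sets) auto
  then have "emeasure lborel {s<..<b} = 0"
    by auto
  then show False
    using b(1) by simp
qed

lemma conv_dist_AE_zero:
  assumes conv: "conv_dist M W P V" and F: "Ftest F" and P: "prob_space P"
    and V: "\<And>x. V x \<in> Dsp \<times> Lset" and bound: "\<And>j. (\<integral>x. \<bar>F (W j x)\<bar> \<partial>M j) \<le> c j" and c: "c \<longlonglongrightarrow> 0"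
  shows "AE x in P. F (V x) = 0"
proof -
  interpret prob_space P by fact
  let ?G = "\<lambda>p. \<bar>F p\<bar>"
  have "Ftest ?G"
    using F by (rule Ftest_abs)
  with conv have meas: "(\<lambda>x. ?G (V x)) \<in> borel_measurable P"
    and lim: "(\<lambda>j. \<integral>x. ?G (W j x) \<partial>M j) \<longlonglongrightarrow> (\<integral>x. ?G (V x) \<partial>P)"
    unfolding conv_dist_def by blast+
  have "bounded (F ` (Dsp \<times> Lset))"
    using F by (simp add: Ftest_def)
  then obtain B where "\<And>p. p \<in> Dsp \<times> Lset \<Longrightarrow> \<bar>F p\<bar> \<le> B"
    unfolding bounded_iff by fastforce
  then have int: "integrable P (\<lambda>x. ?G (V x))"
    by (intro integrable_const_bound[of _ B] meas) (use V in auto)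
  have "(\<integral>x. ?G (V x) \<partial>P) \<le> 0"
    by (rule LIMSEQ_le[OF lim c]) (use bound in auto)
  then have "(\<integral>x. ?G (V x) \<partial>P) = 0"
    by (intro antisym) simp_all
  then show ?thesis
    using integral_nonneg_eq_0_iff_AE[OF int] by simp
qed

definition equilibrium :: "real \<Rightarrow> real \<Rightarrow> (nat \<Rightarrow> real) \<Rightarrow> (nat \<Rightarrow> enat) pmf \<Rightarrow> bool" where
  "equilibrium lam q u \<pi> \<longleftrightarrow> set_pmf \<pi> \<subseteq> OmegaS \<and> stationaryO lam q u \<pi> \<and>
     (\<forall>k. 0 < u k \<longrightarrow> measure_pmf.prob \<pi> {w. w k = \<infinity>} = 1)"

definition limit_identities :: "real \<Rightarrow> real \<Rightarrow> DL \<Rightarrow> bool" where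
  "limit_identities lam q p \<longleftrightarrow> (\<forall>t\<in>\<rat> \<inter> {0<..}.
     (\<forall>k\<in>{1..}. flow_defect lam q t k p = 0) \<and>
     (\<forall>k\<in>{1..}. \<forall>N. occ_integral t (\<lambda>s u w. u k * indicator {..<enat N} (w k)) p = 0) \<and>
     (\<forall>N. \<forall>a\<in>range (truncate_levels N). occ_integral t (\<lambda>s u w. genO lam q u (cylinder N a) w) p = 0))"

lemma AE_expectation_zero:
  assumes h: "observable h" and x: "x \<in> Dsp" and d: "disintegrates \<mu> \<kappa>"
    and zero: "\<And>t. t \<in> \<rat> \<Longrightarrow> 0 < t \<Longrightarrow> occ_integral t h (x, \<mu>) = 0"
  shows "AE s in lborel. 0 < s \<longrightarrow> measure_pmf.expectation (\<kappa> s) (h s (x s)) = 0"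
proof (rule AE_zero_if_integrals_zero)
  show "set_integrable lborel {0..b} (\<lambda>s. measure_pmf.expectation (\<kappa> s) (h s (x s)))" for b
    by (rule occ_integral_disintegrates(1)[OF h x d])
  show "(LINT s:{0..t}|lborel. measure_pmf.expectation (\<kappa> s) (h s (x s))) = 0" if "t \<in> \<rat>" "0 < t" for t
    unfolding occ_integral_disintegrates(2)[OF h x d, symmetric] using that by (rule zero)
qed

lemma infinite_if_expectation_below_zero:
  fixes \<pi> :: "('i \<Rightarrow> enat) pmf" and c :: real
  assumes zero: "\<And>N. measure_pmf.expectation \<pi> (\<lambda>w. c * indicator {..<enat N} (w k)) = 0" and "c \<noteq> 0"
    and w: "w \<in> set_pmf \<pi>"
  shows "w k = \<infinity>"
proof (rule ccontr)
  assume "w k \<noteq> \<infinity>"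
  then obtain j where j: "w k = enat j"
    by auto
  let ?h = "\<lambda>w. indicator {..<enat (Suc j)} (w k) :: real"
  have "measure_pmf.expectation \<pi> ?h = 0"
    using zero[of "Suc j"] \<open>c \<noteq> 0\<close> by simp
  moreover have "integrable (measure_pmf \<pi>) ?h"
    by (rule expectation_pmf_bounded(1)[of _ _ 1]) simp
  ultimately have "AE v in measure_pmf \<pi>. ?h v = 0"
    using integral_nonneg_eq_0_iff_AE[of "measure_pmf \<pi>" ?h] by simp
  then have "?h w = 0"
    using w by (simp add: AE_measure_pmf_iff)
  then show False
    by (simp add: j)
qed

context lcq_parameters
begin

lemma equilibriumI:
  assumes u: "u \<in> Uset" and \<pi>: "set_pmf \<pi> \<subseteq> OmegaS"
    and below: "\<And>k N. 1 \<le> k \<Longrightarrow> measure_pmf.expectation \<pi> (\<lambda>w. u k * indicator {..<enat N} (w k)) = 0"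
    and cylinders: "\<And>N a. a \<in> range (truncate_levels N) \<Longrightarrow> measure_pmf.expectation \<pi> (genO lam q u (cylinder N a)) = 0"
  shows "equilibrium lam q u \<pi>"
proof -
  have top: "w k = \<infinity>" if w: "w \<in> set_pmf \<pi>" and k: "0 < u k" for w k
  proof (cases "k = 0")
    case True
    then show ?thesis
      using OmegaS_zero[OF subsetD[OF \<pi> w]] by simp
  next
    case False
    then show ?thesis
      using k by (intro infinite_if_expectation_below_zero[where c="u k", OF below _ w]) auto
  qed
  then have "measure_pmf.prob \<pi> {w. w k = \<infinity>} = 1" if "0 < u k" for k
    using that by (simp add: measure_pmf.prob_eq_1 AE_measure_pmf_iff)
  moreover have "stationaryO lam q u \<pi>"
    using u \<pi> top cylinders by (rule stationaryO_if_cylinders)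
  ultimately show ?thesis
    using \<pi> by (simp add: equilibrium_def)
qed

lemma AE_equilibrium:
  assumes x: "x \<in> Dsp" and d: "disintegrates \<mu> \<kappa>" and zero: "limit_identities lam q (x, \<mu>)"
  shows "AE s in lborel. 0 < s \<longrightarrow> equilibrium lam q (x s) (\<kappa> s)"
proof -
  have "AE s in lborel. \<forall>k\<in>{1..}. \<forall>N. 0 < s \<longrightarrow>
      measure_pmf.expectation (\<kappa> s) (\<lambda>w. x s k * indicator {..<enat N} (w k)) = 0"
    using zero unfolding limit_identities_def AE_all_countable
    by (intro AE_ball_countable' allI AE_all_countable[THEN iffD2] AE_expectation_zero[OF observable_level_below x d]) auto
  moreover have "AE s in lborel. \<forall>N. \<forall>a\<in>range (truncate_levels N). 0 < s \<longrightarrow>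
      measure_pmf.expectation (\<kappa> s) (genO lam q (x s) (cylinder N a)) = 0"
    using zero unfolding limit_identities_def
    by (intro AE_ball_countable' allI AE_all_countable[THEN iffD2]
        AE_expectation_zero[OF observable_genO[OF continuous_on_cylinder abs_cylinder_le depends_on_levels_cylinder] x d]
        countable_finite finite_range_truncate_levels) auto
  ultimately show ?thesis
  proof eventually_elim
    case (elim s)
    show ?case
      by (intro impI equilibriumI Dsp_Uset[OF x] disintegrates_support[OF d]) (use elim in auto)
  qed
qed

lemma equilibrium_kernel:
  assumes x: "x \<in> Dsp" and \<mu>: "\<mu> \<in> Lset" and zero: "limit_identities lam q (x, \<mu>)"
  obtains \<pi> where "disintegrates \<mu> \<pi>" "\<And>s. 0 < s \<Longrightarrow> equilibrium lam q (x s) (\<pi> s)"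
proof -
  obtain \<kappa> where \<kappa>: "disintegrates \<mu> \<kappa>"
    using Lset_disintegration[OF \<mu>] .
  obtain N where N: "N \<in> null_sets lborel" "\<And>s. s \<notin> N \<Longrightarrow> 0 < s \<Longrightarrow> equilibrium lam q (x s) (\<kappa> s)"
    using AE_equilibrium[OF x \<kappa> zero] unfolding eventually_ae_filter by auto
  have top: "(\<lambda>_. \<infinity>) \<in> OmegaS"
    by (simp add: OmegaS_def)
  show thesis
  proof
    show "disintegrates \<mu> (\<lambda>s. if s \<in> N then return_pmf (\<lambda>_. \<infinity>) else \<kappa> s)"
      using \<kappa> N(1) top by (rule disintegrates_modify)
    show "equilibrium lam q (x s) (if s \<in> N then return_pmf (\<lambda>_. \<infinity>) else \<kappa> s)" if "0 < s" for s
      using N(2) that top stationaryO_infinite by (auto simp: equilibrium_def)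
  qed
qed

lemma flow_equation:
  assumes x: "x \<in> Dsp" and d: "disintegrates \<mu> \<pi>" and zero: "limit_identities lam q (x, \<mu>)"
    and k: "1 \<le> k" and t: "0 \<le> t"
  shows "x t k = x 0 k + (LINT s:{0..t}|lborel. fluid_drift lam q (x s) (\<pi> s) k)"
proof -
  define I where "I s = (LINT r:{0..s}|lborel. fluid_drift lam q (x r) (\<pi> r) k)" for s
  define h where "h s = x s k - x 0 k - I s" for s
  have "set_integrable lborel {0..b} h" for b
  proof (cases "0 \<le> b")
    case True
    from flow_defect_disintegrates(1)[OF x d this] show ?thesis
      unfolding h_def[abs_def] I_def .
  qed (simp add: set_integrable_def)
  moreover have "(LINT s:{0..b}|lborel. h s) = 0" if "b \<in> \<rat>" "0 < b" for b
    using flow_defect_disintegrates(2)[OF x d, of b k] zero k that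
    unfolding h_def I_def limit_identities_def by simp
  ultimately have "AE s in lborel. 0 < s \<longrightarrow> h s = 0"
    by (rule AE_zero_if_integrals_zero)
  moreover have "(h \<longlongrightarrow> h t) (at_right t)"
    unfolding h_def
  proof (intro tendsto_diff tendsto_const)
    show "((\<lambda>s. x s k) \<longlongrightarrow> x t k) (at_right t)"
      using continuous_on_tendsto_compose[OF continuous_on_product_coordinates Dsp_right_continuous[OF x t]] by simp
    have "continuous_on {t..t + 1} I"
      using continuous_on_integral_upto[OF fluid_drift_integrable[OF x d]] unfolding I_def
      by (rule continuous_on_subset) (use t in auto)
    then show "(I \<longlongrightarrow> I t) (at_right t)"
      by (rule continuous_on_Icc_at_rightD) simp
  qed
  ultimately have "h t = 0"
    using t by (rule zero_if_AE_zero_right_continuous)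
  then show ?thesis
    by (simp add: h_def I_def)
qed

lemma flow_derivative:
  assumes x: "x \<in> Dsp" and d: "disintegrates \<mu> \<pi>" and zero: "limit_identities lam q (x, \<mu>)" and k: "1 \<le> k"
  shows "AE t in lborel. 0 < t \<longrightarrow> ((\<lambda>\<tau>. x \<tau> k) has_real_derivative fluid_drift lam q (x t) (\<pi> t) k) (at t)"
proof -
  have "AE t in lborel. 0 < t \<longrightarrow>
      ((\<lambda>\<tau>. LINT s:{0..\<tau>}|lborel. fluid_drift lam q (x s) (\<pi> s) k) has_real_derivative fluid_drift lam q (x t) (\<pi> t) k) (at t)"
    by (rule lebesgue_differentiation[OF fluid_drift_integrable[OF x d]])
  then show ?thesis
  proof (eventually_elim, intro impI)
    fix t :: real
    assume "0 < t" and "0 < t \<longrightarrow>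
      ((\<lambda>\<tau>. LINT s:{0..\<tau>}|lborel. fluid_drift lam q (x s) (\<pi> s) k) has_real_derivative fluid_drift lam q (x t) (\<pi> t) k) (at t)"
    then have "((\<lambda>\<tau>. x 0 k + (LINT s:{0..\<tau>}|lborel. fluid_drift lam q (x s) (\<pi> s) k))
        has_real_derivative 0 + fluid_drift lam q (x t) (\<pi> t) k) (at t)"
      by (intro DERIV_add DERIV_const) simp
    then have "((\<lambda>\<tau>. x 0 k + (LINT s:{0..\<tau>}|lborel. fluid_drift lam q (x s) (\<pi> s) k))
        has_real_derivative fluid_drift lam q (x t) (\<pi> t) k) (at t)"
      by simp
    then show "((\<lambda>\<tau>. x \<tau> k) has_real_derivative fluid_drift lam q (x t) (\<pi> t) k) (at t)"
    proof (rule has_field_derivative_transform_within_open[where S="{0<..}"])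
      show "x 0 k + (LINT s:{0..\<tau>}|lborel. fluid_drift lam q (x s) (\<pi> s) k) = x \<tau> k" if "\<tau> \<in> {0<..}" for \<tau>
        using flow_equation[OF x d zero k, of \<tau>] that by simp
    qed (use \<open>0 < t\<close> in auto)
  qed
qed

end

locale lcq_limit = lcq_parameters lam q + prob_space P for lam q :: real and P :: "'b measure" +
  fixes r :: "nat \<Rightarrow> nat" and M :: "nat \<Rightarrow> 'a measure" and X :: "nat \<Rightarrow> 'a \<Rightarrow> real \<Rightarrow> nat \<Rightarrow> nat"
    and V :: "'b \<Rightarrow> DL"
  assumes subsequence: "strict_mono r" and size_pos: "\<And>j. 0 < r j"
    and chains: "\<And>j. lcq_chain lam q (r j) (M j) (X j)"
    and limit_values: "\<And>x. V x \<in> Dsp \<times> Lset"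
    and convergence: "conv_dist M (\<lambda>j x. scaled_system (r j) (X j x)) P V"
begin

sublocale system: lcq_system lam q "r j" "M j" "X j" for j
  by unfold_locales (rule chains size_pos)+

lemma inverse_size_tendsto: "(\<lambda>j. c / real (r j)) \<longlonglongrightarrow> 0"
proof -
  have "(\<lambda>j. c * (1 / real (r j))) \<longlonglongrightarrow> c * 0"
    using LIMSEQ_subseq_LIMSEQ[OF lim_1_over_n subsequence]
    by (intro tendsto_mult_left) (simp add: comp_def)
  then show ?thesis
    by simp
qed

lemma sqrt_inverse_size_tendsto: "(\<lambda>j. sqrt (c / real (r j))) \<longlonglongrightarrow> 0"
  using tendsto_real_sqrt[OF inverse_size_tendsto] by simp

lemmas limit_functional_zero =
  conv_dist_AE_zero[OF convergence _ prob_space_axioms limit_values]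

lemma AE_flow_defect_zero:
  assumes "0 < t" "1 \<le> k"
  shows "AE x in P. flow_defect lam q t k (V x) = 0"
proof (rule limit_functional_zero)
  show "Ftest (flow_defect lam q t k)"
    using assms(1) by (rule Ftest_flow_defect)
  show "(\<lambda>j. t * sqrt ((lam + 1) * t / real (r j))) \<longlonglongrightarrow> 0"
    by (intro tendsto_mult_right_zero sqrt_inverse_size_tendsto)
qed (use system.expectation_abs_flow_defect_le assms in simp)

lemma AE_occ_genO_zero:
  assumes f: "continuous_on UNIV f" "\<And>w. \<bar>f w\<bar> \<le> B" "depends_on_levels N f" and t: "0 < t"
  shows "AE x in P. occ_integral t (\<lambda>s u w. genO lam q u f w) (V x) = 0"
proof (rule limit_functional_zero)
  show "Ftest (occ_integral t (\<lambda>s u w. genO lam q u f w))"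
    by (rule Ftest_occ_integral[OF observable_genO[OF f] t])
  have "(\<lambda>j. 2 * B * (1 / real (r j) + sqrt ((lam + 1) * t / real (r j)))) \<longlonglongrightarrow> 2 * B * (0 + 0)"
    by (intro tendsto_mult_left tendsto_add inverse_size_tendsto sqrt_inverse_size_tendsto)
  then show "(\<lambda>j. 2 * B * (1 / real (r j) + sqrt ((lam + 1) * t / real (r j)))) \<longlonglongrightarrow> 0"
    by simp
qed (use system.expectation_abs_occ_genO_le[OF f] t in simp)

lemma AE_occ_level_below_zero:
  assumes "0 < t" "1 \<le> k"
  shows "AE x in P. occ_integral t (\<lambda>s u w. u k * indicator {..<enat N} (w k)) (V x) = 0"
proof (rule limit_functional_zero)
  show "Ftest (occ_integral t (\<lambda>s u w. u k * indicator {..<enat N} (w k)))"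
    by (rule Ftest_occ_integral[OF observable_level_below assms(1)])
  show "(\<lambda>j. real N * t / real (r j)) \<longlonglongrightarrow> 0"
    by (rule inverse_size_tendsto)
qed (use system.expectation_abs_occ_level_below_le assms in simp)

lemma AE_limit_identities: "AE x in P. limit_identities lam q (V x)"
proof -
  have levels: "countable ({1..} :: nat set)" and times: "countable (\<rat> \<inter> {0<..} :: real set)"
    and cylinders: "countable (range (truncate_levels N))" for N
    by (auto intro: countable_rat countable_Int1 countable_finite finite_range_truncate_levels)
  show ?thesis
    unfolding limit_identities_def
    by (intro AE_ball_countable'[OF _ levels] AE_ball_countable'[OF _ times] AE_ball_countable'[OF _ cylinders]
        AE_conjI AE_all_countable[THEN iffD2] allI AE_flow_defect_zero AE_occ_level_below_zero
        AE_occ_genO_zero[OF continuous_on_cylinder abs_cylinder_le depends_on_levels_cylinder]) auto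
qed

end

theorem theorem4p1:
  fixes lam q :: real
    and r :: "nat \<Rightarrow> nat"
    and M :: "nat \<Rightarrow> 'a measure"
    and X :: "nat \<Rightarrow> 'a \<Rightarrow> real \<Rightarrow> nat \<Rightarrow> nat"
    and P :: "'b measure"
    and v :: "'b \<Rightarrow> real \<Rightarrow> nat \<Rightarrow> real"
    and chi :: "'b \<Rightarrow> (real \<times> (nat \<Rightarrow> enat)) measure"
  assumes "0 < lam" and "lam < 1" and "0 < q" and "q \<le> 1"
    and "strict_mono r" and "\<forall>j. 0 < r j"
    and "\<forall>j. lcq_chain lam q (r j) (M j) (X j)"
    and "prob_space P"
    and "\<forall>x. v x \<in> Dsp \<and> chi x \<in> Lset"
    and "conv_dist M (\<lambda>j x. (\<lambda>t. uOf (r j) (X j x t), occ (X j x))) P (\<lambda>x. (v x, chi x))"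
  shows "AE x in P. \<exists>\<pi> :: real \<Rightarrow> (nat \<Rightarrow> enat) pmf.
     (\<forall>s>0. set_pmf (\<pi> s) \<subseteq> OmegaS \<and> stationaryO lam q (v x s) (\<pi> s) \<and>
            (\<forall>k. 0 < v x s k \<longrightarrow> measure_pmf.prob (\<pi> s) {w. w k = \<infinity>} = 1)) \<and>
     (\<forall>t>0. \<forall>A \<subseteq> OmegaS.
            set_integrable lborel {0..t} (\<lambda>s. measure_pmf.prob (\<pi> s) A) \<and>
            measure (chi x) ({0..<t} \<times> A) = (LINT s:{0..t}|lborel. measure_pmf.prob (\<pi> s) A)) \<and>
     (\<forall>k\<ge>1.
        (\<forall>t\<ge>0. set_integrable lborel {0..t}
                  (\<lambda>s. lam * (v x s (k - 1) - v x s k)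
                       - measure_pmf.expectation (\<pi> s) (\<lambda>w. pw q (w (Suc k)) - pw q (w k))) \<and>
                v x t k = v x 0 k + (LINT s:{0..t}|lborel. lam * (v x s (k - 1) - v x s k)
                       - measure_pmf.expectation (\<pi> s) (\<lambda>w. pw q (w (Suc k)) - pw q (w k)))) \<and>
        (AE t in lborel. 0 < t \<longrightarrow>
           ((\<lambda>\<tau>. v x \<tau> k) has_real_derivative
              (lam * (v x t (k - 1) - v x t k)
               - measure_pmf.expectation (\<pi> t) (\<lambda>w. pw q (w (Suc k)) - pw q (w k)))) (at t)))"
proof -
  interpret lcq_limit lam q P r M X "\<lambda>x. (v x, chi x)"
    by (intro lcq_limit.intro lcq_parameters.intro lcq_limit_axioms.intro)
      (use assms in \<open>simp_all add: scaled_system_def\<close>)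
  note drift = fluid_drift_def arrival_rate_def departure_rate_def
  from AE_limit_identities show ?thesis
  proof eventually_elim
    case (elim x)
    have x: "v x \<in> Dsp" and \<chi>: "chi x \<in> Lset"
      using assms(9) by auto
    obtain \<pi> where \<pi>: "disintegrates (chi x) \<pi>" "\<And>s. 0 < s \<Longrightarrow> equilibrium lam q (v x s) (\<pi> s)"
      using equilibrium_kernel[OF x \<chi> elim] by blast
    show ?case
      by (intro exI[of _ \<pi>] conjI allI impI \<pi>(2)[unfolded equilibrium_def, THEN conjunct1]
        \<pi>(2)[unfolded equilibrium_def, THEN conjunct2, THEN conjunct1]
        \<pi>(2)[unfolded equilibrium_def, THEN conjunct2, THEN conjunct2, rule_format]
        disintegrates_prob[OF \<pi>(1) \<chi>] fluid_drift_integrable[OF x \<pi>(1), unfolded drift]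
        flow_equation[OF x \<pi>(1) elim, unfolded drift] flow_derivative[OF x \<pi>(1) elim, unfolded drift])
  qed
qed

end
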